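(* Let $A$ be a self-adjoint operator on a Hilbert space $X$ with spectrum contained in $(-\infty,a]$ for some $a\in\mathbb{R}$. Then $A$ has the $p$-Weiss property for control operators if $p\le 2$ (where $p\in[1,\infty]$, as in the definition of the $p$-Weiss property).
   Context: Let $A$ generate a $C_0$-semigroup $T=(T(t))_{t\ge0}$ on a Banach space $X$, and write $R(\lambda,A)=(\lambda I-A)^{-1}$ for the resolvent. $X_{-1}$ is the completion of $X$ with respect to the norm $\|z\|_{X_{-1}}=\|(sI-A)^{-1}z\|_X$ for some $s$ in the resolvent set $\rho(A)$. The semigroup and the resolvent extend to $X_{-1}$ (same notation), and $R(\lambda,A)$ maps $X_{-1}$ boundedly into $X$. For a Banach space $U$ and $p\in[1,\infty]$, an operator $B\in\mathcal{L}(U,X_{-1})$ is infinite-time $L^p$-admissible (or $p$-admissible) for $A$ if for every $t\ge0$ and $u\in L^p([0,t],U)$ the integral $\int_0^tT(t-s)Bu(s)\,ds$ lies in $X$ and there is a constant $C>0$, independent of $t$, with $\|\int_0^tT(t-s)Bu(s)\,ds\|_X\le C\|u\|_{L^p([0,t],U)}$ for all such $t,u$. For $p\in[1,\infty]$, the $p$-Weiss property for control operators holds for $A$ if for any Banach space $U$ and any $B\in\mathcal{L}(U,X_{-1})$ one has the equivalence $$B\text{ is infinite-time }p\text{-admissible}\iff\sup_{\operatorname{Re}\lambda>0}(\operatorname{Re}\lambda)^{1/p}\|R(\lambda,A)B\|_{\mathcal{L}(U,X)}<\infty.$$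
   Formalization: Since a may be positive, R(λ,A) need not exist for all Re λ>0 (e.g. A=1 on ℂ, λ=1); the supremum in the p-Weiss condition is therefore taken over those λ in the resolvent set ρ(A) with Re λ>0, which changes nothing when the spectrum does not meet Re λ>0. *)

theory Defs
  imports "HOL-Analysis.Analysis"
begin

class complex_vector = real_vector +
  fixes scaleC :: "complex \<Rightarrow> 'a \<Rightarrow> 'a" (infixr \<open>*\<^sub>C\<close> 75)
  assumes scaleC_add_right: "c *\<^sub>C (x + y) = c *\<^sub>C x + c *\<^sub>C y"
    and scaleC_add_left: "(c + d) *\<^sub>C x = c *\<^sub>C x + d *\<^sub>C x"
    and scaleC_scaleC: "c *\<^sub>C (d *\<^sub>C x) = (c * d) *\<^sub>C x"
    and scaleC_of_real: "complex_of_real r *\<^sub>C x = r *\<^sub>R x"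

class complex_normed_vector = complex_vector + real_normed_vector +
  assumes norm_scaleC: "norm (c *\<^sub>C x) = cmod c * norm x"

class cbanach = complex_normed_vector + complete_space

class complex_inner = complex_normed_vector +
  fixes cinner :: "'a \<Rightarrow> 'a \<Rightarrow> complex"
  assumes cinner_commute: "cinner x y = cnj (cinner y x)"
    and cinner_add_left: "cinner (x + y) z = cinner x z + cinner y z"
    and cinner_scaleC_left: "cinner (c *\<^sub>C x) y = c * cinner x y"
    and cinner_self_norm: "cinner x x = complex_of_real ((norm x)\<^sup>2)"

class chilbert_space = complex_inner + cbanach

definition bounded_clinear :: "('a::complex_normed_vector \<Rightarrow> 'b::complex_normed_vector) \<Rightarrow> bool" where
  "bounded_clinear f \<longleftrightarrow> bounded_linear f \<and> (\<forall>c x. f (c *\<^sub>C x) = c *\<^sub>C f x)"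

text \<open>An operator with domain \<open>D\<close> is the partial map with \<open>dom A = D\<close>, so that equality of
  operators is equality of domains and of values.\<close>

type_synonym 'a unbounded_op = "'a \<rightharpoonup> 'a"

definition clinear_op :: "'a::complex_vector unbounded_op \<Rightarrow> bool" where
  "clinear_op A \<longleftrightarrow> A 0 = Some 0
    \<and> (\<forall>x y v w. A x = Some v \<longrightarrow> A y = Some w \<longrightarrow> A (x + y) = Some (v + w))
    \<and> (\<forall>c x v. A x = Some v \<longrightarrow> A (c *\<^sub>C x) = Some (c *\<^sub>C v))"

definition adjoint_op :: "'a::complex_inner unbounded_op \<Rightarrow> 'a unbounded_op" where
  "adjoint_op A = (\<lambda>y.
     if \<exists>z. \<forall>x\<in>dom A. cinner (the (A x)) y = cinner x z
     then Some (THE z. \<forall>x\<in>dom A. cinner (the (A x)) y = cinner x z)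
     else None)"

definition self_adjoint :: "'a::complex_inner unbounded_op \<Rightarrow> bool" where
  "self_adjoint A \<longleftrightarrow> clinear_op A \<and> closure (dom A) = UNIV \<and> adjoint_op A = A"

definition resolvent :: "complex \<Rightarrow> 'a::complex_vector unbounded_op \<Rightarrow> 'a \<Rightarrow> 'a" where
  "resolvent l A = inv_into (dom A) (\<lambda>x. l *\<^sub>C x - the (A x))"

definition resolvent_set :: "'a::complex_normed_vector unbounded_op \<Rightarrow> complex set" where
  "resolvent_set A = {l. bij_betw (\<lambda>x. l *\<^sub>C x - the (A x)) (dom A) UNIV
                        \<and> bounded_clinear (resolvent l A)}"

definition spectrum :: "'a::complex_normed_vector unbounded_op \<Rightarrow> complex set" where
  "spectrum A = - resolvent_set A"

definition C0_semigroup :: "(real \<Rightarrow> 'a::complex_normed_vector \<Rightarrow> 'a) \<Rightarrow> bool" where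
  "C0_semigroup T \<longleftrightarrow>
     (\<forall>t\<ge>0. bounded_clinear (T t)) \<and> T 0 = id
     \<and> (\<forall>s\<ge>0. \<forall>t\<ge>0. T (s + t) = T s \<circ> T t)
     \<and> (\<forall>x. ((\<lambda>t. T t x) \<longlongrightarrow> x) (at_right 0))"

definition generator :: "(real \<Rightarrow> 'a::complex_normed_vector \<Rightarrow> 'a) \<Rightarrow> 'a unbounded_op" where
  "generator T = (\<lambda>x.
     if \<exists>y. ((\<lambda>h. (1 / h) *\<^sub>R (T h x - x)) \<longlongrightarrow> y) (at_right 0)
     then Some (THE y. ((\<lambda>h. (1 / h) *\<^sub>R (T h x - x)) \<longlongrightarrow> y) (at_right 0))
     else None)"

definition generates :: "'a::complex_normed_vector unbounded_op \<Rightarrow> (real \<Rightarrow> 'a \<Rightarrow> 'a) \<Rightarrow> bool" where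
  "generates A T \<longleftrightarrow> C0_semigroup T \<and> generator T = A"

text \<open>A completion of \<open>X\<close> for the norm \<open>\<parallel>R(s,A) z\<parallel>\<close> is a Banach space \<open>Y\<close> together with a linear map
  \<open>j : X \<rightarrow> Y\<close> of dense range that is isometric for that norm; it is unique up to isometric
  isomorphism. The map \<open>j\<close> is the inclusion of \<open>X\<close> into its completion.\<close>

definition extrapolation_space ::
    "'x::cbanach unbounded_op \<Rightarrow> ('x \<Rightarrow> 'y::cbanach) \<Rightarrow> bool" where
  "extrapolation_space A j \<longleftrightarrow> bounded_clinear j \<and> closure (range j) = UNIV
     \<and> (\<exists>s\<in>resolvent_set A. \<forall>z. norm (j z) = norm (resolvent s A z))"

text \<open>The continuous extension, along the inclusion \<open>j\<close>, of a linear map defined on \<open>X\<close>.\<close>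

definition ext_along :: "('x::cbanach \<Rightarrow> 'y::cbanach) \<Rightarrow> ('x \<Rightarrow> 'z::cbanach) \<Rightarrow> 'y \<Rightarrow> 'z" where
  "ext_along j S = (THE S'. bounded_clinear S' \<and> (\<forall>z. S' (j z) = S z))"

definition ext_semigroup ::
    "('x::cbanach \<Rightarrow> 'y::cbanach) \<Rightarrow> (real \<Rightarrow> 'x \<Rightarrow> 'x) \<Rightarrow> real \<Rightarrow> 'y \<Rightarrow> 'y" where
  "ext_semigroup j T t = ext_along j (j \<circ> T t)"

definition ext_resolvent ::
    "('x::cbanach \<Rightarrow> 'y::cbanach) \<Rightarrow> complex \<Rightarrow> 'x unbounded_op \<Rightarrow> 'y \<Rightarrow> 'x" where
  "ext_resolvent j l A = ext_along j (resolvent l A)"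

text \<open>The library's Bochner integral requires a second countable target type. The definitions below
  replace Borel measurability by strong measurability, which is the notion needed for possibly
  non-separable Banach spaces.\<close>

definition strongly_measurable :: "'a measure \<Rightarrow> ('a \<Rightarrow> 'b::real_normed_vector) \<Rightarrow> bool" where
  "strongly_measurable M f \<longleftrightarrow>
     (\<exists>g. (\<forall>n::nat. simple_function M (g n)) \<and> (AE x in M. (\<lambda>n. g n x) \<longlonglongrightarrow> f x))"

definition has_strong_integral ::
    "'a measure \<Rightarrow> ('a \<Rightarrow> 'b::real_normed_vector) \<Rightarrow> 'b \<Rightarrow> bool" where
  "has_strong_integral M f I \<longleftrightarrow> strongly_measurable M f
     \<and> (\<exists>g. (\<forall>n::nat. Bochner_Integration.simple_bochner_integrable M (g n))
          \<and> (\<lambda>n. \<integral>\<^sup>+x. ennreal (norm (f x - g n x)) \<partial>M) \<longlonglongrightarrow> 0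
          \<and> (\<lambda>n. Bochner_Integration.simple_bochner_integral M (g n)) \<longlonglongrightarrow> I)"

definition Lp_space :: "ennreal \<Rightarrow> 'a measure \<Rightarrow> ('a \<Rightarrow> 'b::real_normed_vector) set" where
  "Lp_space p M = {f. strongly_measurable M f \<and>
     (if p = \<infinity> then \<exists>c. AE x in M. norm (f x) \<le> c
      else integrable M (\<lambda>x. norm (f x) powr enn2real p))}"

definition Lp_norm :: "ennreal \<Rightarrow> 'a measure \<Rightarrow> ('a \<Rightarrow> 'b::real_normed_vector) \<Rightarrow> real" where
  "Lp_norm p M f =
     (if p = \<infinity> then Inf {c. 0 \<le> c \<and> (AE x in M. norm (f x) \<le> c)}
      else (\<integral>x. norm (f x) powr enn2real p \<partial>M) powr (1 / enn2real p))"

text \<open>An element of the extrapolation space lies in \<open>X\<close> iff it is of the form \<open>j x\<close>, and its norm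
  in \<open>X\<close> is then the norm of \<open>x\<close>.\<close>

definition infinite_time_admissible ::
    "ennreal \<Rightarrow> (real \<Rightarrow> 'x::cbanach \<Rightarrow> 'x) \<Rightarrow> ('x \<Rightarrow> 'y::cbanach) \<Rightarrow> ('u::cbanach \<Rightarrow> 'y) \<Rightarrow> bool" where
  "infinite_time_admissible p T j B \<longleftrightarrow>
     (\<exists>C>0. \<forall>t\<ge>0. \<forall>u\<in>Lp_space p (lebesgue_on {0..t}).
        \<exists>x. has_strong_integral (lebesgue_on {0..t})
               (\<lambda>s. ext_semigroup j T (t - s) (B (u s))) (j x)
          \<and> norm x \<le> C * Lp_norm p (lebesgue_on {0..t}) u)"

text \<open>The supremum is taken over those \<open>\<lambda>\<close> in the open right half-plane for which \<open>R(\<lambda>,A)\<close> exists.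
  Note that \<open>inverse \<infinity> = 0\<close>, so the exponent is \<open>0\<close> for \<open>p = \<infinity>\<close>.\<close>

definition weiss_resolvent_condition ::
    "ennreal \<Rightarrow> 'x::cbanach unbounded_op \<Rightarrow> ('x \<Rightarrow> 'y::cbanach) \<Rightarrow> ('u::cbanach \<Rightarrow> 'y) \<Rightarrow> bool" where
  "weiss_resolvent_condition p A j B \<longleftrightarrow>
     bdd_above ((\<lambda>l. Re l powr enn2real (inverse p) * onorm (ext_resolvent j l A \<circ> B))
                ` {l \<in> resolvent_set A. 0 < Re l})"

text \<open>The semigroup generated by \<open>A\<close> is unique on \<open>t \<ge> 0\<close>. The quantification over all Banach spaces
  \<open>U\<close> is expressed by the type argument.\<close>

definition weiss_property ::
    "'u::cbanach itself \<Rightarrow> ennreal \<Rightarrow> 'x::cbanach unbounded_op \<Rightarrow> ('x \<Rightarrow> 'y::cbanach) \<Rightarrow> bool" where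
  "weiss_property U p A j \<longleftrightarrow>
     (\<exists>T. generates A T \<and>
        (\<forall>B :: 'u \<Rightarrow> 'y. bounded_clinear B \<longrightarrow>
           (infinite_time_admissible p T j B \<longleftrightarrow> weiss_resolvent_condition p A j B)))"

end

theory Submission
  imports Defs "HOL-Complex_Analysis.Complex_Analysis"
begin

text \<open>
  The extended resolvent \<open>E = R(s, A)\<close> maps \<open>X\<^sub>-\<^sub>1\<close> isometrically onto \<open>X\<close>, so one may work with \<open>b = E B : U \<rightarrow> X\<close>:
  the extended \<open>R(l, A) B\<close> becomes \<open>(s - A) R(l, A) b\<close>, and an element of \<open>X\<^sub>-\<^sub>1\<close> lies in \<open>X\<close> iff its image lies
  in the domain of \<open>A\<close>.

  Necessity: for the input \<open>r \<mapsto> exp(- l (t - r)) v\<close> the state is \<open>y - exp(- l t) T(t) y\<close> with \<open>y = R(l, A) B v\<close>. For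
  \<open>t = \<pi> / |Im l|\<close> this is \<open>y + exp(- t Re l) T(t) y\<close>, whose norm is at least \<open>\<parallel>y\<parallel>\<close> because \<open>T(t)\<close> is positive.
  Real \<open>l\<close> are limits of nonreal ones.

  Sufficiency: the resolvent condition forces \<open>b v\<close> into the part of \<open>X\<close> on which \<open>T\<close> is contractive, where
  \<open>\<parallel>A T(t)\<parallel> \<le> 2 / t\<close>; hence \<open>\<parallel>T(t) B\<parallel> \<le> K t\<^sup>-\<^sup>k\<close> with \<open>k = 1 - 1 / p\<close>. As \<open>T\<close> is self-adjoint,
  \<open>\<langle>T(\<sigma>) B v, T(\<tau>) B w\<rangle> = \<langle>T(m) B v, T(m) B w\<rangle>\<close> with \<open>m = (\<sigma> + \<tau>) / 2\<close>, so that
  \<open>\<parallel>\<integral> T(\<tau>) B u(\<tau>) d\<tau>\<parallel>\<^sup>2 \<le> K' \<integral>\<integral> (\<sigma> + \<tau>)\<^sup>-\<^sup>2\<^sup>k \<parallel>u(\<sigma>)\<parallel> \<parallel>u(\<tau>)\<parallel> d\<sigma> d\<tau>\<close>. For \<open>p \<le> 2\<close> this is bounded by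
  \<open>\<parallel>u\<parallel>\<^sub>p\<^sup>2\<close>, by interpolation between the trivial case \<open>p = 1\<close> and Hilbert's inequality, \<open>p = 2\<close>.

  No spectral theorem is used: \<open>T(t)\<close> is the limit of \<open>(1 - t A / n)\<^sup>-\<^sup>n\<close> along \<open>n = 2\<^sup>k\<close>.
\<close>

subsection \<open>Complex normed and inner product spaces\<close>

text \<open>Two obstacles shape the argument. First, \<open>a\<close> may be positive, and the
  resolvent condition is a supremum over resolvent points only, so it says nothing directly about
  spectrum in \<open>(0, a]\<close>. Without spectral projections, the relevant spectral subspace is
  described by the growth of orbits. The condition is turned into growth through scalar functions:
  \<open>\<langle>R(l) y, y\<rangle>\<close> continues holomorphically across the possible spectrum,
  Cauchy's estimate bounds the moments of \<open>R(r)\<close> at \<open>y\<close> in terms of the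
  distance from \<open>r\<close> to the imaginary axis rather than to \<open>a\<close>, and repeated
  squaring removes the constants. Second, the integral of \<open>T(t - r) b u(r)\<close> exists in
  \<open>X\<close> at once, but it must be shown to lie in the domain of \<open>A\<close>, and
  \<open>s - A\<close> cannot simply be moved under the integral. It is regularised to the bounded
  operators \<open>Sm e = (s - A) T(e)\<close>. The estimates are uniform in \<open>e\<close>, which
  also keeps the Hilbert kernel away from its singularity, and closedness of \<open>A\<close> gives
  the limit.\<close>

lemma bounded_bilinear_scaleC:
  "bounded_bilinear (scaleC :: complex \<Rightarrow> 'a::complex_normed_vector \<Rightarrow> 'a)"
proof
  fix a a' :: complex and b b' :: 'a and r :: real
  show "(a + a') *\<^sub>C b = a *\<^sub>C b + a' *\<^sub>C b" by (rule scaleC_add_left)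
  show "a *\<^sub>C (b + b') = a *\<^sub>C b + a *\<^sub>C b'" by (rule scaleC_add_right)
  show "(r *\<^sub>R a) *\<^sub>C b = r *\<^sub>R (a *\<^sub>C b)"
    by (metis scaleC_of_real scaleC_scaleC scaleR_conv_of_real)
  show "a *\<^sub>C (r *\<^sub>R b) = r *\<^sub>R (a *\<^sub>C b)"
    by (metis scaleC_of_real scaleC_scaleC mult.commute)
  show "\<exists>K. \<forall>a b. norm (a *\<^sub>C b :: 'a) \<le> norm a * norm b * K"
    by (intro exI[of _ 1]) (simp add: norm_scaleC)
qed

interpretation scaleC: bounded_bilinear "scaleC :: complex \<Rightarrow> 'a::complex_normed_vector \<Rightarrow> 'a"
  by (rule bounded_bilinear_scaleC)

lemma scaleC_one [simp]: "1 *\<^sub>C (x::'a::complex_vector) = x"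
  using scaleC_of_real[of 1 x] by simp

lemma cinner_add_right: "cinner x (y + z) = cinner x y + cinner x (z::'a::complex_inner)"
  by (metis cinner_add_left cinner_commute complex_cnj_add)

lemma cinner_scaleC_right: "cinner x (c *\<^sub>C y) = cnj c * cinner x (y::'a::complex_inner)"
  by (metis cinner_scaleC_left cinner_commute complex_cnj_mult)

lemma cinner_scaleR_left: "cinner (r *\<^sub>R x) y = r * cinner x (y::'a::complex_inner)"
  by (metis cinner_scaleC_left scaleC_of_real)

lemma cinner_scaleR_right: "cinner x (r *\<^sub>R y) = r * cinner x (y::'a::complex_inner)"
  by (metis cinner_scaleC_right scaleC_of_real complex_cnj_complex_of_real)

lemma cinner_diff_left: "cinner (x - y) z = cinner x z - cinner y (z::'a::complex_inner)"
  using cinner_add_left[of "x - y" y z] by simp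

lemma cinner_diff_right: "cinner x (y - z) = cinner x y - cinner x (z::'a::complex_inner)"
  using cinner_add_right[of x "y - z" z] by simp

lemma cinner_mult_commute: "cinner x y * cinner y x = complex_of_real ((cmod (cinner x (y::'a::complex_inner)))\<^sup>2)"
  by (metis cinner_commute complex_norm_square)

text \<open>Cauchy-Schwarz, from the squared distance of \<open>x\<close> to its orthogonal
  projection \<open>c *\<^sub>C y\<close> onto the line of \<open>y\<close>.\<close>

lemma norm_cinner_le: "cmod (cinner x y) \<le> norm x * norm (y::'a::complex_inner)"
proof (cases "y = 0")
  case True
  have "cinner x (0::'a) = 0" using cinner_diff_right[of x 0 0] by simp
  with True show ?thesis by simp
next
  case False
  define c where "c = cinner x y / complex_of_real ((norm y)\<^sup>2)"
  have n: "complex_of_real ((norm y)\<^sup>2) \<noteq> 0" using False by simp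
  have cy: "c * complex_of_real ((norm y)\<^sup>2) = cinner x y" using n by (simp add: c_def)
  have "complex_of_real ((norm (x - c *\<^sub>C y))\<^sup>2) = cinner (x - c *\<^sub>C y) (x - c *\<^sub>C y)"
    by (simp add: cinner_self_norm)
  also have "\<dots> = cinner x x - c * cinner y x - cnj c * (cinner x y - c * cinner y y)"
    by (simp add: cinner_diff_left cinner_diff_right cinner_scaleC_left cinner_scaleC_right algebra_simps)
  also have "\<dots> = complex_of_real ((norm x)\<^sup>2) - c * cinner y x"
    using cy by (simp add: cinner_self_norm)
  also have "c * cinner y x = complex_of_real ((cmod (cinner x y))\<^sup>2 / (norm y)\<^sup>2)"
    by (simp add: c_def cinner_mult_commute)
  finally have "(norm (x - c *\<^sub>C y))\<^sup>2 = (norm x)\<^sup>2 - (cmod (cinner x y))\<^sup>2 / (norm y)\<^sup>2"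
    by (metis of_real_diff of_real_eq_iff)
  then have "(cmod (cinner x y))\<^sup>2 / (norm y)\<^sup>2 \<le> (norm x)\<^sup>2"
    by (smt (verit) zero_le_power2)
  then have "(cmod (cinner x y))\<^sup>2 \<le> (norm x * norm y)\<^sup>2"
    using False by (simp add: field_simps power_mult_distrib)
  then show ?thesis by (simp add: abs_le_square_iff[symmetric] abs_mult)
qed

lemma bounded_bilinear_cinner:
  "bounded_bilinear (cinner :: 'a::complex_inner \<Rightarrow> 'a \<Rightarrow> complex)"
proof
  show "\<exists>K. \<forall>a b. norm (cinner a (b::'a)) \<le> norm a * norm b * K"
    by (intro exI[of _ 1]) (simp add: norm_cinner_le)
qed (simp_all add: cinner_add_left cinner_add_right cinner_scaleR_left cinner_scaleR_right scaleR_conv_of_real)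

interpretation cinner: bounded_bilinear "cinner :: 'a::complex_inner \<Rightarrow> 'a \<Rightarrow> complex"
  by (rule bounded_bilinear_cinner)

lemma Re_cinner_self: "Re (cinner x x) = (norm (x::'a::complex_inner))\<^sup>2"
  by (simp add: cinner_self_norm)

lemma Re_cinner_commute: "Re (cinner x y) = Re (cinner y (x::'a::complex_inner))"
  by (metis cinner_commute complex_cnj(1) cnj.simps(1))

lemma norm_diff_square:
  "(norm (x - y))\<^sup>2 = (norm x)\<^sup>2 + (norm y)\<^sup>2 - 2 * Re (cinner x (y::'a::complex_inner))"
  using Re_cinner_commute[of x y]
  by (simp add: Re_cinner_self[symmetric] cinner_diff_left cinner_diff_right)

lemma norm_add_square:
  "(norm (x + y))\<^sup>2 = (norm x)\<^sup>2 + (norm y)\<^sup>2 + 2 * Re (cinner x (y::'a::complex_inner))"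
  using Re_cinner_commute[of x y]
  by (simp add: Re_cinner_self[symmetric] cinner_add_left cinner_add_right)

lemma cinner_ext:
  assumes "\<And>z. cinner x z = cinner y (z::'a::complex_inner)"
  shows "x = y"
proof -
  have "cinner (x - y) (x - y) = 0" using assms by (simp add: cinner_diff_left)
  then show ?thesis by (simp add: cinner_self_norm)
qed

lemma bounded_clinear_imp_bounded_linear: "bounded_clinear f \<Longrightarrow> bounded_linear f"
  by (simp add: bounded_clinear_def)

lemma bounded_clinearI:
  assumes "\<And>x y. f (x + y) = f x + f y" and "\<And>c x. f (c *\<^sub>C x) = c *\<^sub>C f x"
    and "\<And>x. norm (f x) \<le> K * norm x"
  shows "bounded_clinear f"
proof -
  have "f (r *\<^sub>R x) = r *\<^sub>R f x" for r x
    by (metis assms(2) scaleC_of_real)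
  then have "bounded_linear f"
    using assms(1,3) by (intro bounded_linear_intro[where K = K]) (auto simp: mult.commute)
  then show ?thesis using assms by (simp add: bounded_clinear_def)
qed

lemma bounded_clinear_comp:
  assumes "bounded_clinear f" "bounded_clinear g"
  shows "bounded_clinear (\<lambda>x. f (g x))"
  using assms bounded_linear_compose[of f g] by (simp add: bounded_clinear_def)

subsection \<open>Strong integrals\<close>

text \<open>Completeness allows \<open>f\<close> to be arbitrary on the exceptional null set:
  setting everything to zero there gives an everywhere convergent sequence with limit
  \<open>h\<close>, and preimages under \<open>f\<close> and \<open>h\<close> differ by a null
  set.\<close>

lemma (in complete_measure) borel_measurable_AE_limit:
  fixes f :: "'a \<Rightarrow> 'b::{real_normed_vector, second_countable_topology}"
  assumes g: "\<And>n. g n \<in> borel_measurable M" and lim: "AE x in M. (\<lambda>n. g n x) \<longlonglongrightarrow> f x"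
  shows "f \<in> borel_measurable M"
proof -
  obtain N where N: "N \<in> null_sets M" "\<And>x. x \<in> space M - N \<Longrightarrow> (\<lambda>n. g n x) \<longlonglongrightarrow> f x"
    using AE_E3[OF lim] by metis
  define h where "h x = (if x \<in> N then 0 else f x)" for x
  have [measurable]: "N \<in> sets M" using N by auto
  have "(\<lambda>x. if x \<in> N then 0 else g n x) \<in> borel_measurable M" for n
    using g by measurable
  moreover have "(\<lambda>n. if x \<in> N then 0 else g n x) \<longlonglongrightarrow> h x" if "x \<in> space M" for x
    using N(2)[of x] that by (auto simp: h_def)
  ultimately have h: "h \<in> borel_measurable M"
    by (rule borel_measurable_LIMSEQ_metric)
  show ?thesis
  proof (rule measurableI)
    fix B :: "'b set" assume "B \<in> sets borel"
    then have "h -` B \<inter> space M \<in> sets M" using h by (rule measurable_sets[rotated])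
    moreover have "AE x in M. x \<in> h -` B \<inter> space M \<longleftrightarrow> x \<in> f -` B \<inter> space M"
      using AE_not_in[OF N(1)] by eventually_elim (auto simp: h_def)
    ultimately show "f -` B \<inter> space M \<in> sets M"
      using in_sets_AE by blast
  qed auto
qed

lemma complete_measure_lebesgue_on:
  assumes "S \<in> sets lebesgue"
  shows "complete_measure (lebesgue_on S)"
proof
  fix A B :: "'a set" assume AB: "A \<subseteq> B" "B \<in> null_sets (lebesgue_on S)"
  then have "B \<in> null_sets lebesgue" "B \<subseteq> S"
    using assms null_sets_restrict_space[of S lebesgue] by auto
  then have "A \<in> null_sets lebesgue" using AB completion.complete2 by blast
  then show "A \<in> sets (lebesgue_on S)"
    using AB \<open>B \<subseteq> S\<close> null_sets_restrict_space[of S lebesgue B] assms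
    by (auto simp: sets_restrict_space_iff null_setsD2)
qed

lemma strongly_measurable_bounded_linear:
  assumes "bounded_linear L" and "strongly_measurable M f"
  shows "strongly_measurable M (\<lambda>x. L (f x))"
proof -
  obtain g where g: "\<And>n::nat. simple_function M (g n)" "AE x in M. (\<lambda>n. g n x) \<longlonglongrightarrow> f x"
    using assms(2) unfolding strongly_measurable_def by blast
  have "AE x in M. (\<lambda>n. L (g n x)) \<longlonglongrightarrow> L (f x)"
    using g(2) by eventually_elim (rule bounded_linear.tendsto[OF assms(1)])
  moreover have "simple_function M (\<lambda>x. L (g n x))" for n
    using simple_function_compose1[OF g(1)[of n], of L] by simp
  ultimately show ?thesis
    unfolding strongly_measurable_def by (intro exI[of _ "\<lambda>n x. L (g n x)"]) auto
qed

text \<open>The integrand \<open>h\<close> may be nonmeasurable here, as happens for norms of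
  strongly measurable functions or for inner integrals. The proof rescales the simple minorants of
  \<open>K * h\<close> by \<open>1/K\<close>.\<close>

lemma nn_integral_cmult_le:
  assumes K: "0 < K"
  shows "(\<integral>\<^sup>+x. ennreal K * h x \<partial>M) \<le> ennreal K * (\<integral>\<^sup>+x. h x \<partial>M)"
proof -
  have "integral\<^sup>S M s \<le> ennreal K * (\<integral>\<^sup>+x. h x \<partial>M)"
    if s: "simple_function M s" "s \<le> (\<lambda>x. ennreal K * h x)" for s
  proof -
    have s': "simple_function M (\<lambda>x. ennreal (1/K) * s x)"
      using simple_function_compose1[OF s(1), of "\<lambda>y. ennreal (1/K) * y"] by simp
    have "integral\<^sup>S M s = (\<integral>\<^sup>Sx. ennreal K * (ennreal (1/K) * s x) \<partial>M)"
      using K by (intro arg_cong[where f = "integral\<^sup>S M"] ext)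
        (simp add: mult.assoc[symmetric] ennreal_mult[symmetric])
    also have "\<dots> = ennreal K * (\<integral>\<^sup>Sx. ennreal (1/K) * s x \<partial>M)"
      using s' by (rule simple_integral_mult)
    also have "\<dots> = ennreal K * (\<integral>\<^sup>+x. ennreal (1/K) * s x \<partial>M)"
      using nn_integral_eq_simple_integral[OF s'] by simp
    also have "\<dots> \<le> ennreal K * (\<integral>\<^sup>+x. h x \<partial>M)"
    proof (intro mult_left_mono nn_integral_mono)
      fix x
      have "ennreal (1/K) * s x \<le> ennreal (1/K) * (ennreal K * h x)"
        using s(2) by (intro mult_left_mono) (auto simp: le_fun_def)
      also have "\<dots> = h x" using K by (simp add: mult.assoc[symmetric] ennreal_mult[symmetric])
      finally show "ennreal (1/K) * s x \<le> h x" .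
    qed simp
    finally show ?thesis .
  qed
  then show ?thesis
    unfolding nn_integral_def[of M "\<lambda>x. ennreal K * h x"] by (intro SUP_least) blast
qed

lemma L1_convergence_bounded_linear:
  assumes L: "bounded_linear L"
    and g: "(\<lambda>n. \<integral>\<^sup>+x. ennreal (norm (f x - g n x)) \<partial>M) \<longlonglongrightarrow> 0"
  shows "(\<lambda>n. \<integral>\<^sup>+x. ennreal (norm (L (f x) - L (g n x))) \<partial>M) \<longlonglongrightarrow> 0"
proof -
  obtain K where K: "K > 0" "\<And>x. norm (L x) \<le> norm x * K"
    using bounded_linear.pos_bounded[OF L] by blast
  have "(\<integral>\<^sup>+x. ennreal (norm (L (f x) - L (g n x))) \<partial>M)
      \<le> ennreal K * (\<integral>\<^sup>+x. ennreal (norm (f x - g n x)) \<partial>M)" for n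
  proof -
    have "(\<integral>\<^sup>+x. ennreal (norm (L (f x) - L (g n x))) \<partial>M)
        \<le> (\<integral>\<^sup>+x. ennreal K * ennreal (norm (f x - g n x)) \<partial>M)"
      using K by (intro nn_integral_mono)
        (simp add: ennreal_mult[symmetric] linear_diff[OF bounded_linear.linear[OF L], symmetric] mult.commute)
    also have "\<dots> \<le> ennreal K * (\<integral>\<^sup>+x. ennreal (norm (f x - g n x)) \<partial>M)"
      using K by (intro nn_integral_cmult_le)
    finally show ?thesis .
  qed
  then have le: "eventually (\<lambda>n. (\<integral>\<^sup>+x. ennreal (norm (L (f x) - L (g n x))) \<partial>M)
      \<le> ennreal K * (\<integral>\<^sup>+x. ennreal (norm (f x - g n x)) \<partial>M)) sequentially"
    by simp
  have "(\<lambda>n. ennreal K * (\<integral>\<^sup>+x. ennreal (norm (f x - g n x)) \<partial>M)) \<longlonglongrightarrow> ennreal K * 0"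
    using g by (intro ennreal_tendsto_cmult) auto
  then show ?thesis
    using tendsto_sandwich[OF _ le tendsto_const] by simp
qed

lemma simple_bochner_integrable_bounded_linear:
  assumes "bounded_linear L" and "Bochner_Integration.simple_bochner_integrable M g"
  shows "Bochner_Integration.simple_bochner_integrable M (\<lambda>x. L (g x))"
  using assms(2) linear_0[OF bounded_linear.linear[OF assms(1)]]
  by (intro Bochner_Integration.simple_bochner_integrable_compose2[of "\<lambda>x y. L x" M g g]) auto

lemma has_strong_integral_bounded_linear:
  assumes L: "bounded_linear L" and f: "has_strong_integral M f I"
  shows "has_strong_integral M (\<lambda>x. L (f x)) (L I)"
proof -
  obtain g where g: "\<And>n::nat. Bochner_Integration.simple_bochner_integrable M (g n)"
     "(\<lambda>n. \<integral>\<^sup>+x. ennreal (norm (f x - g n x)) \<partial>M) \<longlonglongrightarrow> 0"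
     "(\<lambda>n. Bochner_Integration.simple_bochner_integral M (g n)) \<longlonglongrightarrow> I"
    using f unfolding has_strong_integral_def by blast
  have "(\<lambda>n. Bochner_Integration.simple_bochner_integral M (\<lambda>x. L (g n x))) \<longlonglongrightarrow> L I"
    using bounded_linear.tendsto[OF L g(3)]
    by (simp add: Bochner_Integration.simple_bochner_integral_linear[OF bounded_linear.linear[OF L] g(1)])
  then show ?thesis
    unfolding has_strong_integral_def
    using strongly_measurable_bounded_linear[OF L] f
      simple_bochner_integrable_bounded_linear[OF L g(1)] L1_convergence_bounded_linear[OF L g(2)]
    by (auto simp: has_strong_integral_def intro!: exI[of _ "\<lambda>n x. L (g n x)"])
qed

text \<open>The bridge from strong integrals to ordinary ones. It is applied with \<open>L\<close>
  an inner product against a fixed vector, so that all estimates of vector integrals become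
  estimates of scalar integrals.\<close>

lemma has_bochner_integral_strong_integral:
  fixes L :: "'b::real_normed_vector \<Rightarrow> 'c::{real_normed_vector, second_countable_topology}"
  assumes M: "complete_measure M" and L: "bounded_linear L" and f: "has_strong_integral M f I"
  shows "has_bochner_integral M (\<lambda>x. L (f x)) (L I)"
proof -
  have Lf: "has_strong_integral M (\<lambda>x. L (f x)) (L I)"
    by (rule has_strong_integral_bounded_linear[OF L f])
  then obtain g where "\<And>n::nat. simple_function M (g n)" "AE x in M. (\<lambda>n. g n x) \<longlonglongrightarrow> L (f x)"
    unfolding has_strong_integral_def strongly_measurable_def by blast
  then have "(\<lambda>x. L (f x)) \<in> borel_measurable M"
    using complete_measure.borel_measurable_AE_limit[OF M, of g "\<lambda>x. L (f x)"]
      borel_measurable_simple_function by blast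
  moreover obtain h where "\<And>n::nat. Bochner_Integration.simple_bochner_integrable M (h n)"
     "(\<lambda>n. \<integral>\<^sup>+x. ennreal (norm (L (f x) - h n x)) \<partial>M) \<longlonglongrightarrow> 0"
     "(\<lambda>n. Bochner_Integration.simple_bochner_integral M (h n)) \<longlonglongrightarrow> L I"
    using Lf unfolding has_strong_integral_def by blast
  ultimately show ?thesis by (rule has_bochner_integral.intros)
qed

text \<open>Pointwise approximation by simple functions becomes approximation in the L1 sense once
  the simple functions are truncated by a multiple of \<open>w\<close>; their integrals then form a
  Cauchy sequence.\<close>

lemma has_strong_integral_dominated:
  fixes f :: "'a \<Rightarrow> 'b::{real_normed_vector, complete_space}"
  assumes f: "strongly_measurable M f" and w: "integrable M w" and fw: "AE x in M. norm (f x) \<le> w x"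
  shows "\<exists>I. has_strong_integral M f I"
proof -
  obtain g where g: "\<And>n::nat. simple_function M (g n)" "AE x in M. (\<lambda>n. g n x) \<longlonglongrightarrow> f x"
    using f unfolding strongly_measurable_def by blast
  have "AE x in M. (\<lambda>n. g n x) \<longlonglongrightarrow> f x \<and> norm (f x) \<le> w x"
    using g(2) fw by eventually_elim auto
  then obtain N where N: "N \<in> null_sets M"
    and Nx: "\<And>x. x \<in> space M - N \<Longrightarrow> (\<lambda>n. g n x) \<longlonglongrightarrow> f x \<and> norm (f x) \<le> w x"
    by (elim AE_E3) simp
  have [measurable]: "N \<in> sets M" "w \<in> borel_measurable M" using N w by auto
  have [measurable]: "(\<lambda>x. norm (g n x)) \<in> borel_measurable M" for n
    using simple_function_compose1[OF g(1)[of n], of norm] by (intro borel_measurable_simple_function) simp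
  \<comment> \<open>The factor 2 leaves room: where \<open>f x\<close> is nonzero, its norm is
    strictly below \<open>2 * w x\<close>, so the truncation is eventually inactive; where
    \<open>f x = 0\<close>, truncating only decreases the norms of \<open>g n x\<close>.\<close>
  define h where "h n x = (if x \<in> N \<or> norm (g n x) > 2 * w x then 0 else g n x)" for n x
  have hs: "simple_function M (h n)" for n
  proof -
    have "{x \<in> space M. x \<in> N \<or> norm (g n x) > 2 * w x} \<in> sets M" by measurable
    then show ?thesis
      unfolding h_def by (intro simple_function_If) (use g in \<open>auto simp: Int_def conj_commute\<close>)
  qed
  define k where "k x = (if x \<in> N then 0 else f x)" for x
  have lim: "(\<lambda>n. h n x) \<longlonglongrightarrow> k x" if "x \<in> space M" for x
  proof (cases "x \<in> N")
    case False
    then have x: "(\<lambda>n. g n x) \<longlonglongrightarrow> f x" "norm (f x) \<le> w x" using Nx that by auto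
    show ?thesis
    proof (cases "f x = 0")
      case True
      have "(\<lambda>n. h n x) \<longlonglongrightarrow> 0"
        by (rule Lim_null_comparison[OF _ tendsto_norm_zero[of "\<lambda>n. g n x"]])
          (use x(1) True in \<open>auto simp: h_def\<close>)
      then show ?thesis using True False by (simp add: k_def)
    next
      case fx: False
      have "norm (f x) < 2 * w x" using fx x(2) by (smt (verit) zero_less_norm_iff)
      then have "eventually (\<lambda>n. norm (g n x) < 2 * w x) sequentially"
        using order_tendstoD(2)[OF tendsto_norm[OF x(1)]] by blast
      then have "eventually (\<lambda>n. h n x = g n x) sequentially"
        by eventually_elim (use False in \<open>auto simp: h_def\<close>)
      then show ?thesis using x(1) False by (simp add: k_def tendsto_cong)
    qed
  qed (simp add: h_def k_def)
  have hb: "norm (h n x) \<le> 2 * w x \<or> h n x = 0" for n x by (auto simp: h_def)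
  \<comment> \<open>The values of \<open>k\<close> may lie in a nonseparable space, so measurability
    of the scalar function is obtained as a limit of simple functions instead of by
    composition.\<close>
  have [measurable]: "(\<lambda>x. norm (k x - h n x)) \<in> borel_measurable M" for n
  proof (rule borel_measurable_LIMSEQ_metric)
    show "(\<lambda>x. norm (h m x - h n x)) \<in> borel_measurable M" for m
      using simple_function_compose2[OF hs[of m] hs[of n], of "\<lambda>a b. norm (a - b)"]
      by (intro borel_measurable_simple_function)
    show "(\<lambda>m. norm (h m x - h n x)) \<longlonglongrightarrow> norm (k x - h n x)" if "x \<in> space M" for x
      using lim[OF that] by (intro tendsto_intros)
  qed
  have kf: "AE x in M. k x = f x"
    using AE_not_in[OF N] by eventually_elim (simp add: k_def)
  have "(\<lambda>n. \<integral>\<^sup>+x. ennreal (norm (k x - h n x)) \<partial>M) \<longlonglongrightarrow> (\<integral>\<^sup>+x. 0 \<partial>M)"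
  proof (rule nn_integral_dominated_convergence[where w = "\<lambda>x. ennreal (3 * \<bar>w x\<bar>)"])
    show "AE x in M. ennreal (norm (k x - h j x)) \<le> ennreal (3 * \<bar>w x\<bar>)" for j
    proof (rule AE_I2)
      fix x assume "x \<in> space M"
      then have "norm (k x) \<le> \<bar>w x\<bar>" using Nx by (force simp: k_def)
      moreover have "norm (h j x) \<le> 2 * \<bar>w x\<bar>" using hb[of j x] by auto
      ultimately show "ennreal (norm (k x - h j x)) \<le> ennreal (3 * \<bar>w x\<bar>)"
        using norm_triangle_ineq4[of "k x" "h j x"] by (intro ennreal_leI) linarith
    qed
    show "(\<integral>\<^sup>+x. ennreal (3 * \<bar>w x\<bar>) \<partial>M) < \<infinity>"
      using integrable_mult_right[OF integrable_abs[OF w], of 3]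
      unfolding integrable_iff_bounded by (simp add: abs_mult)
    show "AE x in M. (\<lambda>n. ennreal (norm (k x - h n x))) \<longlonglongrightarrow> 0"
    proof (rule AE_I2)
      fix x assume "x \<in> space M"
      then have "(\<lambda>n. norm (k x - h n x)) \<longlonglongrightarrow> norm (k x - k x)" by (intro tendsto_intros lim)
      then show "(\<lambda>n. ennreal (norm (k x - h n x))) \<longlonglongrightarrow> 0"
        by (simp flip: ennreal_0)
    qed
  qed (use w in auto)
  then have L1: "(\<lambda>n. \<integral>\<^sup>+x. ennreal (norm (k x - h n x)) \<partial>M) \<longlonglongrightarrow> 0" by simp
  have "(\<lambda>n. \<integral>\<^sup>+x. ennreal (norm (f x - h n x)) \<partial>M) = (\<lambda>n. \<integral>\<^sup>+x. ennreal (norm (k x - h n x)) \<partial>M)"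
    using kf by (intro ext nn_integral_cong_AE) auto
  with L1 have fh: "(\<lambda>n. \<integral>\<^sup>+x. ennreal (norm (f x - h n x)) \<partial>M) \<longlonglongrightarrow> 0" by simp
  have hi: "Bochner_Integration.simple_bochner_integrable M (h n)" for n
  proof (rule Bochner_Integration.simple_bochner_integrableI_bounded[OF hs])
    have "(\<integral>\<^sup>+x. ennreal (norm (h n x)) \<partial>M) \<le> (\<integral>\<^sup>+x. ennreal (2 * \<bar>w x\<bar>) \<partial>M)"
    proof (rule nn_integral_mono)
      fix x show "ennreal (norm (h n x)) \<le> ennreal (2 * \<bar>w x\<bar>)" using hb[of n x] by (auto intro!: ennreal_leI)
    qed
    also have "\<dots> < \<infinity>"
      using integrable_mult_right[OF integrable_abs[OF w], of 2]
      unfolding integrable_iff_bounded by (simp add: abs_mult)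
    finally show "(\<integral>\<^sup>+x. ennreal (norm (h n x)) \<partial>M) < \<infinity>" .
  qed
  let ?S = "\<lambda>n. Bochner_Integration.simple_bochner_integral M (h n)"
  let ?d = "\<lambda>n. \<integral>\<^sup>+x. ennreal (norm (k x - h n x)) \<partial>M"
  have bnd: "ennreal (norm (?S m - ?S n)) \<le> ?d m + ?d n" for m n
  proof -
    have i: "Bochner_Integration.simple_bochner_integrable M (\<lambda>x. h m x - h n x)"
      using Bochner_Integration.simple_bochner_integrable_compose2[of "(-)", OF _ hi[of m] hi[of n]] by simp
    have i2: "Bochner_Integration.simple_bochner_integrable M (\<lambda>x. norm (h m x - h n x))"
      using Bochner_Integration.simple_bochner_integrable_compose2[of "\<lambda>a b. norm (a - b)", OF _ hi[of m] hi[of n]] by simp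
    have "norm (?S m - ?S n) = norm (Bochner_Integration.simple_bochner_integral M (\<lambda>x. h m x - h n x))"
      by (simp add: Bochner_Integration.simple_bochner_integral_diff hi)
    also have "\<dots> \<le> Bochner_Integration.simple_bochner_integral M (\<lambda>x. norm (h m x - h n x))"
      by (rule Bochner_Integration.simple_bochner_integral_norm_bound[OF i])
    finally have "ennreal (norm (?S m - ?S n)) \<le> (\<integral>\<^sup>+x. ennreal (norm (h m x - h n x)) \<partial>M)"
      using Bochner_Integration.simple_bochner_integral_eq_nn_integral[OF i2] ennreal_leI by fastforce
    also have "\<dots> \<le> (\<integral>\<^sup>+x. ennreal (norm (k x - h m x)) + ennreal (norm (k x - h n x)) \<partial>M)"
    proof (rule nn_integral_mono)
      fix x
      have "norm (h m x - h n x) \<le> norm (k x - h m x) + norm (k x - h n x)"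
        by (metis add.commute dist_commute dist_norm dist_triangle2)
      then show "ennreal (norm (h m x - h n x)) \<le> ennreal (norm (k x - h m x)) + ennreal (norm (k x - h n x))"
        by (simp flip: ennreal_plus)
    qed
    also have "\<dots> = ?d m + ?d n" by (rule nn_integral_add) auto
    finally show ?thesis .
  qed
  have "Cauchy ?S"
  proof (rule metric_CauchyI)
    fix e :: real assume e: "e > 0"
    then have "eventually (\<lambda>n. ?d n < ennreal (e/2)) sequentially"
      by (intro order_tendstoD(2)[OF L1]) simp
    then obtain n0 where n0: "\<And>n. n \<ge> n0 \<Longrightarrow> ?d n < ennreal (e/2)"
      by (auto simp: eventually_sequentially)
    show "\<exists>M. \<forall>m\<ge>M. \<forall>n\<ge>M. dist (?S m) (?S n) < e"
    proof (intro exI allI impI)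
      fix m n assume "m \<ge> n0" "n \<ge> n0"
      then have "?d m + ?d n < ennreal (e/2) + ennreal (e/2)" by (intro add_strict_mono n0)
      also have "\<dots> = ennreal e" using e by (simp flip: ennreal_plus)
      finally show "dist (?S m) (?S n) < e"
        using bnd[of m n] e by (auto simp: dist_norm ennreal_less_iff dest: le_less_trans)
    qed
  qed
  then obtain I where "?S \<longlonglongrightarrow> I" using Cauchy_convergent convergent_def by blast
  then show ?thesis
    using f hi fh unfolding has_strong_integral_def by blast
qed

subsection \<open>Self-adjoint operators that are bounded above\<close>

locale upper_bounded_self_adjoint =
  fixes A :: "'x::chilbert_space unbounded_op" and a :: real
  assumes self_adjoint: "self_adjoint A"
    and spectrum: "spectrum A \<subseteq> complex_of_real ` {..a}"
    and a_nonneg: "0 \<le> a"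
begin

abbreviation D :: "'x set" where "D \<equiv> dom A"
abbreviation Op :: "'x \<Rightarrow> 'x" where "Op x \<equiv> the (A x)"
abbreviation R :: "complex \<Rightarrow> 'x \<Rightarrow> 'x" where "R l \<equiv> resolvent l A"
abbreviation rho :: "complex set" where "rho \<equiv> resolvent_set A"

lemma A_eq: "x \<in> D \<Longrightarrow> A x = Some (Op x)"
  by auto

lemma clinear: "clinear_op A" and dense_D: "closure D = UNIV"
  using self_adjoint by (auto simp: self_adjoint_def)

lemma D_add: "x \<in> D \<Longrightarrow> y \<in> D \<Longrightarrow> x + y \<in> D"
  and Op_add: "x \<in> D \<Longrightarrow> y \<in> D \<Longrightarrow> Op (x + y) = Op x + Op y"
  using clinear by (fastforce simp: clinear_op_def)+

lemma D_scaleC: "x \<in> D \<Longrightarrow> c *\<^sub>C x \<in> D"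
  and Op_scaleC: "x \<in> D \<Longrightarrow> Op (c *\<^sub>C x) = c *\<^sub>C Op x"
  using clinear by (fastforce simp: clinear_op_def)+

lemma D_scaleR: "x \<in> D \<Longrightarrow> r *\<^sub>R x \<in> D"
  and Op_scaleR: "x \<in> D \<Longrightarrow> Op (r *\<^sub>R x) = r *\<^sub>R Op x"
  using D_scaleC[of x "complex_of_real r"] Op_scaleC[of x "complex_of_real r"]
  by (simp_all add: scaleC_of_real)

lemma D_diff: "x \<in> D \<Longrightarrow> y \<in> D \<Longrightarrow> x - y \<in> D"
  and Op_diff: "x \<in> D \<Longrightarrow> y \<in> D \<Longrightarrow> Op (x - y) = Op x - Op y"
  using D_add[of x "(-1) *\<^sub>R y"] Op_add[of x "(-1) *\<^sub>R y"] D_scaleR[of y "-1"] Op_scaleR[of y "-1"]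
  by simp_all

lemma nonreal_in_rho: "Im l \<noteq> 0 \<Longrightarrow> l \<in> rho"
  using spectrum by (force simp: spectrum_def)

lemma gt_a_in_rho: "a < r \<Longrightarrow> complex_of_real r \<in> rho"
  using spectrum by (force simp: spectrum_def)

lemma cnj_in_rho: "l \<in> rho \<Longrightarrow> cnj l \<in> rho"
  by (cases "Im l = 0") (auto simp: nonreal_in_rho complex_eq_iff intro: back_subst[of "\<lambda>l. l \<in> rho" l])

lemma bij_rho: "l \<in> rho \<Longrightarrow> bij_betw (\<lambda>x. l *\<^sub>C x - Op x) D UNIV"
  by (simp add: resolvent_set_def)

lemma R_bounded_clinear: "l \<in> rho \<Longrightarrow> bounded_clinear (R l)"
  by (simp add: resolvent_set_def)

lemma R_bounded_linear: "l \<in> rho \<Longrightarrow> bounded_linear (R l)"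
  by (simp add: R_bounded_clinear bounded_clinear_imp_bounded_linear)

lemma R_scaleC: "l \<in> rho \<Longrightarrow> R l (c *\<^sub>C x) = c *\<^sub>C R l x"
  using R_bounded_clinear by (auto simp: bounded_clinear_def)

lemma R_linear: "l \<in> rho \<Longrightarrow> linear (R l)"
  by (simp add: R_bounded_linear bounded_linear.linear)

lemma R_in_D: "l \<in> rho \<Longrightarrow> R l x \<in> D"
  using bij_rho[of l] unfolding resolvent_def bij_betw_def by (intro inv_into_into) simp

lemma Op_R: "l \<in> rho \<Longrightarrow> Op (R l x) = l *\<^sub>C R l x - x"
  using f_inv_into_f[of x "\<lambda>x. l *\<^sub>C x - Op x" D] bij_rho[of l]
  by (simp add: resolvent_def bij_betw_def algebra_simps)

lemma R_left: "l \<in> rho \<Longrightarrow> x \<in> D \<Longrightarrow> R l (l *\<^sub>C x - Op x) = x"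
  using bij_rho[of l] inv_into_f_f[of "\<lambda>x. l *\<^sub>C x - Op x" D x] by (simp add: resolvent_def bij_betw_def)

lemma R_Op: "l \<in> rho \<Longrightarrow> x \<in> D \<Longrightarrow> R l (Op x) = l *\<^sub>C R l x - x"
  using R_left[of l x] by (simp add: linear_diff[OF R_linear] R_scaleC algebra_simps)

lemma resolvent_identity:
  assumes "l \<in> rho" "m \<in> rho"
  shows "R l x - R m x = (m - l) *\<^sub>C R l (R m x)"
proof -
  have "R l x = R l (m *\<^sub>C R m x - Op (R m x))" using Op_R[OF assms(2), of x] by simp
  also have "\<dots> = m *\<^sub>C R l (R m x) - (l *\<^sub>C R l (R m x) - R m x)"
    using assms by (simp add: linear_diff[OF R_linear] R_scaleC R_Op R_in_D)
  finally show ?thesis by (simp add: scaleC.diff_left)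
qed

lemma R_commute:
  assumes "l \<in> rho" "m \<in> rho"
  shows "R l (R m x) = R m (R l x)"
proof (cases "l = m")
  case False
  have "(m - l) *\<^sub>C R l (R m x) = (m - l) *\<^sub>C R m (R l x)"
    using resolvent_identity[OF assms, of x] resolvent_identity[OF assms(2,1), of x]
    by (metis minus_diff_eq scaleC.minus_left)
  then have "(1 / (m - l)) *\<^sub>C ((m - l) *\<^sub>C R l (R m x)) = (1 / (m - l)) *\<^sub>C ((m - l) *\<^sub>C R m (R l x))"
    by simp
  with False show ?thesis by (simp add: scaleC_scaleC)
qed simp

text \<open>Density of the domain gives the uniqueness that the definite description in
  \<open>adjoint_op\<close> relies on.\<close>

lemma dense_orthogonal:
  assumes "\<And>x. x \<in> D \<Longrightarrow> cinner x z = cinner x z'"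
  shows "z = z'"
proof -
  have "closed {x. cinner x (z - z') = 0}"
    by (intro closed_Collect_eq continuous_intros cinner.continuous_on)
  moreover have "D \<subseteq> {x. cinner x (z - z') = 0}" using assms by (auto simp: cinner_diff_right)
  ultimately have "closure D \<subseteq> {x. cinner x (z - z') = 0}" by (rule closure_minimal[rotated])
  then have "cinner (z - z') (z - z') = 0" using dense_D by blast
  then show ?thesis by (simp add: cinner_self_norm)
qed

lemma Op_symmetric:
  assumes "x \<in> D" "y \<in> D"
  shows "cinner (Op x) y = cinner x (Op y)"
proof -
  let ?P = "\<lambda>z. \<forall>x\<in>D. cinner (Op x) y = cinner x z"
  have eq: "adjoint_op A y = Some (Op y)"
    using self_adjoint assms by (auto simp: self_adjoint_def)
  then have "\<exists>z. ?P z" unfolding adjoint_op_def by (metis option.distinct(1))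
  then obtain z where z: "?P z" by blast
  have "(THE z. ?P z) = z"
    using z by (intro the_equality) (auto intro: dense_orthogonal)
  then have "Op y = z" using eq \<open>\<exists>z. ?P z\<close> by (simp add: adjoint_op_def)
  with z assms show ?thesis by blast
qed

lemma R_symmetric:
  assumes l: "l \<in> rho"
  shows "cinner (R l x) y = cinner x (R (cnj l) y)"
proof -
  have c: "cnj l \<in> rho" using l by (rule cnj_in_rho)
  let ?p = "R l x" and ?q = "R (cnj l) y"
  have "cinner ?p y = cinner ?p (cnj l *\<^sub>C ?q - Op ?q)" using Op_R[OF c, of y] by simp
  also have "\<dots> = l * cinner ?p ?q - cinner (Op ?p) ?q"
    using Op_symmetric[OF R_in_D[OF l] R_in_D[OF c]] by (simp add: cinner_diff_right cinner_scaleC_right)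
  also have "\<dots> = cinner (l *\<^sub>C ?p - Op ?p) ?q" by (simp add: cinner_diff_left cinner_scaleC_left)
  finally show ?thesis using Op_R[OF l, of x] by simp
qed

section \<open>Resolvent estimates\<close>

lemma Im_cinner_Op: "x \<in> D \<Longrightarrow> Im (cinner (Op x) x) = 0"
  using Op_symmetric[of x x] cinner_commute[of "Op x" x] by (auto simp: complex_eq_iff)

lemma Im_cinner_R:
  assumes l: "l \<in> rho"
  shows "Im (cinner (R l x) x) = - Im l * (norm (R l x))\<^sup>2"
proof -
  let ?p = "R l x"
  have "cinner x ?p = l * complex_of_real ((norm ?p)\<^sup>2) - cinner (Op ?p) ?p"
    using Op_R[OF l, of x] by (simp add: cinner_diff_left cinner_scaleC_left cinner_self_norm)
  then have "Im (cinner x ?p) = Im l * (norm ?p)\<^sup>2"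
    using Im_cinner_Op[OF R_in_D[OF l]] by simp
  then show ?thesis using cinner_commute[of ?p x] by simp
qed

lemma R_norm_nonreal:
  assumes l: "Im l \<noteq> 0"
  shows "norm (R l x) \<le> norm x / \<bar>Im l\<bar>"
proof (cases "norm (R l x) = 0")
  case False
  have "\<bar>Im l\<bar> * (norm (R l x))\<^sup>2 = \<bar>Im (cinner (R l x) x)\<bar>"
    by (simp add: Im_cinner_R nonreal_in_rho l abs_mult)
  also have "\<dots> \<le> norm (R l x) * norm x"
    by (meson abs_Im_le_cmod norm_cinner_le order_trans)
  finally have "\<bar>Im l\<bar> * norm (R l x) \<le> norm x" using False by (simp add: power2_eq_square)
  then show ?thesis using l by (simp add: field_simps)
qed simp

text \<open>Spectral mapping by hand: with \<open>G = R(r)\<close> and \<open>l = r - 1 / mu\<close>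
  one has \<open>G - mu = - mu (l - A) G\<close>. Since \<open>l\<close> is a resolvent point,
  \<open>G - mu\<close> has a bounded inverse, which the lower bound expresses
  quantitatively.\<close>

lemma R_minus_bounded_below:
  assumes r: "a < r" and mu: "mu \<noteq> 0" "a < r - 1 / mu"
  obtains K where "K > 0" "\<And>x. norm x \<le> K * norm (R (complex_of_real r) x - mu *\<^sub>R x)"
proof -
  define l where "l = complex_of_real (r - 1 / mu)"
  have l: "l \<in> rho" and r': "complex_of_real r \<in> rho" using gt_a_in_rho r mu by (auto simp: l_def simp del: of_real_diff)
  obtain K0 where K0: "K0 > 0" "\<And>x. norm (R l x) \<le> norm x * K0"
    using bounded_linear.pos_bounded[OF R_bounded_linear[OF l]] by blast
  have "norm x \<le> ((1 + K0 / \<bar>mu\<bar>) / \<bar>mu\<bar>) * norm (R (complex_of_real r) x - mu *\<^sub>R x)" for x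
  proof -
    let ?G = "R (complex_of_real r)"
    define w where "w = mu *\<^sub>R x - ?G x"
    have "R l x - ?G x = (1 / mu) *\<^sub>R R l (?G x)"
      using resolvent_identity[OF l r', of x] scaleC_of_real[of "1 / mu" "R l (?G x)"] by (simp add: l_def)
    then have "R l (?G x) = mu *\<^sub>R (R l x - ?G x)" using mu by simp
    then have "R l w = mu *\<^sub>R ?G x"
      unfolding w_def by (simp add: linear_diff[OF R_linear[OF l]] linear_cmul[OF R_linear[OF l]] algebra_simps)
    then have "\<bar>mu\<bar> * norm (?G x) \<le> norm w * K0" using K0(2)[of w] by simp
    then have 1: "norm (?G x) \<le> norm w * K0 / \<bar>mu\<bar>" using mu by (simp add: field_simps)
    have "mu *\<^sub>R x = w + ?G x" by (simp add: w_def)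
    then have "\<bar>mu\<bar> * norm x \<le> norm w + norm (?G x)" by (metis norm_scaleR norm_triangle_ineq)
    also have "\<dots> \<le> (1 + K0 / \<bar>mu\<bar>) * norm w" using 1 by (simp add: algebra_simps)
    finally have "norm x \<le> (1 + K0 / \<bar>mu\<bar>) * norm w / \<bar>mu\<bar>"
      using mu by (simp add: pos_le_divide_eq mult.commute)
    then show ?thesis by (simp add: w_def norm_minus_commute)
  qed
  moreover have "(1 + K0 / \<bar>mu\<bar>) / \<bar>mu\<bar> > 0" using K0 mu by (intro divide_pos_pos add_pos_nonneg) auto
  ultimately show ?thesis using that by blast
qed

text \<open>If the norm \<open>m\<close> of \<open>G = R(r)\<close> were too large, both \<open>G - m\<close> and \<open>G + m\<close> would be bounded below,
  hence \<open>G\<^sup>2 - m\<^sup>2\<close> would be; but \<open>\<parallel>(G\<^sup>2 - m\<^sup>2) x\<parallel>\<^sup>2 \<le> m\<^sup>2 (m\<^sup>2 \<parallel>x\<parallel>\<^sup>2 - \<parallel>G x\<parallel>\<^sup>2)\<close>.\<close>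

lemma R_norm_real:
  assumes r: "a < r"
  shows "norm (R (complex_of_real r) x) \<le> norm x / (r - a)"
proof -
  let ?G = "R (complex_of_real r)"
  have r': "complex_of_real r \<in> rho" using r by (rule gt_a_in_rho)
  have bl: "bounded_linear ?G" using r' by (rule R_bounded_linear)
  define m where "m = onorm ?G"
  have mG: "norm (?G x) \<le> m * norm x" for x unfolding m_def by (rule onorm[OF bl])
  have "m \<le> 1 / (r - a)"
  proof (rule ccontr)
    assume "\<not> ?thesis"
    then have m: "1 / (r - a) < m" by simp
    then have m0: "m > 0" using r by (smt (verit) divide_pos_pos)
    have "1 / m < r - a" using m r m0 by (simp add: field_simps)
    then have "a < r - 1 / m" "a < r - 1 / (- m)" using m0 r by (auto simp: field_simps)
    then obtain K1 K2 where K: "K1 > 0" "\<And>x. norm x \<le> K1 * norm (?G x - m *\<^sub>R x)"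
       "K2 > 0" "\<And>x. norm x \<le> K2 * norm (?G x - (- m) *\<^sub>R x)"
      using R_minus_bounded_below[OF r, of m] R_minus_bounded_below[OF r, of "-m"] m0
      by (metis neg_equal_0_iff_equal less_irrefl)
    \<comment> \<open>Chosen so that \<open>d * (norm x)\<^sup>2 \<le> m\<^sup>2 * (norm x)\<^sup>2
      - (norm (?G x))\<^sup>2\<close> for all \<open>x\<close>. This undercuts the operator norm
      \<open>m\<close>.\<close>
    define d where "d = 1 / (K1 * K2 * m)\<^sup>2"
    have d: "d > 0" using K m0 by (simp add: d_def)
    have "(norm (?G x))\<^sup>2 \<le> (m\<^sup>2 - d) * (norm x)\<^sup>2" for x
    proof -
      have "norm x \<le> K1 * norm (?G x - m *\<^sub>R x)" by (rule K)
      also have "\<dots> \<le> K1 * (K2 * norm (?G (?G x - m *\<^sub>R x) - (- m) *\<^sub>R (?G x - m *\<^sub>R x)))"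
        using K by (intro mult_left_mono) auto
      also have "?G (?G x - m *\<^sub>R x) - (- m) *\<^sub>R (?G x - m *\<^sub>R x) = ?G (?G x) - (m * m) *\<^sub>R x"
        by (simp add: linear_diff[OF R_linear[OF r']] linear_cmul[OF R_linear[OF r']] algebra_simps)
      finally have "norm x \<le> K1 * K2 * norm (?G (?G x) - (m * m) *\<^sub>R x)" by simp
      then have "(norm x)\<^sup>2 \<le> (K1 * K2)\<^sup>2 * (norm (?G (?G x) - (m * m) *\<^sub>R x))\<^sup>2"
        by (metis norm_ge_zero power_mono power_mult_distrib)
      also have "(norm (?G (?G x) - (m * m) *\<^sub>R x))\<^sup>2
          = (norm (?G (?G x)))\<^sup>2 + (m * m)\<^sup>2 * (norm x)\<^sup>2 - 2 * (m * m) * (norm (?G x))\<^sup>2"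
        using R_symmetric[OF r', of "?G x" x]
        by (simp add: norm_diff_square power_mult_distrib cinner_scaleR_right Re_cinner_self cinner_self_norm)
      also have "\<dots> \<le> m\<^sup>2 * (m\<^sup>2 * (norm x)\<^sup>2 - (norm (?G x))\<^sup>2)"
      proof -
        have "(norm (?G (?G x)))\<^sup>2 \<le> m\<^sup>2 * (norm (?G x))\<^sup>2"
          by (metis mG norm_ge_zero power_mono power_mult_distrib)
        then show ?thesis by (simp add: algebra_simps power2_eq_square)
      qed
      finally have "(norm x)\<^sup>2 \<le> (K1 * K2)\<^sup>2 * (m\<^sup>2 * (m\<^sup>2 * (norm x)\<^sup>2 - (norm (?G x))\<^sup>2))"
        by (simp add: mult_left_mono)
      then have "d * (norm x)\<^sup>2 \<le> m\<^sup>2 * (norm x)\<^sup>2 - (norm (?G x))\<^sup>2"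
        using K m0 by (simp add: d_def divide_le_eq power_mult_distrib mult_ac)
      then show ?thesis by (simp add: algebra_simps)
    qed
    then have le: "norm (?G x) \<le> sqrt (m\<^sup>2 - d) * norm x" for x
      by (metis abs_norm_cancel real_sqrt_abs real_sqrt_le_iff real_sqrt_mult)
    have "m \<le> sqrt (m\<^sup>2 - d)" unfolding m_def
    proof (rule onorm_bound)
      \<comment> \<open>The real function \<open>sqrt\<close> is negative at negative arguments, so
        nonnegativity needs a nonzero vector; in the trivial space \<open>m\<close> would vanish,
        contrary to \<open>m0\<close>.\<close>
      show "0 \<le> sqrt ((onorm ?G)\<^sup>2 - d)"
      proof (cases "\<exists>x::'x. x \<noteq> 0")
        case True
        then obtain x :: 'x where "x \<noteq> 0" by blast
        have "0 \<le> sqrt (m\<^sup>2 - d) * norm x" using le[of x] norm_ge_zero order_trans by blast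
        then show ?thesis using \<open>x \<noteq> 0\<close> by (simp add: m_def zero_le_mult_iff)
      next
        case False
        then have "?G = (\<lambda>x. 0)" by auto
        then have "m = 0" by (simp add: m_def onorm_zero)
        with m0 show ?thesis by simp
      qed
    qed (use le in \<open>simp add: m_def\<close>)
    also have "\<dots> < sqrt (m\<^sup>2)" using d by (intro real_sqrt_less_mono) simp
    finally show False using m0 by simp
  qed
  then have "m * norm x \<le> 1 / (r - a) * norm x" by (rule mult_right_mono) simp
  with mG[of x] show ?thesis by simp
qed

text \<open>An operator with a resolvent point is closed: \<open>f n\<close> is the image of
  \<open>\<i> *\<^sub>C f n - Op (f n)\<close> under the bounded operator \<open>R \<i>\<close>, and
  both sides converge.\<close>

lemma closed_op:
  assumes "\<And>n::nat. f n \<in> D" "f \<longlonglongrightarrow> x" "(\<lambda>n. Op (f n)) \<longlonglongrightarrow> z"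
  shows "x \<in> D" "Op x = z"
proof -
  have l: "\<i> \<in> rho" by (simp add: nonreal_in_rho)
  have "(\<lambda>n. R \<i> (\<i> *\<^sub>C f n - Op (f n))) \<longlonglongrightarrow> R \<i> (\<i> *\<^sub>C x - z)"
    by (intro bounded_linear.tendsto[OF R_bounded_linear[OF l]] tendsto_diff scaleC.tendsto tendsto_const assms)
  then have "f \<longlonglongrightarrow> R \<i> (\<i> *\<^sub>C x - z)" using assms(1) by (simp add: R_left l)
  then have x: "x = R \<i> (\<i> *\<^sub>C x - z)" using assms(2) LIMSEQ_unique by blast
  then show "x \<in> D" using R_in_D[OF l] by metis
  show "Op x = z" using Op_R[OF l, of "\<i> *\<^sub>C x - z"] x by simp
qed

end

subsection \<open>The semigroup generated by a self-adjoint operator\<close>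

lemma tendsto_zero_norm_le:
  assumes "\<And>n. norm (f n) \<le> g n" and "g \<longlonglongrightarrow> 0"
  shows "f \<longlonglongrightarrow> 0"
  using Lim_null_comparison[of f g sequentially] assms by simp

lemma norm_funpow_le:
  fixes F :: "'a::real_normed_vector \<Rightarrow> 'a"
  assumes "\<And>x. norm (F x) \<le> norm x"
  shows "norm ((F ^^ n) x) \<le> norm x"
  by (induction n) (auto intro: order_trans[OF assms])

lemma linear_funpow: "linear (F :: 'a::real_vector \<Rightarrow> 'a) \<Longrightarrow> linear (F ^^ n)"
proof (induction n)
  case (Suc n)
  then show ?case using linear_compose[of "F ^^ n" F] by (simp add: comp_def)
qed (simp add: linear_id[unfolded id_def] id_def)

lemma funpow_commute:
  assumes "\<And>x. F (G x) = G (F x)"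
  shows "(F ^^ n) (G x) = G ((F ^^ n) x)"
  by (induction n) (auto simp: assms)

lemma funpow_comp_commute:
  assumes "\<And>x. F (G x) = G (F x)"
  shows "((\<lambda>x. F (G x)) ^^ n) x = (F ^^ n) ((G ^^ n) x)"
proof (induction n)
  case (Suc n)
  have "((\<lambda>x. F (G x)) ^^ Suc n) x = F (G ((F ^^ n) ((G ^^ n) x)))" using Suc by simp
  also have "\<dots> = F ((F ^^ n) (G ((G ^^ n) x)))" using assms funpow_commute[of F G n] by simp
  finally show ?case by simp
qed simp

text \<open>Telescoping: the factors \<open>F\<close> are exchanged for \<open>G\<close> one at a
  time. Commutation lets the difference act first, and contractivity makes the remaining factors
  harmless.\<close>

lemma funpow_diff_le:
  fixes F G :: "'a::real_normed_vector \<Rightarrow> 'a"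
  assumes F: "linear F" "\<And>x. norm (F x) \<le> norm x" and G: "linear G" "\<And>x. norm (G x) \<le> norm x"
    and FG: "\<And>x. F (G x) = G (F x)"
  shows "norm ((F ^^ n) x - (G ^^ n) x) \<le> n * norm (F x - G x)"
proof (induction n arbitrary: x)
  case (Suc n)
  have eq: "(F ^^ Suc n) x - (G ^^ Suc n) x = (F ^^ n) (F x - G x) + ((F ^^ n) (G x) - (G ^^ n) (G x))"
    by (simp add: funpow_swap1 linear_diff[OF linear_funpow[OF F(1)]])
  have "norm ((F ^^ n) (F x - G x)) \<le> norm (F x - G x)" by (rule norm_funpow_le[OF F(2)])
  moreover have "norm ((F ^^ n) (G x) - (G ^^ n) (G x)) \<le> n * norm (G (F x - G x))"
    using Suc[of "G x"] by (simp add: FG linear_diff[OF G(1)])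
  moreover have "n * norm (G (F x - G x)) \<le> n * norm (F x - G x)" by (intro mult_left_mono G(2)) simp
  ultimately have "norm ((F ^^ Suc n) x - (G ^^ Suc n) x) \<le> norm (F x - G x) + n * norm (F x - G x)"
    unfolding eq using norm_triangle_ineq[of "(F ^^ n) (F x - G x)" "(F ^^ n) (G x) - (G ^^ n) (G x)"] by linarith
  then show ?case by (simp add: algebra_simps)
qed simp

lemma geometric_increments:
  fixes v :: "nat \<Rightarrow> 'a::real_normed_vector"
  assumes "\<And>k. norm (v (Suc k) - v k) \<le> c / 2 ^ k"
  shows "norm (v (k + m) - v k) \<le> 2 * c / 2 ^ k"
proof -
  have c: "0 \<le> c" using order_trans[OF norm_ge_zero assms[of 0]] by simp
  \<comment> \<open>The induction needs the exact geometric sum; the subtracted tail is dropped only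
    afterwards.\<close>
  have "norm (v (k + m) - v k) \<le> 2 * c / 2 ^ k - 2 * c / 2 ^ (k + m)"
  proof (induction m)
    case (Suc m)
    have "norm (v (k + Suc m) - v k) \<le> norm (v (Suc (k + m)) - v (k + m)) + norm (v (k + m) - v k)"
      by (metis add_Suc_right dist_norm dist_triangle)
    also have "\<dots> \<le> c / 2 ^ (k + m) + (2 * c / 2 ^ k - 2 * c / 2 ^ (k + m))"
      using assms Suc by (rule add_mono)
    also have "\<dots> = 2 * c / 2 ^ k - 2 * c / 2 ^ (k + Suc m)" by (simp add: field_simps)
    finally show ?case .
  qed simp
  also have "\<dots> \<le> 2 * c / 2 ^ k" using c by simp
  finally show ?thesis .
qed

section \<open>Backward Euler steps for the shifted operator\<close>

context upper_bounded_self_adjoint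
begin

definition C :: "'x \<Rightarrow> 'x" where "C x = Op x - a *\<^sub>R x"

text \<open>This is \<open>(1 - h C)\<^sup>-\<^sup>1\<close>, one backward Euler step for
  \<open>x' = C x\<close>. It is a contraction because \<open>a + 1 / h\<close> has distance
  \<open>1 / h\<close> from \<open>a\<close>; the shift by \<open>a\<close> in \<open>C\<close> is
  made for this purpose and undone in \<open>T\<close>.\<close>

definition J :: "real \<Rightarrow> 'x \<Rightarrow> 'x" where
  "J h x = (if h = 0 then x else (1 / h) *\<^sub>R R (complex_of_real (a + 1 / h)) x)"

text \<open>The domain of the square of \<open>A\<close>. The second-order Euler errors are
  expressed through \<open>C (C x)\<close>.\<close>

definition D2 :: "'x set" where "D2 = {x \<in> D. C x \<in> D}"

lemma shift_in_rho: "0 < h \<Longrightarrow> complex_of_real (a + 1 / h) \<in> rho"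
  by (intro gt_a_in_rho) simp

lemma J_zero [simp]: "J 0 x = x" by (simp add: J_def)

lemma J_pos: "0 < h \<Longrightarrow> J h x = (1 / h) *\<^sub>R R (complex_of_real (a + 1 / h)) x"
  by (simp add: J_def)

lemma J_bounded_linear: "0 \<le> h \<Longrightarrow> bounded_linear (J h)"
proof -
  assume h: "0 \<le> h"
  show ?thesis
  proof (cases "h = 0")
    case True
    have "J 0 = (\<lambda>x. x)" by (rule ext) simp
    then show ?thesis using True bounded_linear_ident by simp
  next
    case False
    then have "J h = (\<lambda>x. (1 / h) *\<^sub>R R (complex_of_real (a + 1 / h)) x)" by (auto simp: J_def)
    then show ?thesis
      using bounded_linear_compose[OF bounded_linear_scaleR_right R_bounded_linear[OF shift_in_rho, of h]]
        False h by auto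
  qed
qed

lemma J_linear: "0 \<le> h \<Longrightarrow> linear (J h)"
  by (simp add: J_bounded_linear bounded_linear.linear)

lemma J_scaleC: "0 \<le> h \<Longrightarrow> J h (c *\<^sub>C x) = c *\<^sub>C J h x"
  using shift_in_rho[of h] by (cases "h = 0") (auto simp: J_def R_scaleC scaleC.scaleR_right)

lemma J_contraction: "0 \<le> h \<Longrightarrow> norm (J h x) \<le> norm x"
  using R_norm_real[of "a + 1 / h" x] by (cases "h = 0") (auto simp: J_def field_simps)

lemma J_in_D: "0 < h \<Longrightarrow> J h x \<in> D"
  by (simp add: J_pos D_scaleR R_in_D shift_in_rho del: of_real_add of_real_divide)

lemma C_J: "0 < h \<Longrightarrow> C (J h x) = (1 / h) *\<^sub>R (J h x - x)"
  using shift_in_rho[of h]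
  by (simp add: C_def J_pos Op_scaleR R_in_D Op_R scaleC_of_real del: of_real_add of_real_divide)
    (simp add: algebra_simps)

lemma C_diff: "x \<in> D \<Longrightarrow> y \<in> D \<Longrightarrow> C (x - y) = C x - C y"
  by (simp add: C_def Op_diff algebra_simps)

lemma J_left: "0 \<le> h \<Longrightarrow> x \<in> D \<Longrightarrow> J h (x - h *\<^sub>R C x) = x"
proof -
  assume h: "0 \<le> h" and x: "x \<in> D"
  show ?thesis
  proof (cases "h = 0")
    case False
    then have h: "0 < h" using h by simp
    let ?l = "complex_of_real (a + 1 / h)"
    have "x - h *\<^sub>R C x = h *\<^sub>R (?l *\<^sub>C x - Op x)"
      using h by (simp add: C_def scaleC_of_real algebra_simps del: of_real_add of_real_divide)
    then show ?thesis
      using h shift_in_rho[OF h] x by (simp add: J_pos linear_cmul[OF R_linear] R_left del: of_real_add of_real_divide domIff)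
  qed simp
qed

lemma J_eq: "0 \<le> h \<Longrightarrow> x \<in> D \<Longrightarrow> J h x = x + h *\<^sub>R J h (C x)"
  using J_left[of h x] by (simp add: linear_diff[OF J_linear] linear_cmul[OF J_linear] algebra_simps del: domIff)

lemma C_J_commute: "0 \<le> h \<Longrightarrow> x \<in> D \<Longrightarrow> C (J h x) = J h (C x)"
  using C_J[of h x] J_eq[of h x] by (cases "h = 0") (auto simp: scaleR_left_diff_distrib simp del: domIff)

lemma J_R_commute: "0 \<le> h \<Longrightarrow> l \<in> rho \<Longrightarrow> J h (R l x) = R l (J h x)"
  using shift_in_rho[of h] by (cases "h = 0") (auto simp: J_def R_commute linear_cmul[OF R_linear])

lemma J_commute: "0 \<le> h \<Longrightarrow> 0 \<le> k \<Longrightarrow> J h (J k x) = J k (J h x)"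
  using shift_in_rho[of k] J_R_commute[of h]
  by (cases "k = 0") (auto simp: J_pos linear_cmul[OF J_linear])

lemma J_symmetric: "0 \<le> h \<Longrightarrow> cinner (J h x) y = cinner x (J h y)"
  using R_symmetric[OF shift_in_rho[of h], of x y]
  by (cases "h = 0") (auto simp: J_def cinner_scaleR_left cinner_scaleR_right)

lemma norm_J_minus: "0 \<le> h \<Longrightarrow> x \<in> D \<Longrightarrow> norm (J h x - x) \<le> h * norm (C x)"
  using J_eq[of h x] J_contraction[of h "C x"] by (simp add: mult_left_mono del: domIff)

lemma J_tendsto: "(\<lambda>n. J (1 / Suc n) x) \<longlonglongrightarrow> x"
proof (rule LIMSEQ_I)
  fix e :: real assume e: "e > 0"
  have "x \<in> closure D" using dense_D by simp
  then obtain y where y: "y \<in> D" "norm (x - y) < e / 3"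
    using e by (metis closure_approachable dist_norm norm_minus_commute divide_pos_pos zero_less_numeral)
  obtain N :: nat where N: "norm (C y) * 3 / e < N" using reals_Archimedean2 by blast
  show "\<exists>n0. \<forall>n\<ge>n0. norm (J (1 / Suc n) x - x) < e"
  proof (intro exI allI impI)
    fix n assume n: "n \<ge> N"
    let ?h = "1 / real (Suc n)"
    have "norm (C y) * 3 < e * real (Suc n)"
    proof -
      have "norm (C y) * 3 < e * N" using N e by (simp add: field_simps)
      also have "\<dots> \<le> e * real (Suc n)" using n e by (intro mult_left_mono) auto
      finally show ?thesis .
    qed
    then have h: "?h * norm (C y) < e / 3" by (simp add: field_simps)
    have "J ?h x - x = (J ?h (x - y) + (J ?h y - y)) - (x - y)"
      using linear_diff[OF J_linear[of ?h], of x y] by simp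
    then have "norm (J ?h x - x) \<le> norm (J ?h (x - y)) + norm (J ?h y - y) + norm (x - y)"
      using norm_triangle_ineq4[of "J ?h (x - y) + (J ?h y - y)" "x - y"]
        norm_triangle_ineq[of "J ?h (x - y)" "J ?h y - y"] by simp
    moreover have "norm (J ?h (x - y)) \<le> norm (x - y)" by (rule J_contraction) simp
    moreover have "norm (J ?h y - y) \<le> ?h * norm (C y)" using y by (intro norm_J_minus) auto
    ultimately show "norm (J ?h x - x) < e" using y(2) h by linarith
  qed
qed

lemma J_J_in_D2: "0 < h \<Longrightarrow> J h (J h x) \<in> D2"
  using J_in_D[of h] C_J_commute[of h "J h x"] by (auto simp: D2_def simp del: domIff)

lemma J_in_D2: "0 < h \<Longrightarrow> x \<in> D \<Longrightarrow> J h x \<in> D2"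
  using J_in_D[of h] C_J_commute[of h x] by (auto simp: D2_def simp del: domIff)

text \<open>Each application of \<open>J\<close> gains one order of regularity, so two of them
  approximate any vector from within \<open>D2\<close>.\<close>

lemma J_J_tendsto: "(\<lambda>n. J (1 / Suc n) (J (1 / Suc n) x)) \<longlonglongrightarrow> x"
proof -
  have "(\<lambda>n. 2 * norm (J (1 / Suc n) x - x)) \<longlonglongrightarrow> 2 * 0"
    by (intro tendsto_mult tendsto_const tendsto_norm_zero) (use J_tendsto[of x] in \<open>simp add: LIM_zero_iff\<close>)
  moreover have "norm (J (1 / Suc n) (J (1 / Suc n) x) - x) \<le> 2 * norm (J (1 / Suc n) x - x)" for n
  proof -
    let ?J = "J (1 / Suc n)"
    have "?J (?J x) - x = ?J (?J x - x) + (?J x - x)" by (simp add: linear_diff[OF J_linear])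
    then have "norm (?J (?J x) - x) \<le> norm (?J (?J x - x)) + norm (?J x - x)" by (metis norm_triangle_ineq)
    then show ?thesis using J_contraction[of "1 / Suc n" "?J x - x"] by simp
  qed
  ultimately have "(\<lambda>n. J (1 / Suc n) (J (1 / Suc n) x) - x) \<longlonglongrightarrow> 0"
    using tendsto_zero_norm_le[of "\<lambda>n. J (1 / Suc n) (J (1 / Suc n) x) - x"
      "\<lambda>n. 2 * norm (J (1 / Suc n) x - x)"] by auto
  then show ?thesis by (simp add: LIM_zero_iff)
qed

lemma D2_dense: "0 < e \<Longrightarrow> \<exists>y\<in>D2. norm (x - y) < e"
proof -
  assume "0 < e"
  then obtain n where "\<forall>m\<ge>n. norm (J (1 / Suc m) (J (1 / Suc m) x) - x) < e"
    using LIMSEQ_D[OF J_J_tendsto[of x], of e] by fast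
  then have "norm (J (1 / Suc n) (J (1 / Suc n) x) - x) < e" by blast
  moreover have "J (1 / Suc n) (J (1 / Suc n) x) \<in> D2" by (rule J_J_in_D2) simp
  ultimately show ?thesis by (auto simp: norm_minus_commute)
qed

lemma eq_on_D2:
  assumes "bounded_linear F" "bounded_linear G" "\<And>x. x \<in> D2 \<Longrightarrow> F x = (G x :: 'x)"
  shows "F x = G x"
proof -
  have "(\<lambda>n. F (J (1 / Suc n) (J (1 / Suc n) x))) \<longlonglongrightarrow> F x"
    by (rule bounded_linear.tendsto[OF assms(1) J_J_tendsto])
  moreover have "(\<lambda>n. G (J (1 / Suc n) (J (1 / Suc n) x))) \<longlonglongrightarrow> G x"
    by (rule bounded_linear.tendsto[OF assms(2) J_J_tendsto])
  moreover have "F (J (1 / Suc n) (J (1 / Suc n) x)) = G (J (1 / Suc n) (J (1 / Suc n) x))" for n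
    by (intro assms(3) J_J_in_D2) simp
  ultimately show ?thesis using LIMSEQ_unique by fastforce
qed

text \<open>From \<open>(1 - s C)(1 - t C) = 1 - (s + t) C + s t C\<^sup>2\<close> one gets
  \<open>J(s + t) - J(s) J(t) = s t J(s) J(t) J(s + t) C\<^sup>2\<close>, and the three factors
  \<open>J\<close> are contractions.\<close>

lemma J_product_diff:
  assumes "0 \<le> s" "0 \<le> t" "x \<in> D2"
  shows "norm (J s (J t x) - J (s + t) x) \<le> s * t * norm (C (C x))"
proof -
  have x: "x \<in> D" "C x \<in> D" using assms by (auto simp: D2_def)
  let ?P = "J (s + t)" and ?w = "x - (s + t) *\<^sub>R C x"
  note lin = linear_add[OF J_linear] linear_diff[OF J_linear] linear_cmul[OF J_linear]
  have "?w + (s * t) *\<^sub>R C (C x) = (x - t *\<^sub>R C x) - s *\<^sub>R (C x - t *\<^sub>R C (C x))"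
    by (simp add: algebra_simps)
  then have "J t (?w + (s * t) *\<^sub>R C (C x)) = x - s *\<^sub>R C x"
    using J_left[OF assms(2) x(1)] J_left[OF assms(2) x(2)] assms(2)
    by (simp only: linear_diff[OF J_linear] linear_cmul[OF J_linear])
  then have "J s (J t (?w + (s * t) *\<^sub>R C (C x))) = x"
    using J_left[OF assms(1) x(1)] by simp
  then have "?P x = ?P (J s (J t (?w + (s * t) *\<^sub>R C (C x))))" by simp
  also have "\<dots> = J s (J t (?P (?w + (s * t) *\<^sub>R C (C x))))" using assms by (simp add: J_commute)
  also have "\<dots> = J s (J t x) + (s * t) *\<^sub>R J s (J t (?P (C (C x))))"
    using J_left[of "s + t" x] x assms by (simp add: lin del: domIff)
  finally have "norm (J s (J t x) - ?P x) = (s * t) * norm (J s (J t (?P (C (C x)))))"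
    using assms by (simp add: norm_minus_commute)
  also have "\<dots> \<le> (s * t) * norm (C (C x))"
  proof -
    have "norm (J s (J t (?P (C (C x))))) \<le> norm (C (C x))"
      using J_contraction[of s] J_contraction[of t] J_contraction[of "s + t"] assms
      by (meson add_nonneg_nonneg order_trans)
    then show ?thesis using assms by (intro mult_left_mono) auto
  qed
  finally show ?thesis .
qed

section \<open>Dyadic Euler products and the contraction semigroup\<close>

definition V :: "nat \<Rightarrow> real \<Rightarrow> 'x \<Rightarrow> 'x" where
  "V k t = J (t / 2 ^ k) ^^ (2 ^ k)"

lemma V_linear: "0 \<le> t \<Longrightarrow> linear (V k t)"
  unfolding V_def by (intro linear_funpow J_linear) simp

lemma V_contraction: "0 \<le> t \<Longrightarrow> norm (V k t x) \<le> norm x"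
  unfolding V_def by (intro norm_funpow_le J_contraction) simp

text \<open>Powers of two make refinement local: passing from \<open>k\<close> to
  \<open>Suc k\<close> replaces each of the \<open>2 ^ k\<close> steps \<open>J h\<close> by two
  steps \<open>J (h / 2)\<close>, at a cost of \<open>h\<^sup>2 / 4 * norm (C (C x))\<close> per
  step.\<close>

lemma V_Suc_diff:
  assumes t: "0 \<le> t" and x: "x \<in> D2"
  shows "norm (V (Suc k) t x - V k t x) \<le> (t\<^sup>2 / 4 * norm (C (C x))) / 2 ^ k"
proof -
  let ?h = "t / 2 ^ k"
  have h: "0 \<le> ?h" using t by simp
  have half: "t / 2 ^ Suc k = ?h / 2" by simp
  have F: "V (Suc k) t = (\<lambda>x. J (?h / 2) (J (?h / 2) x)) ^^ (2 ^ k)"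
  proof -
    have "(\<lambda>x. J (?h / 2) (J (?h / 2) x)) = J (?h / 2) ^^ 2" by (simp add: eval_nat_numeral comp_def)
    then show ?thesis unfolding V_def half by (simp only: funpow_mult power_Suc mult.commute)
  qed
  have "norm (V (Suc k) t x - V k t x) \<le> real (2 ^ k) * norm (J (?h / 2) (J (?h / 2) x) - J ?h x)"
    unfolding F unfolding V_def
  proof (rule funpow_diff_le)
    show "linear (\<lambda>x. J (?h / 2) (J (?h / 2) x))"
      using linear_compose[OF J_linear[of "?h / 2"] J_linear[of "?h / 2"]] h by (simp add: comp_def)
    show "norm (J (?h / 2) (J (?h / 2) x)) \<le> norm x" for x
      using J_contraction[of "?h / 2"] h by (meson order_trans half_gt_zero_iff divide_nonneg_pos zero_less_numeral)
  qed (use h in \<open>simp_all add: J_linear J_contraction J_commute\<close>)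
  also have "\<dots> \<le> real (2 ^ k) * (?h / 2 * (?h / 2) * norm (C (C x)))"
    using J_product_diff[of "?h / 2" "?h / 2" x] h x by (intro mult_left_mono) auto
  also have "\<dots> = (t\<^sup>2 / 4 * norm (C (C x))) / 2 ^ k" by (simp add: power2_eq_square field_simps)
  finally show ?thesis .
qed

lemma V_increment:
  assumes "0 \<le> t" "x \<in> D2"
  shows "norm (V (k + m) t x - V k t x) \<le> t\<^sup>2 / 2 * norm (C (C x)) / 2 ^ k"
  using geometric_increments[of "\<lambda>k. V k t x", OF V_Suc_diff[OF assms], of k m] by simp

lemma V_convergent:
  assumes t: "0 \<le> t"
  shows "convergent (\<lambda>k. V k t x)"
proof -
  have "Cauchy (\<lambda>k. V k t x)"
  proof (rule metric_CauchyI)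
    fix e :: real assume e: "e > 0"
    \<comment> \<open>On \<open>D2\<close> the increments are geometric; contractivity of all
      \<open>V k t\<close> carries the Cauchy property over to the closure.\<close>
    obtain y where y: "y \<in> D2" "norm (x - y) < e / 6" using D2_dense[of "e / 6"] e by auto
    have "(\<lambda>k. t\<^sup>2 / 2 * norm (C (C y)) / 2 ^ k) \<longlonglongrightarrow> 0"
      by (intro LIMSEQ_divide_realpow_zero) auto
    from LIMSEQ_D[OF this, of "e / 6"] obtain N where N: "t\<^sup>2 / 2 * norm (C (C y)) / 2 ^ N < e / 6"
      using e by (auto simp: abs_less_iff)
    have near: "norm (V m t x - V N t y) < e / 3" if "m \<ge> N" for m
    proof -
      have eq: "V m t x - V N t y = V m t (x - y) + (V m t y - V N t y)"
        by (simp add: linear_diff[OF V_linear[OF t]])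
      have "norm (V m t (x - y)) < e / 6" using V_contraction[OF t, of m "x - y"] y(2) by linarith
      moreover have "norm (V m t y - V N t y) < e / 6"
        using V_increment[OF t y(1), of N "m - N"] that N by simp
      ultimately show ?thesis
        unfolding eq using norm_triangle_ineq[of "V m t (x - y)" "V m t y - V N t y"] by linarith
    qed
    show "\<exists>M. \<forall>m\<ge>M. \<forall>n\<ge>M. dist (V m t x) (V n t x) < e"
    proof (intro exI allI impI)
      fix m n assume "m \<ge> N" "n \<ge> N"
      then have "dist (V m t x) (V N t y) < e / 3" "dist (V n t x) (V N t y) < e / 3"
        using near by (auto simp: dist_norm)
      then show "dist (V m t x) (V n t x) < e" using e dist_triangle2[of "V m t x" "V n t x" "V N t y"] by linarith
    qed
  qed
  then show ?thesis by (rule Cauchy_convergent)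
qed

definition T0 :: "real \<Rightarrow> 'x \<Rightarrow> 'x" where "T0 t x = lim (\<lambda>k. V k t x)"

lemma V_tendsto: "0 \<le> t \<Longrightarrow> (\<lambda>k. V k t x) \<longlonglongrightarrow> T0 t x"
  unfolding T0_def using V_convergent convergent_LIMSEQ_iff by blast

lemma T0_contraction: "0 \<le> t \<Longrightarrow> norm (T0 t x) \<le> norm x"
  by (rule LIMSEQ_le_const2[OF tendsto_norm[OF V_tendsto]]) (auto simp: V_contraction)

lemma T0_commute:
  assumes t: "0 \<le> t" and S: "bounded_linear S" and c: "\<And>h x. 0 \<le> h \<Longrightarrow> J h (S x) = S (J h x)"
  shows "T0 t (S x) = S (T0 t x)"
proof -
  have "V k t (S x) = S (V k t x)" for k
    unfolding V_def using t by (intro funpow_commute c) simp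
  then have "(\<lambda>k. V k t (S x)) \<longlonglongrightarrow> S (T0 t x)"
    using bounded_linear.tendsto[OF S V_tendsto[OF t, of x]] by simp
  then show ?thesis using V_tendsto[OF t, of "S x"] LIMSEQ_unique by blast
qed

lemma T0_bounded_clinear: "0 \<le> t \<Longrightarrow> bounded_clinear (T0 t)"
proof (rule bounded_clinearI[where K = 1])
  fix x y assume t: "0 \<le> t"
  have "(\<lambda>k. V k t (x + y)) \<longlonglongrightarrow> T0 t x + T0 t y"
    using tendsto_add[OF V_tendsto[OF t, of x] V_tendsto[OF t, of y]] by (simp add: linear_add[OF V_linear[OF t]])
  then show "T0 t (x + y) = T0 t x + T0 t y" using V_tendsto[OF t, of "x + y"] LIMSEQ_unique by blast
next
  fix c x assume t: "0 \<le> t"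
  have "bounded_linear (\<lambda>x. c *\<^sub>C (x::'x))" by (rule scaleC.bounded_linear_right)
  then show "T0 t (c *\<^sub>C x) = c *\<^sub>C T0 t x" using t by (intro T0_commute) (auto simp: J_scaleC)
qed (simp add: T0_contraction)

lemma T0_linear: "0 \<le> t \<Longrightarrow> linear (T0 t)"
  by (simp add: T0_bounded_clinear bounded_clinear_imp_bounded_linear bounded_linear.linear)

lemma T0_bounded_linear: "0 \<le> t \<Longrightarrow> bounded_linear (T0 t)"
  by (simp add: T0_bounded_clinear bounded_clinear_imp_bounded_linear)

lemma T0_zero: "T0 0 x = x"
proof -
  have "V k 0 x = x" for k
  proof -
    have "((\<lambda>x::'x. x) ^^ n) x = x" for n by (induction n) auto
    moreover have "J 0 = (\<lambda>x. x)" by (rule ext) simp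
    ultimately show ?thesis by (simp add: V_def)
  qed
  then show ?thesis using V_tendsto[of 0 x] LIMSEQ_unique[OF _ tendsto_const] by fastforce
qed

lemma T0_symmetric: "0 \<le> t \<Longrightarrow> cinner (T0 t x) y = cinner x (T0 t y)"
proof -
  assume t: "0 \<le> t"
  have "cinner ((J h ^^ n) x) y = cinner x ((J h ^^ n) y)" if "0 \<le> h" for h n
  proof (induction n arbitrary: x y)
    case (Suc n)
    have "cinner ((J h ^^ Suc n) x) y = cinner ((J h ^^ n) x) (J h y)" using that by (simp add: J_symmetric)
    then show ?case using Suc by (simp add: funpow_swap1)
  qed simp
  then have "cinner (V k t x) y = cinner x (V k t y)" for k using t by (simp add: V_def)
  moreover have "(\<lambda>k. cinner (V k t x) y) \<longlonglongrightarrow> cinner (T0 t x) y"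
    by (intro cinner.tendsto V_tendsto t tendsto_const)
  moreover have "(\<lambda>k. cinner x (V k t y)) \<longlonglongrightarrow> cinner x (T0 t y)"
    by (intro cinner.tendsto V_tendsto t tendsto_const)
  ultimately show ?thesis using LIMSEQ_unique by fastforce
qed

lemma T0_R_commute: "0 \<le> t \<Longrightarrow> l \<in> rho \<Longrightarrow> T0 t (R l x) = R l (T0 t x)"
  by (intro T0_commute R_bounded_linear J_R_commute)

text \<open>At level \<open>k\<close> the products for \<open>s\<close>, \<open>t\<close> and
  \<open>s + t\<close> have equally many steps, so they are compared step by step. The
  \<open>2 ^ k\<close> errors are each of order \<open>s t / 4 ^ k\<close> and vanish in
  total.\<close>

lemma T0_add:
  assumes s: "0 \<le> s" and t: "0 \<le> t"
  shows "T0 (s + t) x = T0 s (T0 t x)"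
proof (rule eq_on_D2[of "T0 (s + t)" "\<lambda>x. T0 s (T0 t x)"])
  show "bounded_linear (T0 (s + t))" using s t by (intro T0_bounded_linear) simp
  show "bounded_linear (\<lambda>x. T0 s (T0 t x))"
    using s t by (intro bounded_linear_compose[OF T0_bounded_linear T0_bounded_linear])
  fix x assume x: "x \<in> D2"
  have "(\<lambda>k. V k s (V k t x) - V k (s + t) x) \<longlonglongrightarrow> 0"
  proof (rule tendsto_zero_norm_le)
    fix k
    let ?s = "s / 2 ^ k" and ?t = "t / 2 ^ k"
    have st: "0 \<le> ?s" "0 \<le> ?t" "(s + t) / 2 ^ k = ?s + ?t" using s t by (auto simp: add_divide_distrib)
    have "V k s (V k t x) = ((\<lambda>x. J ?s (J ?t x)) ^^ (2 ^ k)) x"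
      unfolding V_def using st by (intro funpow_comp_commute[symmetric] J_commute)
    then have "norm (V k s (V k t x) - V k (s + t) x)
        = norm (((\<lambda>x. J ?s (J ?t x)) ^^ (2 ^ k)) x - (J (?s + ?t) ^^ (2 ^ k)) x)"
      using st(3) by (simp only: V_def)
    also have "\<dots> \<le> real (2 ^ k) * norm (J ?s (J ?t x) - J (?s + ?t) x)"
    proof (rule funpow_diff_le)
      show "linear (\<lambda>x. J ?s (J ?t x))"
        using linear_compose[OF J_linear J_linear, of ?t ?s] st by (simp add: comp_def)
      show "norm (J ?s (J ?t x)) \<le> norm x" for x using J_contraction st by (meson order_trans)
    qed (use st in \<open>simp_all add: J_linear J_contraction J_commute\<close>)
    also have "\<dots> \<le> real (2 ^ k) * (?s * ?t * norm (C (C x)))"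
      by (intro mult_left_mono J_product_diff st x) simp
    also have "\<dots> = s * t * norm (C (C x)) / 2 ^ k" by simp
    finally show "norm (V k s (V k t x) - V k (s + t) x) \<le> s * t * norm (C (C x)) / 2 ^ k" .
  next
    show "(\<lambda>k. s * t * norm (C (C x)) / 2 ^ k) \<longlonglongrightarrow> 0" by (intro LIMSEQ_divide_realpow_zero) auto
  qed
  moreover have "(\<lambda>k. V k s (V k t x)) \<longlonglongrightarrow> T0 s (T0 t x)"
  proof -
    have "(\<lambda>k. V k s (V k t x) - V k s (T0 t x)) \<longlonglongrightarrow> 0"
    proof (rule tendsto_zero_norm_le)
      show "norm (V k s (V k t x) - V k s (T0 t x)) \<le> norm (V k t x - T0 t x)" for k
        using V_contraction[OF s, of k "V k t x - T0 t x"] by (simp add: linear_diff[OF V_linear[OF s]])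
      show "(\<lambda>k. norm (V k t x - T0 t x)) \<longlonglongrightarrow> 0"
        using V_tendsto[OF t, of x] by (simp add: LIM_zero_iff tendsto_norm_zero)
    qed
    from tendsto_add[OF this V_tendsto[OF s, of "T0 t x"]] show ?thesis by simp
  qed
  ultimately have "(\<lambda>k. V k (s + t) x) \<longlonglongrightarrow> T0 s (T0 t x)"
    using tendsto_diff[of "\<lambda>k. V k s (V k t x)" "T0 s (T0 t x)" sequentially "\<lambda>k. V k s (V k t x) - V k (s + t) x" 0]
    by simp
  then show "T0 (s + t) x = T0 s (T0 t x)" using V_tendsto[of "s + t" x] s t LIMSEQ_unique by fastforce
qed

lemma T0_minus_id:
  assumes t: "0 \<le> t" and x: "x \<in> D"
  shows "norm (T0 t x - x) \<le> t * norm (C x)"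
proof (rule LIMSEQ_le_const2)
  show "(\<lambda>k. norm (V k t x - x)) \<longlonglongrightarrow> norm (T0 t x - x)"
    by (intro tendsto_norm tendsto_diff V_tendsto t tendsto_const)
  have "norm (V k t x - x) \<le> t * norm (C x)" for k
  proof -
    have id: "((\<lambda>x::'x. x) ^^ n) x = x" for n by (induction n) auto
    have "norm ((J (t / 2 ^ k) ^^ (2 ^ k)) x - ((\<lambda>x. x) ^^ (2 ^ k)) x) \<le> real (2 ^ k) * norm (J (t / 2 ^ k) x - x)"
      using t by (intro funpow_diff_le) (auto simp: J_linear J_contraction linear_id[unfolded id_def])
    also have "\<dots> \<le> real (2 ^ k) * (t / 2 ^ k * norm (C x))"
      using t x by (intro mult_left_mono norm_J_minus) auto
    finally show ?thesis by (simp add: V_def id)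
  qed
  then show "\<exists>N. \<forall>n\<ge>N. norm (V n t x - x) \<le> t * norm (C x)" by blast
qed

text \<open>\<open>J t\<close> is the level 0 approximation \<open>V 0 t\<close>, so summing all
  dyadic increments bounds \<open>T0 t x - J t x\<close> by \<open>t\<^sup>2 / 2\<close> times
  \<open>norm (C (C x))\<close>. The remaining part is \<open>t (J t - 1) C x\<close>. The sum 3/2
  of the constants is rounded up to 2.\<close>

lemma T0_taylor:
  assumes t: "0 \<le> t" and x: "x \<in> D2"
  shows "norm (T0 t x - x - t *\<^sub>R C x) \<le> 2 * t\<^sup>2 * norm (C (C x))"
proof -
  have D: "x \<in> D" "C x \<in> D" using x by (auto simp: D2_def)
  have "norm (T0 t x - J t x) \<le> t\<^sup>2 / 2 * norm (C (C x))"
  proof (rule LIMSEQ_le_const2)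
    show "(\<lambda>k. norm (V k t x - J t x)) \<longlonglongrightarrow> norm (T0 t x - J t x)"
      by (intro tendsto_norm tendsto_diff V_tendsto t tendsto_const)
    have "norm (V k t x - J t x) \<le> t\<^sup>2 / 2 * norm (C (C x))" for k
      using V_increment[OF assms, of 0 k] by (simp add: V_def[of 0])
    then show "\<exists>N. \<forall>n\<ge>N. norm (V n t x - J t x) \<le> t\<^sup>2 / 2 * norm (C (C x))" by blast
  qed
  moreover have "norm (J t x - x - t *\<^sub>R C x) \<le> t\<^sup>2 * norm (C (C x))"
  proof -
    have "J t x - x - t *\<^sub>R C x = t *\<^sub>R (J t (C x) - C x)" using J_eq[OF t D(1)] by (simp add: algebra_simps)
    then have "norm (J t x - x - t *\<^sub>R C x) = t * norm (J t (C x) - C x)" using t by simp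
    also have "\<dots> \<le> t * (t * norm (C (C x)))" using norm_J_minus[OF t D(2)] t by (intro mult_left_mono)
    finally show ?thesis by (simp add: power2_eq_square)
  qed
  moreover have "norm (T0 t x - x - t *\<^sub>R C x) \<le> norm (T0 t x - J t x) + norm (J t x - x - t *\<^sub>R C x)"
    using dist_triangle[of "T0 t x" "x + t *\<^sub>R C x" "J t x"] by (simp add: dist_norm diff_diff_eq)
  ultimately have "norm (T0 t x - x - t *\<^sub>R C x) \<le> t\<^sup>2 / 2 * norm (C (C x)) + t\<^sup>2 * norm (C (C x))" by linarith
  also have "\<dots> = 3 / 2 * (t\<^sup>2 * norm (C (C x)))" by (simp add: algebra_simps)
  also have "\<dots> \<le> 2 * (t\<^sup>2 * norm (C (C x)))" by (intro mult_right_mono) auto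
  finally show ?thesis by simp
qed

section \<open>Regularity of orbits\<close>

lemma T0_diff_le:
  assumes "0 \<le> s" "0 \<le> t"
  shows "norm (T0 s x - T0 t x) \<le> norm (T0 \<bar>s - t\<bar> x - x)"
proof -
  have *: "norm (T0 s x - T0 t x) \<le> norm (T0 (s - t) x - x)" if "t \<le> s" "0 \<le> t" for s t
  proof -
    have "T0 s x = T0 t (T0 (s - t) x)" using T0_add[of t "s - t" x] that by simp
    then show ?thesis using T0_contraction[of t "T0 (s - t) x - x"] that by (simp add: linear_diff[OF T0_linear])
  qed
  show ?thesis
  proof (cases "t \<le> s")
    case False
    then show ?thesis using *[of s t] assms by (simp add: norm_minus_commute)
  qed (use * assms in simp)
qed

lemma T0_Lipschitz:
  assumes "0 \<le> s" "0 \<le> t" "x \<in> D"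
  shows "norm (T0 s x - T0 t x) \<le> \<bar>s - t\<bar> * norm (C x)"
  using T0_diff_le[OF assms(1,2), of x] T0_minus_id[of "\<bar>s - t\<bar>" x] assms(3) by auto

lemma T0_derivative_D2:
  assumes s: "0 \<le> s" and t: "0 \<le> t" and x: "x \<in> D2"
  shows "norm (T0 s x - T0 t x - (s - t) *\<^sub>R T0 t (C x)) \<le> 3 * \<bar>s - t\<bar>\<^sup>2 * norm (C (C x))"
proof (cases "t \<le> s")
  case True
  let ?h = "s - t"
  have "T0 s x - T0 t x - ?h *\<^sub>R T0 t (C x) = T0 t (T0 ?h x - x - ?h *\<^sub>R C x)"
    using T0_add[of t ?h x] True t by (simp add: linear_diff[OF T0_linear] linear_cmul[OF T0_linear])
  then have "norm (T0 s x - T0 t x - ?h *\<^sub>R T0 t (C x)) \<le> norm (T0 ?h x - x - ?h *\<^sub>R C x)"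
    using T0_contraction[OF t] by simp
  also have "\<dots> \<le> 2 * ?h\<^sup>2 * norm (C (C x))" using True x by (intro T0_taylor) auto
  also have "\<dots> \<le> 3 * \<bar>s - t\<bar>\<^sup>2 * norm (C (C x))" by (intro mult_right_mono) auto
  finally show ?thesis .
next
  case False
  \<comment> \<open>Here \<open>t\<close> is the later time. The Taylor expansion is made at
    \<open>s\<close>, and moving the derivative from \<open>s\<close> to \<open>t\<close> costs one
    more second-order term; this gives 3 = 1 + 2.\<close>
  let ?h = "t - s"
  have D: "C x \<in> D" using x by (auto simp: D2_def)
  have h: "0 \<le> ?h" using False by simp
  have eq: "T0 t y = T0 s (T0 ?h y)" for y using T0_add[OF s h, of y] by simp
  have "T0 s x - T0 t x - (s - t) *\<^sub>R T0 t (C x) = T0 s (?h *\<^sub>R (T0 ?h (C x) - C x) - (T0 ?h x - x - ?h *\<^sub>R C x))"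
    unfolding eq using s
    by (simp only: linear_diff[OF T0_linear] linear_cmul[OF T0_linear]) (simp add: algebra_simps)
  then have "norm (T0 s x - T0 t x - (s - t) *\<^sub>R T0 t (C x)) \<le> norm (?h *\<^sub>R (T0 ?h (C x) - C x) - (T0 ?h x - x - ?h *\<^sub>R C x))"
    using T0_contraction[OF s] by simp
  also have "\<dots> \<le> norm (?h *\<^sub>R (T0 ?h (C x) - C x)) + norm (T0 ?h x - x - ?h *\<^sub>R C x)" by (rule norm_triangle_ineq4)
  also have "\<dots> \<le> ?h * (?h * norm (C (C x))) + 2 * ?h\<^sup>2 * norm (C (C x))"
    using T0_minus_id[OF h D] T0_taylor[OF h x] h by (intro add_mono) (auto intro: mult_left_mono)
  also have "\<dots> = 3 * \<bar>s - t\<bar>\<^sup>2 * norm (C (C x))" by (simp add: power2_eq_square algebra_simps)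
  finally show ?thesis .
qed

text \<open>Passes from \<open>D2\<close> to \<open>D\<close> by approximation in the graph norm:
  \<open>y = J h x\<close> is close to \<open>x\<close>, and \<open>C y = J h (C x)\<close> is close
  to \<open>C x\<close>. The error \<open>x - y\<close> is controlled by the Lipschitz bound,
  uniformly in both times.\<close>

lemma T0_derivative:
  assumes x: "x \<in> D" and e: "0 < e"
  obtains d where "d > 0" "\<And>s t. 0 \<le> s \<Longrightarrow> 0 \<le> t \<Longrightarrow> \<bar>s - t\<bar> < d \<Longrightarrow>
    norm (T0 s x - T0 t x - (s - t) *\<^sub>R T0 t (C x)) \<le> e * \<bar>s - t\<bar>"
proof -
  obtain n where n: "norm (J (1 / Suc n) (C x) - C x) < e / 4"
    using LIMSEQ_D[OF J_tendsto[of "C x"], of "e / 4"] e by auto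
  define y where "y = J (1 / Suc n) x"
  have y: "y \<in> D2" "C y = J (1 / Suc n) (C x)"
    using x J_in_D2[of "1 / Suc n" x] C_J_commute[of "1 / Suc n" x] by (auto simp: y_def)
  have yD: "y \<in> D" using y by (auto simp: D2_def)
  have xy: "x - y \<in> D" "norm (C (x - y)) < e / 4"
    using x yD y(2) n by (auto simp: D_diff C_diff norm_minus_commute simp del: domIff)
  define K where "K = 3 * norm (C (C y)) + 1"
  have K: "K > 0" unfolding K_def by (intro add_nonneg_pos) auto
  show ?thesis
  proof (rule that[of "e / (2 * K)"])
    fix s t :: real assume st: "0 \<le> s" "0 \<le> t" "\<bar>s - t\<bar> < e / (2 * K)"
    let ?E = "\<lambda>x. T0 s x - T0 t x - (s - t) *\<^sub>R T0 t (C x)"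
    have "?E x = ?E y + (T0 s (x - y) - T0 t (x - y)) - (s - t) *\<^sub>R T0 t (C (x - y))"
      using st x yD by (simp add: linear_diff[OF T0_linear] C_diff algebra_simps del: domIff)
    then have "norm (?E x) \<le> norm (?E y + (T0 s (x - y) - T0 t (x - y))) + norm ((s - t) *\<^sub>R T0 t (C (x - y)))"
      by (metis norm_triangle_ineq4)
    also have "\<dots> \<le> norm (?E y) + norm (T0 s (x - y) - T0 t (x - y)) + norm ((s - t) *\<^sub>R T0 t (C (x - y)))"
      by (intro add_right_mono norm_triangle_ineq)
    also have "\<dots> \<le> e / 2 * \<bar>s - t\<bar> + e / 4 * \<bar>s - t\<bar> + e / 4 * \<bar>s - t\<bar>"
    proof (intro add_mono)
      have "norm (?E y) \<le> 3 * \<bar>s - t\<bar>\<^sup>2 * norm (C (C y))" by (rule T0_derivative_D2[OF st(1,2) y(1)])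
      also have "\<dots> = (3 * norm (C (C y)) * \<bar>s - t\<bar>) * \<bar>s - t\<bar>" by (simp only: power2_eq_square mult_ac)
      also have "\<dots> \<le> (K * \<bar>s - t\<bar>) * \<bar>s - t\<bar>" unfolding K_def by (intro mult_right_mono) auto
      also have "\<dots> \<le> e / 2 * \<bar>s - t\<bar>" using st(3) K by (intro mult_right_mono) (auto simp: field_simps)
      finally show "norm (?E y) \<le> e / 2 * \<bar>s - t\<bar>" .
      have "norm (T0 s (x - y) - T0 t (x - y)) \<le> \<bar>s - t\<bar> * norm (C (x - y))"
        by (rule T0_Lipschitz[OF st(1,2) xy(1)])
      also have "\<dots> \<le> \<bar>s - t\<bar> * (e / 4)" using xy(2) by (intro mult_left_mono) auto
      finally show "norm (T0 s (x - y) - T0 t (x - y)) \<le> e / 4 * \<bar>s - t\<bar>" by (simp add: mult.commute)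
      have "norm ((s - t) *\<^sub>R T0 t (C (x - y))) \<le> \<bar>s - t\<bar> * norm (C (x - y))"
        using T0_contraction[OF st(2)] by (simp add: mult_left_mono)
      also have "\<dots> \<le> \<bar>s - t\<bar> * (e / 4)" using xy(2) by (intro mult_left_mono) auto
      finally show "norm ((s - t) *\<^sub>R T0 t (C (x - y))) \<le> e / 4 * \<bar>s - t\<bar>" by (simp add: mult.commute)
    qed
    finally show "norm (?E x) \<le> e * \<bar>s - t\<bar>" by (simp add: algebra_simps)
  qed (use e K in simp)
qed

end

text \<open>If \<open>q 0\<close> exceeded 1, then \<open>q m \<ge> q 0 ^ (2 ^ m)\<close> would be
  unbounded. This removes multiplicative constants, for the semigroup under doubling of time and for
  the resolvent under doubling of the exponent.\<close>

lemma square_doubling_bounded: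
  fixes q :: "nat \<Rightarrow> real"
  assumes sq: "\<And>m. (q m)\<^sup>2 \<le> q (Suc m)" and K: "\<And>m. q m \<le> K" and q0: "0 \<le> q 0"
  shows "q 0 \<le> 1"
proof (rule ccontr)
  assume "\<not> q 0 \<le> 1"
  then have q1: "1 < q 0" by simp
  have pow: "q 0 ^ (2 ^ m) \<le> q m" for m
  proof (induction m)
    case (Suc m)
    have "q 0 ^ (2 ^ Suc m) = (q 0 ^ (2 ^ m))\<^sup>2" by (simp add: power_mult[symmetric] mult.commute)
    also have "\<dots> \<le> (q m)\<^sup>2" using Suc q0 by (intro power_mono) auto
    finally show ?case using sq[of m] by linarith
  qed simp
  obtain n where "K < q 0 ^ n" using real_arch_pow[OF q1] by blast
  also have "\<dots> \<le> q 0 ^ (2 ^ n)" using q1 by (intro power_increasing) (auto intro: less_imp_le less_exp)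
  finally show False using pow[of n] K[of n] by linarith
qed

section \<open>The rescaled semigroup and its generator\<close>

context upper_bounded_self_adjoint
begin

definition T :: "real \<Rightarrow> 'x \<Rightarrow> 'x" where "T t x = exp (a * t) *\<^sub>R T0 t x"

lemma T_bounded_clinear: "0 \<le> t \<Longrightarrow> bounded_clinear (T t)"
  using T0_bounded_clinear[of t] T0_contraction[of t] T0_linear[of t]
  by (intro bounded_clinearI[where K = "exp (a * t)"])
    (auto simp: T_def linear_add scaleR_add_right bounded_clinear_def scaleC.scaleR_right)

lemma T_bounded_linear: "0 \<le> t \<Longrightarrow> bounded_linear (T t)"
  by (simp add: T_bounded_clinear bounded_clinear_imp_bounded_linear)

lemma T_linear: "0 \<le> t \<Longrightarrow> linear (T t)"
  by (simp add: T_bounded_linear bounded_linear.linear)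

lemma T_scaleC: "0 \<le> t \<Longrightarrow> T t (c *\<^sub>C x) = c *\<^sub>C T t x"
  using T_bounded_clinear by (auto simp: bounded_clinear_def)

lemma T_zero: "T 0 x = x" by (simp add: T_def T0_zero)

lemma T_add: "0 \<le> s \<Longrightarrow> 0 \<le> t \<Longrightarrow> T (s + t) x = T s (T t x)"
  by (simp add: T_def T0_add linear_cmul[OF T0_linear] exp_add distrib_left mult.commute)

lemma T_commute: "0 \<le> s \<Longrightarrow> 0 \<le> t \<Longrightarrow> T s (T t x) = T t (T s x)"
  by (metis T_add add.commute)

lemma T_norm: "0 \<le> t \<Longrightarrow> norm (T t x) \<le> exp (a * t) * norm x"
  by (simp add: T_def T0_contraction)

lemma T_symmetric: "0 \<le> t \<Longrightarrow> cinner (T t x) y = cinner x (T t y)"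
  by (simp add: T_def T0_symmetric cinner_scaleR_left cinner_scaleR_right)

lemma T_R_commute: "0 \<le> t \<Longrightarrow> l \<in> rho \<Longrightarrow> T t (R l x) = R l (T t x)"
  by (simp add: T_def T0_R_commute linear_cmul[OF R_linear])

lemma T_in_D: "0 \<le> t \<Longrightarrow> x \<in> D \<Longrightarrow> T t x \<in> D"
  and Op_T: "0 \<le> t \<Longrightarrow> x \<in> D \<Longrightarrow> Op (T t x) = T t (Op x)"
proof -
  assume t: "0 \<le> t" and x: "x \<in> D"
  have i: "\<i> \<in> rho" by (simp add: nonreal_in_rho)
  define w where "w = \<i> *\<^sub>C x - Op x"
  have xw: "x = R \<i> w" using R_left[OF i x] by (simp add: w_def)
  then have Tx: "T t x = R \<i> (T t w)" using t i by (simp add: T_R_commute)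
  then show "T t x \<in> D" using R_in_D[OF i] by simp
  have "Op (T t x) = \<i> *\<^sub>C T t x - T t w" using Op_R[OF i, of "T t w"] Tx by simp
  also have "\<dots> = T t (\<i> *\<^sub>C x - w)" using t by (simp add: linear_diff[OF T_linear] T_scaleC)
  finally show "Op (T t x) = T t (Op x)" by (simp add: w_def)
qed

lemma T0_continuous_on: "continuous_on {0..} (\<lambda>t. T0 t x)"
  unfolding continuous_on_iff
proof (intro ballI allI impI)
  fix t e :: real assume t: "t \<in> {0..}" and e: "0 < e"
  obtain y where y: "y \<in> D2" "norm (x - y) < e / 3" using D2_dense[of "e / 3" x] e by auto
  have yD: "y \<in> D" using y by (auto simp: D2_def)
  let ?d = "e / (3 * (norm (C y) + 1))"
  have pos: "0 < norm (C y) + 1" by (simp add: add_nonneg_pos)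
  show "\<exists>d>0. \<forall>s\<in>{0..}. dist s t < d \<longrightarrow> dist (T0 s x) (T0 t x) < e"
  proof (intro exI[of _ ?d] conjI ballI impI)
    fix s :: real assume s: "s \<in> {0..}" "dist s t < ?d"
    have "dist (T0 s y) (T0 t y) \<le> \<bar>s - t\<bar> * norm (C y)"
      using T0_Lipschitz[of s t y] s t yD by (simp add: dist_norm)
    also have "\<dots> \<le> ?d * (norm (C y) + 1)" using s e pos by (intro mult_mono) (auto simp: dist_real_def)
    also have "\<dots> = e / 3" using pos by (simp add: field_simps)
    finally have "dist (T0 s y) (T0 t y) \<le> e / 3" .
    moreover have "dist (T0 r x) (T0 r y) < e / 3" if "0 \<le> r" for r
      using T0_contraction[OF that, of "x - y"] y(2) that by (simp add: dist_norm linear_diff[OF T0_linear])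
    from this[of s] this[of t] have "dist (T0 s x) (T0 s y) < e / 3" "dist (T0 t x) (T0 t y) < e / 3"
      using s t by auto
    ultimately show "dist (T0 s x) (T0 t x) < e"
      using dist_triangle[of "T0 s x" "T0 t x" "T0 s y"] dist_triangle2[of "T0 s y" "T0 t x" "T0 t y"] by linarith
  qed (use e pos in simp)
qed

lemma T_continuous_on: "continuous_on {0..} (\<lambda>t. T t x)"
  unfolding T_def by (intro continuous_intros T0_continuous_on)

lemma T0_has_vector_derivative:
  assumes x: "x \<in> D" and t: "0 \<le> t"
  shows "((\<lambda>t. T0 t x) has_vector_derivative T0 t (C x)) (at t within {0..})"
  unfolding has_vector_derivative_def has_derivative_within_alt
proof (intro conjI allI impI)
  fix e :: real assume "0 < e"
  from T0_derivative[OF x this] obtain d where "d > 0" "\<And>s t. 0 \<le> s \<Longrightarrow> 0 \<le> t \<Longrightarrow> \<bar>s - t\<bar> < d \<Longrightarrow>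
    norm (T0 s x - T0 t x - (s - t) *\<^sub>R T0 t (C x)) \<le> e * \<bar>s - t\<bar>" by metis
  then show "\<exists>d>0. \<forall>y\<in>{0..}. norm (y - t) < d \<longrightarrow>
       norm (T0 y x - T0 t x - (y - t) *\<^sub>R T0 t (C x)) \<le> e * norm (y - t)"
    using t by (intro exI[of _ d]) auto
qed (rule bounded_linear_scaleR_left)

lemma T_has_vector_derivative:
  assumes x: "x \<in> D" and t: "0 \<le> t"
  shows "((\<lambda>t. T t x) has_vector_derivative T t (Op x)) (at t within {0..})"
proof -
  have "((\<lambda>t. exp (a * t)) has_real_derivative a * exp (a * t)) (at t within {0..})"
    by (auto intro!: derivative_eq_intros)
  from has_vector_derivative_scaleR[OF this T0_has_vector_derivative[OF assms]]
  have "((\<lambda>t. T t x) has_vector_derivative exp (a * t) *\<^sub>R T0 t (C x) + (a * exp (a * t)) *\<^sub>R T0 t x) (at t within {0..})"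
    by (simp add: T_def[abs_def])
  moreover have "exp (a * t) *\<^sub>R T0 t (C x) + (a * exp (a * t)) *\<^sub>R T0 t x = T t (Op x)"
    using t by (simp add: T_def C_def linear_diff[OF T0_linear] linear_cmul[OF T0_linear] algebra_simps)
  ultimately show ?thesis by simp
qed

lemma T_difference_quotient:
  assumes x: "x \<in> D"
  shows "((\<lambda>h. (1 / h) *\<^sub>R (T h x - x)) \<longlongrightarrow> Op x) (at_right 0)"
proof -
  have "((\<lambda>t. T t x) has_vector_derivative Op x) (at 0 within {0<..})"
    using has_vector_derivative_within_subset[OF T_has_vector_derivative[OF x order_refl], of "{0<..}"]
    by (simp add: T_zero subset_eq)
  then have "((\<lambda>h. (1 / norm (h - 0)) *\<^sub>R (T h x - (T 0 x + (h - 0) *\<^sub>R Op x))) \<longlongrightarrow> 0) (at_right 0)"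
    unfolding has_vector_derivative_def has_derivative_within by blast
  moreover have "eventually (\<lambda>h. (1 / norm (h - 0)) *\<^sub>R (T h x - (T 0 x + (h - 0) *\<^sub>R Op x))
      = (1 / h) *\<^sub>R (T h x - x) - Op x) (at_right 0)"
    by (auto simp: eventually_at_filter T_zero algebra_simps)
  ultimately have "((\<lambda>h. (1 / h) *\<^sub>R (T h x - x) - Op x) \<longlongrightarrow> 0) (at_right 0)"
    by (simp add: tendsto_cong)
  then show ?thesis by (simp add: LIM_zero_iff)
qed

text \<open>The generator is no larger than \<open>A\<close>: the bounded operator
  \<open>R \<i>\<close> moves the quotient into \<open>D\<close>, where its limit is known, so
  \<open>A R(\<i>) x = R(\<i>) y\<close>. This says that \<open>x\<close> is itself a value of
  \<open>R \<i>\<close>.\<close>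

lemma difference_quotient_in_D:
  assumes lim: "((\<lambda>h. (1 / h) *\<^sub>R (T h x - x)) \<longlongrightarrow> y) (at_right 0)"
  shows "x \<in> D" "Op x = y"
proof -
  have i: "\<i> \<in> rho" by (simp add: nonreal_in_rho)
  have "((\<lambda>h. R \<i> ((1 / h) *\<^sub>R (T h x - x))) \<longlongrightarrow> R \<i> y) (at_right 0)"
    by (rule bounded_linear.tendsto[OF R_bounded_linear[OF i] lim])
  moreover have "eventually (\<lambda>h. R \<i> ((1 / h) *\<^sub>R (T h x - x)) = (1 / h) *\<^sub>R (T h (R \<i> x) - R \<i> x)) (at_right 0)"
    using i by (auto simp: eventually_at_filter T_R_commute linear_cmul[OF R_linear] linear_diff[OF R_linear])
  ultimately have "((\<lambda>h. (1 / h) *\<^sub>R (T h (R \<i> x) - R \<i> x)) \<longlongrightarrow> R \<i> y) (at_right 0)"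
    by (rule Lim_transform_eventually)
  then have "Op (R \<i> x) = R \<i> y"
    using T_difference_quotient[OF R_in_D[OF i]] tendsto_unique[OF trivial_limit_at_right_real] by blast
  then have "R \<i> (\<i> *\<^sub>C x - y) = x"
    using i by (simp add: Op_R linear_diff[OF R_linear] R_scaleC algebra_simps)
  then show "x \<in> D" using R_in_D[OF i] by metis
  then show "Op x = y"
    using T_difference_quotient tendsto_unique[OF trivial_limit_at_right_real _ lim] by blast
qed

lemma C0_semigroup_T: "C0_semigroup T"
  unfolding C0_semigroup_def
proof (intro conjI allI impI)
  show "T 0 = id" by (auto simp: T_zero)
  show "T (s + t) = T s \<circ> T t" if "0 \<le> s" "0 \<le> t" for s t using T_add[OF that] by auto
  show "((\<lambda>t. T t x) \<longlongrightarrow> x) (at_right 0)" for x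
  proof -
    have "((\<lambda>t. T t x) \<longlongrightarrow> T 0 x) (at 0 within {0..})"
      using T_continuous_on by (auto simp: continuous_on_def)
    then have "((\<lambda>t. T t x) \<longlongrightarrow> T 0 x) (at 0 within {0<..})" by (rule tendsto_within_subset) auto
    then show ?thesis by (simp add: T_zero)
  qed
qed (rule T_bounded_clinear)

lemma generates_T: "generates A T"
proof -
  have "generator T x = A x" for x
  proof (cases "x \<in> D")
    case True
    have lim: "((\<lambda>h. (1 / h) *\<^sub>R (T h x - x)) \<longlongrightarrow> Op x) (at_right 0)"
      by (rule T_difference_quotient[OF True])
    then have "(THE y. ((\<lambda>h. (1 / h) *\<^sub>R (T h x - x)) \<longlongrightarrow> y) (at_right 0)) = Op x"
      using tendsto_unique[OF trivial_limit_at_right_real] by blast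
    then have "generator T x = Some (Op x)" using lim by (auto simp: generator_def)
    then show ?thesis using A_eq[OF True] by simp
  next
    case False
    then have "\<nexists>y. ((\<lambda>h. (1 / h) *\<^sub>R (T h x - x)) \<longlongrightarrow> y) (at_right 0)"
      using difference_quotient_in_D by blast
    moreover have "A x = None" using False by auto
    ultimately show ?thesis by (simp add: generator_def)
  qed
  then show ?thesis using C0_semigroup_T by (auto simp: generates_def)
qed

subsection \<open>Smoothing of orbits of bounded growth\<close>

text \<open>Replaces a spectral projection: in terms of the spectral measure of \<open>x\<close>,
  the condition means that this measure is carried by \<open>(-\<infinity>, w]\<close>.\<close>

definition growth :: "real \<Rightarrow> 'x \<Rightarrow> bool" where
  "growth w x \<longleftrightarrow> (\<forall>t\<ge>0. norm (T t x) \<le> exp (w * t) * norm x)"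

lemma growth_a: "growth a x"
  by (simp add: growth_def T_norm)

lemma T_half: "0 \<le> t \<Longrightarrow> cinner (T t x) x = complex_of_real ((norm (T (t / 2) x))\<^sup>2)"
  using T_add[of "t / 2" "t / 2" x] T_symmetric[of "t / 2" "T (t / 2) x" x] by (simp add: cinner_self_norm)

text \<open>Since \<open>\<parallel>T(t) x\<parallel>\<^sup>2 = \<langle>T(2t) x, x\<rangle> \<le> \<parallel>T(2t) x\<parallel> \<parallel>x\<parallel>\<close>, the constant \<open>K\<close> can be replaced by \<open>\<parallel>x\<parallel>\<close>.\<close>

lemma growthI:
  assumes K: "\<And>t. 0 \<le> t \<Longrightarrow> norm (T t x) \<le> exp (w * t) * K"
  shows "growth w x"
  unfolding growth_def
proof (intro allI impI)
  fix t :: real assume t: "0 \<le> t"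
  show "norm (T t x) \<le> exp (w * t) * norm x"
  proof (cases "x = 0")
    case True
    then show ?thesis using t by (simp add: linear_0[OF T_linear])
  next
    case False
    then have N: "0 < norm x" by simp
    define q where "q m = norm (T (2 ^ m * t) x) / (exp (w * (2 ^ m * t)) * norm x)" for m :: nat
    have "q 0 \<le> 1"
    proof (rule square_doubling_bounded[of q "K / norm x"])
      fix m
      let ?s = "2 ^ m * t"
      have s: "0 \<le> ?s" using t by simp
      have "(norm (T ?s x))\<^sup>2 = cmod (cinner (T (2 * ?s) x) x)" using T_half[of "2 * ?s" x] s by (simp add: norm_power)
      also have "\<dots> \<le> norm (T (2 * ?s) x) * norm x" by (rule norm_cinner_le)
      finally have sq: "(norm (T ?s x))\<^sup>2 \<le> norm (T (2 * ?s) x) * norm x" .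
      have "(q m)\<^sup>2 = (norm (T ?s x))\<^sup>2 / ((exp (w * ?s))\<^sup>2 * (norm x)\<^sup>2)" by (simp add: q_def power_divide power_mult_distrib)
      also have "\<dots> \<le> (norm (T (2 * ?s) x) * norm x) / ((exp (w * ?s))\<^sup>2 * (norm x)\<^sup>2)"
        by (intro divide_right_mono sq) simp
      also have "\<dots> = q (Suc m)"
        using N by (simp add: q_def power2_eq_square exp_add[symmetric] mult.assoc)
      finally show "(q m)\<^sup>2 \<le> q (Suc m)" .
      show "q m \<le> K / norm x" using K[OF s] N by (simp add: q_def field_simps)
      show "0 \<le> q 0" by (simp add: q_def)
    qed
    then show ?thesis using N by (simp add: q_def field_simps)
  qed
qed

text \<open>The operator norm of \<open>S\<close> enters as a constant, which \<open>growthI\<close>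
  absorbs. The same mechanism makes \<open>growth\<close> stable under sums.\<close>

lemma growth_commuting:
  assumes S: "bounded_linear S" "\<And>t x. 0 \<le> t \<Longrightarrow> T t (S x) = S (T t x)" and x: "growth w x"
  shows "growth w (S x)"
proof -
  obtain K where K: "K > 0" "\<And>x. norm (S x) \<le> norm x * K" using bounded_linear.pos_bounded[OF S(1)] by blast
  show ?thesis
  proof (rule growthI)
    fix t :: real assume t: "0 \<le> t"
    have "norm (T t (S x)) \<le> norm (T t x) * K" using S(2)[OF t] K by simp
    also have "\<dots> \<le> (exp (w * t) * norm x) * K" using x t K by (intro mult_right_mono) (auto simp: growth_def)
    finally show "norm (T t (S x)) \<le> exp (w * t) * (norm x * K)" by simp
  qed
qed

lemma growth_R: "l \<in> rho \<Longrightarrow> growth w x \<Longrightarrow> growth w (R l x)"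
  by (intro growth_commuting[of "R l"] R_bounded_linear T_R_commute)

lemma growth_T: "0 \<le> s \<Longrightarrow> growth w x \<Longrightarrow> growth w (T s x)"
  by (intro growth_commuting[of "T s"] T_bounded_linear T_commute)

lemma growth_scaleC: "growth w x \<Longrightarrow> growth w (c *\<^sub>C x)"
  by (intro growth_commuting[of "\<lambda>x. c *\<^sub>C x"] scaleC.bounded_linear_right T_scaleC)

lemma growth_scaleR: "growth w x \<Longrightarrow> growth w (c *\<^sub>R x)"
  using growth_scaleC[of w x "complex_of_real c"] by (simp add: scaleC_of_real)

lemma growth_add:
  assumes "growth w x" "growth w y"
  shows "growth w (x + y)"
proof (rule growthI)
  fix t :: real assume t: "0 \<le> t"
  have "norm (T t (x + y)) \<le> norm (T t x) + norm (T t y)"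
    using t by (simp add: linear_add[OF T_linear] norm_triangle_ineq)
  also have "\<dots> \<le> exp (w * t) * norm x + exp (w * t) * norm y"
    using assms t by (intro add_mono) (auto simp: growth_def)
  finally show "norm (T t (x + y)) \<le> exp (w * t) * (norm x + norm y)" by (simp add: distrib_left)
qed

lemma growth_diff: "growth w x \<Longrightarrow> growth w y \<Longrightarrow> growth w (x - y)"
  using growth_add[of w x "(-1) *\<^sub>R y"] growth_scaleR[of w y "-1"] by simp

lemma growth_J: "0 < h \<Longrightarrow> growth w x \<Longrightarrow> growth w (J h x)"
  by (simp add: J_pos growth_scaleR growth_R shift_in_rho del: of_real_add of_real_divide)

text \<open>For \<open>f(t) = e\<^sup>-\<^sup>w\<^sup>t \<langle>T(t) x, x\<rangle>\<close> one has \<open>f \<ge> 0\<close>, \<open>f\<close> decreasing, and \<open>f''(t) = \<parallel>e\<^sup>-\<^sup>w\<^sup>t\<^sup>/\<^sup>2 T(t/2)(A - w) x\<parallel>\<^sup>2\<close>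
  decreasing; three applications of the mean value theorem bound \<open>f''\<close> by \<open>f(0)/t\<^sup>2\<close>.\<close>

lemma smoothing_D:
  assumes x: "x \<in> D" "growth w x" and z: "z = Op x - w *\<^sub>R x" "growth w z" and t: "0 < t"
  shows "norm (T t z) \<le> 2 * exp (w * t) * norm x / t"
proof -
  define s where "s = t / 2"
  have s: "0 < s" using t by (simp add: s_def)
  define u where "u t y = exp (- w * t) *\<^sub>R T t y" for t y
  have du: "((\<lambda>t. u t x) has_vector_derivative u t z) (at t)" if "0 < t" for t
  proof -
    have "((\<lambda>t. T t x) has_vector_derivative T t (Op x)) (at t)"
      using T_has_vector_derivative[OF x(1), of t] that at_within_interior[of t "{0..}"]
      by simp
    moreover have "((\<lambda>t. exp (- w * t)) has_real_derivative - w * exp (- w * t)) (at t)"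
      by (auto intro!: derivative_eq_intros)
    ultimately have "((\<lambda>t. u t x) has_vector_derivative exp (- w * t) *\<^sub>R T t (Op x) + (- w * exp (- w * t)) *\<^sub>R T t x) (at t)"
      unfolding u_def by (rule has_vector_derivative_scaleR[rotated])
    moreover have "exp (- w * t) *\<^sub>R T t (Op x) + (- w * exp (- w * t)) *\<^sub>R T t x = u t z"
      using that by (simp add: u_def z(1) linear_diff[OF T_linear] linear_cmul[OF T_linear] algebra_simps)
    ultimately show ?thesis by simp
  qed
  define f where "f t = Re (cinner (u t x) x)" for t
  define g where "g t = Re (cinner (u t z) x)" for t
  define k where "k t = Re (cinner (u t z) z)" for t
  have Re: "((\<lambda>t. Re (cinner (u t x) y)) has_real_derivative Re (cinner (u t z) y)) (at t)" if "0 < t" for t y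
  proof -
    have "bounded_linear (\<lambda>x. Re (cinner x y))"
      by (intro bounded_linear_compose[OF bounded_linear_Re] cinner.bounded_linear_left)
    from bounded_linear.has_vector_derivative[OF this du[OF that]] show ?thesis
      by (simp add: has_real_derivative_iff_has_vector_derivative)
  qed
  have df: "DERIV f t :> g t" if "0 < t" for t unfolding f_def g_def by (rule Re[OF that])
  \<comment> \<open>Symmetry of \<open>T t\<close> moves \<open>z\<close> into the fixed argument,
    so \<open>g\<close> can be differentiated again although \<open>z\<close> need not lie in
    \<open>D\<close>.\<close>
  have gz: "g t = Re (cinner (u t x) z)" if "0 < t" for t
    using T_symmetric[of t x z] Re_cinner_commute[of x "T t z"] that
    by (simp add: g_def u_def cinner_scaleR_left Re_cinner_commute)
  have dg: "DERIV g t :> k t" if "0 < t" for t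
  proof -
    have "DERIV (\<lambda>t. Re (cinner (u t x) z)) t :> k t" unfolding k_def by (rule Re[OF that])
    moreover have "eventually (\<lambda>t. Re (cinner (u t x) z) = g t) (nhds t)"
      using eventually_nhds_in_open[of "{0<..}" t] that by (auto elim!: eventually_mono simp: gz)
    ultimately show ?thesis using DERIV_cong_ev[OF refl, of "\<lambda>t. Re (cinner (u t x) z)" g t] by blast
  qed
  have unorm: "Re (cinner (u t y) y) = (norm (u (t / 2) y))\<^sup>2" if "0 \<le> t" for t y
    using T_half[OF that, of y]
    by (simp add: u_def cinner_scaleR_left power_mult_distrib exp_double[symmetric] flip: of_real_mult)
  have mono: "norm (u r y) \<le> norm (u q y)" if "growth w y" "0 \<le> q" "q \<le> r" for r q y
  proof -
    have "norm (T (r - q) (T q y)) \<le> exp (w * (r - q)) * norm (T q y)"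
      using growth_T[OF that(2,1)] that(3) by (auto simp: growth_def)
    moreover have "T r y = T (r - q) (T q y)" using T_add[of "r - q" q y] that by simp
    ultimately have "exp (- w * r) * norm (T r y) \<le> exp (- w * r) * (exp (w * (r - q)) * norm (T q y))"
      by (intro mult_left_mono) auto
    also have "\<dots> = exp (- w * q) * norm (T q y)" by (simp add: exp_add[symmetric] mult.assoc[symmetric] algebra_simps)
    finally show ?thesis by (simp add: u_def)
  qed
  have f0: "0 \<le> f r" "f r \<le> (norm x)\<^sup>2" if "0 \<le> r" for r
  proof -
    show "0 \<le> f r" using unorm[OF that] by (simp add: f_def)
    have "norm (u (r / 2) x) \<le> norm (u 0 x)" using mono[OF x(2), of 0 "r / 2"] that by simp
    then show "f r \<le> (norm x)\<^sup>2" using unorm[OF that, of x] by (simp add: f_def u_def T_zero power_mono)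
  qed
  have fmono: "f r \<le> f q" and kmono: "k r \<le> k q" if "0 \<le> q" "q \<le> r" for r q
    using mono[OF x(2), of "q / 2" "r / 2"] mono[OF z(2), of "q / 2" "r / 2"] unorm[of r x] unorm[of q x]
      unorm[of r z] unorm[of q z] that by (auto simp: f_def k_def intro!: power_mono)
  \<comment> \<open>With \<open>t = 2 * s\<close>, the value \<open>k (4 * s)\<close> is the squared
    norm of \<open>u t z\<close>. Using the separated intervals from \<open>s\<close> to
    \<open>2 * s\<close> and from \<open>3 * s\<close> to \<open>4 * s\<close> keeps the two
    intermediate points more than \<open>s\<close> apart.\<close>
  obtain xi where xi: "s < xi" "xi < 2 * s" "f (2 * s) - f s = (2 * s - s) * g xi"
    using MVT2[of s "2 * s" f g] df s by auto
  obtain et where et: "3 * s < et" "et < 4 * s" "f (4 * s) - f (3 * s) = (4 * s - 3 * s) * g et"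
    using MVT2[of "3 * s" "4 * s" f g] df s by auto
  obtain ze where ze: "xi < ze" "ze < et" "g et - g xi = (et - xi) * k ze"
    using MVT2[of xi et g k] dg s xi et by auto
  have "s * g et \<le> 0" using et(3) fmono[of "3 * s" "4 * s"] s by simp
  then have "g et \<le> 0" using s by (simp add: mult_le_0_iff)
  moreover have "s * g xi \<ge> - (norm x)\<^sup>2" using xi(3) f0[of s] f0[of "2 * s"] s by simp
  then have "- g xi * s \<le> (norm x)\<^sup>2" by (simp add: mult.commute)
  moreover have "s * k (4 * s) \<le> (et - xi) * k ze"
    using kmono[of ze "4 * s"] unorm[of "4 * s" z] s xi et ze by (intro mult_mono) (auto simp: k_def)
  ultimately have "s * k (4 * s) \<le> - g xi" using ze(3) by linarith
  then have "s * (s * k (4 * s)) \<le> s * (- g xi)" using s by (intro mult_left_mono) auto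
  then have "s\<^sup>2 * k (4 * s) \<le> (norm x)\<^sup>2"
    using \<open>- g xi * s \<le> (norm x)\<^sup>2\<close> by (simp add: power2_eq_square mult_ac)
  moreover have "k (4 * s) = (norm (u t z))\<^sup>2"
    using unorm[of "4 * s" z] s by (simp add: k_def s_def)
  ultimately have "(s * norm (u t z))\<^sup>2 \<le> (norm x)\<^sup>2"
    by (simp only: power_mult_distrib)
  then have "s * norm (u t z) \<le> norm x" by (rule power2_le_imp_le) simp
  then have "exp (w * t) * (s * (exp (- w * t) * norm (T t z))) \<le> exp (w * t) * norm x"
    by (intro mult_left_mono) (auto simp: u_def)
  also have "exp (w * t) * (s * (exp (- w * t) * norm (T t z))) = s * norm (T t z)"
    by (simp add: exp_minus field_simps)
  finally show ?thesis using t by (simp add: s_def field_simps)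
qed

text \<open>The approximants \<open>J (1 / Suc n) x\<close> lie in \<open>D\<close> and inherit the
  growth. The bound of \<open>smoothing_D\<close>, applied to their differences, makes the images a
  Cauchy sequence, and closedness of \<open>A\<close> puts \<open>T t x\<close> into
  \<open>D\<close>.\<close>

lemma smoothing:
  assumes x: "growth w x" and t: "0 < t"
  shows "T t x \<in> D" "norm (Op (T t x) - w *\<^sub>R T t x) \<le> 2 * exp (w * t) * norm x / t"
proof -
  define f where "f n = J (1 / Suc n) x" for n
  define Z where "Z y = Op y - w *\<^sub>R y" for y
  have fD: "f n \<in> D" for n unfolding f_def by (intro J_in_D) simp
  have flim: "f \<longlonglongrightarrow> x" unfolding f_def by (rule J_tendsto)
  have fg: "growth w (f n)" for n unfolding f_def using x by (intro growth_J) simp_all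
  have Zg: "growth w (Z (f n))" for n
  proof -
    \<comment> \<open>Writing \<open>C (J h x)\<close> as a difference quotient expresses
      \<open>Z (f n)\<close> as a combination of \<open>f n\<close> and \<open>x\<close>, so its
      growth bound follows from theirs.\<close>
    have "Z (f n) = real (Suc n) *\<^sub>R (f n - x) + (a - w) *\<^sub>R f n"
      using C_J[of "1 / Suc n" x] by (simp add: Z_def C_def f_def algebra_simps)
    then show ?thesis using x fg by (simp only: growth_add growth_diff growth_scaleR)
  qed
  have est: "norm (T t (Z (f n))) \<le> 2 * exp (w * t) * norm (f n) / t" for n
    using fg Zg t fD by (intro smoothing_D) (auto simp: Z_def)
  have estd: "norm (T t (Z (f n)) - T t (Z (f m))) \<le> 2 * exp (w * t) / t * norm (f n - f m)" for n m
  proof -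
    have Zd: "Z (f n) - Z (f m) = Op (f n - f m) - w *\<^sub>R (f n - f m)"
      using fD by (simp add: Z_def Op_diff algebra_simps del: domIff)
    have "norm (T t (Z (f n) - Z (f m))) \<le> 2 * exp (w * t) * norm (f n - f m) / t"
      by (rule smoothing_D[OF D_diff[OF fD fD] growth_diff[OF fg fg] Zd growth_diff[OF Zg Zg] t])
    then show ?thesis using t by (simp add: linear_diff[OF T_linear])
  qed
  have "Cauchy (\<lambda>n. T t (Z (f n)))"
  proof (rule metric_CauchyI)
    fix e :: real assume e: "0 < e"
    let ?K = "2 * exp (w * t) / t"
    have K: "0 < ?K" using t by simp
    obtain M where M: "\<And>m n. m \<ge> M \<Longrightarrow> n \<ge> M \<Longrightarrow> dist (f m) (f n) < e / ?K"
      using metric_CauchyD[OF LIMSEQ_imp_Cauchy[OF flim] divide_pos_pos[OF e K]] by blast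
    show "\<exists>M. \<forall>m\<ge>M. \<forall>n\<ge>M. dist (T t (Z (f m))) (T t (Z (f n))) < e"
    proof (intro exI[of _ M] allI impI)
      fix m n assume "m \<ge> M" "n \<ge> M"
      then have "?K * norm (f m - f n) < e" using M[of m n] t by (simp add: dist_norm field_simps)
      then show "dist (T t (Z (f m))) (T t (Z (f n))) < e" using estd[of m n] unfolding dist_norm by linarith
    qed
  qed
  then obtain z where z: "(\<lambda>n. T t (Z (f n))) \<longlonglongrightarrow> z" using Cauchy_convergent convergent_def by blast
  have Tlim: "(\<lambda>n. T t (f n)) \<longlonglongrightarrow> T t x"
    using t by (intro bounded_linear.tendsto[OF T_bounded_linear] flim) simp
  have "Op (T t (f n)) = T t (Z (f n)) + w *\<^sub>R T t (f n)" for n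
    using t fD[of n] by (simp add: Op_T Z_def linear_diff[OF T_linear] linear_cmul[OF T_linear] del: domIff)
  then have "(\<lambda>n. Op (T t (f n))) \<longlonglongrightarrow> z + w *\<^sub>R T t x"
    using tendsto_add[OF z tendsto_scaleR[OF tendsto_const Tlim]] by simp
  moreover have "T t (f n) \<in> D" for n using t fD by (intro T_in_D) auto
  ultimately have "T t x \<in> D" "Op (T t x) = z + w *\<^sub>R T t x"
    using closed_op[of "\<lambda>n. T t (f n)", OF _ Tlim] by blast+
  moreover have "norm z \<le> 2 * exp (w * t) * norm x / t"
  proof (rule LIMSEQ_le[OF tendsto_norm[OF z]])
    show "(\<lambda>n. 2 * exp (w * t) * norm (f n) / t) \<longlonglongrightarrow> 2 * exp (w * t) * norm x / t"
      using t by (intro tendsto_intros flim) simp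
  qed (use est in blast)
  ultimately show "T t x \<in> D" "norm (Op (T t x) - w *\<^sub>R T t x) \<le> 2 * exp (w * t) * norm x / t" by auto
qed

end

context upper_bounded_self_adjoint
begin

subsection \<open>Vectors with bounded resolvent orbit in the right half-plane\<close>

text \<open>The qualitative content of the resolvent condition: away from the imaginary axis the
  resolvents do not blow up at \<open>y\<close>, even near spectral points inside the half-plane,
  where \<open>R l\<close> itself does.\<close>

definition resolvent_bounded :: "'x \<Rightarrow> bool" where
  "resolvent_bounded y \<longleftrightarrow> (\<forall>c>0. \<exists>K. \<forall>l\<in>rho. c \<le> Re l \<longrightarrow> norm (R l y) \<le> K)"

lemma Re_gt_a_in_rho: "a < Re l \<Longrightarrow> l \<in> rho"
proof (cases "Im l = 0")
  case True
  then have "l = complex_of_real (Re l)" by (simp add: complex_eq_iff)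
  then show "a < Re l \<Longrightarrow> l \<in> rho" using gt_a_in_rho[of "Re l"] by simp
qed (simp add: nonreal_in_rho)

lemma resolvent_bounded_R:
  assumes "resolvent_bounded y" "m \<in> rho"
  shows "resolvent_bounded (R m y)"
  unfolding resolvent_bounded_def
proof (intro allI impI)
  fix c :: real assume "0 < c"
  then obtain K where K: "\<And>l. l \<in> rho \<Longrightarrow> c \<le> Re l \<Longrightarrow> norm (R l y) \<le> K"
    using assms(1) unfolding resolvent_bounded_def by blast
  obtain B where B: "B > 0" "\<And>x. norm (R m x) \<le> norm x * B"
    using bounded_linear.pos_bounded[OF R_bounded_linear[OF assms(2)]] by blast
  have "norm (R l (R m y)) \<le> K * B" if "l \<in> rho" "c \<le> Re l" for l
  proof -
    have "norm (R l (R m y)) \<le> norm (R l y) * B" using R_commute[OF that(1) assms(2)] B by simp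
    also have "\<dots> \<le> K * B" using K[OF that] B by (intro mult_right_mono) auto
    finally show ?thesis .
  qed
  then show "\<exists>K. \<forall>l\<in>rho. c \<le> Re l \<longrightarrow> norm (R l (R m y)) \<le> K" by blast
qed

lemma resolvent_bounded_scaleR:
  assumes "resolvent_bounded y"
  shows "resolvent_bounded (r *\<^sub>R y)"
  unfolding resolvent_bounded_def
proof (intro allI impI)
  fix c :: real assume "0 < c"
  then obtain K where K: "\<And>l. l \<in> rho \<Longrightarrow> c \<le> Re l \<Longrightarrow> norm (R l y) \<le> K"
    using assms(1) unfolding resolvent_bounded_def by blast
  then show "\<exists>K. \<forall>l\<in>rho. c \<le> Re l \<longrightarrow> norm (R l (r *\<^sub>R y)) \<le> K"
    by (intro exI[of _ "\<bar>r\<bar> * K"]) (auto simp: linear_cmul[OF R_linear] intro: mult_left_mono)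
qed

lemma resolvent_tendsto:
  assumes l: "Im l \<noteq> 0"
  shows "((\<lambda>m. R m x) \<longlongrightarrow> R l x) (at l)"
proof -
  have ev: "eventually (\<lambda>m. \<bar>Im l\<bar> / 2 < \<bar>Im m\<bar>) (at l)"
    using l by (intro order_tendstoD(1)[where y = "\<bar>Im l\<bar>"] tendsto_intros) auto
  have "((\<lambda>m. R m x - R l x) \<longlongrightarrow> 0) (at l)"
  proof (rule Lim_null_comparison)
    show "eventually (\<lambda>m. norm (R m x - R l x) \<le> cmod (l - m) * (norm (R l x) / (\<bar>Im l\<bar> / 2))) (at l)"
      using ev
    proof eventually_elim
      case (elim m)
      then have m: "Im m \<noteq> 0" using l by auto
      have "norm (R m x - R l x) = cmod (l - m) * norm (R m (R l x))"
        using resolvent_identity[of m l x] nonreal_in_rho m l by (simp add: norm_scaleC)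
      also have "norm (R m (R l x)) \<le> norm (R l x) / \<bar>Im m\<bar>" by (rule R_norm_nonreal[OF m])
      also have "\<dots> \<le> norm (R l x) / (\<bar>Im l\<bar> / 2)" using elim l by (intro divide_left_mono) auto
      finally show ?case by (simp add: mult_left_mono)
    qed
    have "((\<lambda>m. cmod (l - m) * (norm (R l x) / (\<bar>Im l\<bar> / 2))) \<longlongrightarrow> cmod (l - l) * (norm (R l x) / (\<bar>Im l\<bar> / 2))) (at l)"
      by (intro tendsto_intros)
    then show "((\<lambda>m. cmod (l - m) * (norm (R l x) / (\<bar>Im l\<bar> / 2))) \<longlongrightarrow> 0) (at l)" by simp
  qed
  then show ?thesis by (simp add: LIM_zero_iff)
qed

lemma cinner_resolvent_derivative:
  assumes l: "Im l \<noteq> 0"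
  shows "((\<lambda>m. cinner (R m y) y) has_field_derivative - cinner (R l (R l y)) y) (at l)"
  unfolding has_field_derivative_iff
proof (rule Lim_transform_eventually)
  show "((\<lambda>m. - cinner (R m (R l y)) y) \<longlongrightarrow> - cinner (R l (R l y)) y) (at l)"
    by (intro tendsto_minus cinner.tendsto tendsto_const resolvent_tendsto l)
  have "eventually (\<lambda>m. m \<noteq> l \<and> Im m \<noteq> 0) (at l)"
    using tendsto_imp_eventually_ne[OF tendsto_Im[OF tendsto_ident_at[of l UNIV]] l] eventually_neq_at_within[of l l UNIV]
    by eventually_elim auto
  then show "eventually (\<lambda>m. - cinner (R m (R l y)) y = (cinner (R m y) y - cinner (R l y) y) / (m - l)) (at l)"
  proof eventually_elim
    case (elim m)
    have "cinner (R m y) y - cinner (R l y) y = (l - m) * cinner (R m (R l y)) y"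
      using resolvent_identity[of m l y] nonreal_in_rho elim l
      by (simp add: cinner_diff_left[symmetric] cinner_scaleC_left)
    then show ?case using elim by (simp add: field_simps)
  qed
qed

text \<open>The scalar resolvent \<open>\<langle>R(l) y, y\<rangle>\<close> is Lipschitz on the resolvent set because
  \<open>\<langle>R(l) y, y\<rangle> - \<langle>R(m) y, y\<rangle> = (m - l) \<langle>R(m) y, R(l)\<^sup>* y\<rangle>\<close>. Hence it extends continuously, and by pasting
  across the real line holomorphically, to the half-plane, although the spectrum may be present there.\<close>

lemma scalar_resolvent_extension:
  assumes K: "\<And>l. l \<in> rho \<Longrightarrow> c \<le> Re l \<Longrightarrow> norm (R l y) \<le> K"
  obtains g where "g holomorphic_on {l. c < Re l}"
    "\<And>l. l \<in> rho \<Longrightarrow> c < Re l \<Longrightarrow> g l = cinner (R l y) y"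
    "\<And>l. c < Re l \<Longrightarrow> cmod (g l) \<le> K * norm y"
proof -
  define F where "F l = cinner (R l y) y" for l
  define H where "H = {l. c < Re l}"
  define W where "W = H \<inter> rho"
  have "norm (R (Complex c 1) y) \<le> K" by (rule K) (simp_all add: nonreal_in_rho)
  then have K0: "0 \<le> K" by (rule order_trans[OF norm_ge_zero])
  have lip: "dist (F l) (F m) \<le> K\<^sup>2 * dist l m" if "l \<in> W" "m \<in> W" for l m
  proof -
    have lm: "l \<in> rho" "m \<in> rho" "c < Re l" "c < Re m" using that by (auto simp: W_def H_def)
    have "F l - F m = (m - l) * cinner (R l (R m y)) y"
      using resolvent_identity[OF lm(1,2), of y] by (simp add: F_def cinner_diff_left[symmetric] cinner_scaleC_left)
    also have "cinner (R l (R m y)) y = cinner (R m y) (R (cnj l) y)" by (rule R_symmetric[OF lm(1)])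
    finally have "cmod (F l - F m) = cmod (m - l) * cmod (cinner (R m y) (R (cnj l) y))" by (simp add: norm_mult)
    also have "\<dots> \<le> cmod (m - l) * (norm (R m y) * norm (R (cnj l) y))" by (intro mult_left_mono norm_cinner_le) simp
    also have "\<dots> \<le> cmod (m - l) * (K * K)"
      using K[of m] K[of "cnj l"] lm cnj_in_rho[OF lm(1)] K0 by (intro mult_left_mono mult_mono) auto
    finally show ?thesis by (simp add: dist_norm power2_eq_square norm_minus_commute mult.commute)
  qed
  have "uniformly_continuous_on W F"
    unfolding uniformly_continuous_on_def
  proof (intro allI impI)
    fix e :: real assume e: "0 < e"
    have pos: "0 < K\<^sup>2 + 1" by (simp add: add_nonneg_pos)
    show "\<exists>d>0. \<forall>x\<in>W. \<forall>x'\<in>W. dist x' x < d \<longrightarrow> dist (F x') (F x) < e"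
    proof (intro exI[of _ "e / (K\<^sup>2 + 1)"] conjI ballI impI)
      fix x x' assume x: "x \<in> W" "x' \<in> W" "dist x' x < e / (K\<^sup>2 + 1)"
      have "dist (F x') (F x) \<le> K\<^sup>2 * dist x' x" using lip x by blast
      also have "\<dots> \<le> (K\<^sup>2 + 1) * dist x' x" by (intro mult_right_mono) auto
      also have "\<dots> < e" using x(3) pos by (simp add: field_simps)
      finally show "dist (F x') (F x) < e" .
    qed (use e pos in simp)
  qed
  then obtain g where g: "uniformly_continuous_on (closure W) g" "\<And>x. x \<in> W \<Longrightarrow> F x = g x"
    using uniformly_continuous_on_extension_on_closure by metis
  have HW: "H \<subseteq> closure W"
  proof
    fix l assume l: "l \<in> H"
    show "l \<in> closure W"
    proof (cases "Im l = 0")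
      case False
      then have "l \<in> W" using l nonreal_in_rho by (simp add: W_def)
      then show ?thesis using closure_subset by blast
    next
      case True
      \<comment> \<open>A real point may belong to the spectrum; it is reached from nonreal points,
        which never do.\<close>
      have "(\<lambda>n. l + \<i> * of_real (1 / Suc n)) \<longlonglongrightarrow> l + \<i> * of_real 0"
        by (intro tendsto_intros) (use LIMSEQ_inverse_real_of_nat in \<open>simp add: inverse_eq_divide\<close>)
      moreover have "l + \<i> * of_real (1 / Suc n) \<in> W" for n
        using l True by (auto simp: W_def H_def intro!: nonreal_in_rho simp: add_nonneg_eq_0_iff)
      ultimately show ?thesis
        unfolding closure_sequential by (intro exI[of _ "\<lambda>n. l + \<i> * of_real (1 / Suc n)"]) simp
    qed
  qed
  have contg: "continuous_on H g"
    using uniformly_continuous_imp_continuous[OF g(1)] HW by (rule continuous_on_subset)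
  have openH: "open H" unfolding H_def by (simp add: open_halfspace_Re_gt)
  have hol: "g holomorphic_on (H \<inter> S)" if S: "open S" "\<And>l. l \<in> S \<Longrightarrow> Im l \<noteq> 0" for S
  proof -
    have "F holomorphic_on (H \<inter> S)"
      unfolding holomorphic_on_def field_differentiable_def F_def
      using cinner_resolvent_derivative S(2) has_field_derivative_at_within by blast
    moreover have "F l = g l" if "l \<in> H \<inter> S" for l using that S(2) nonreal_in_rho g(2) by (auto simp: W_def)
    ultimately show ?thesis using holomorphic_transform by blast
  qed
  have "g holomorphic_on H"
  proof (rule holomorphic_on_paste_across_line[OF openH, of \<i> g 0])
    have eq: "\<i> \<bullet> z = Im z" for z by (simp add: inner_complex_def)
    show "g holomorphic_on H \<inter> {z. \<i> \<bullet> z < 0}" unfolding eq by (rule hol) (auto intro: open_halfspace_Im_lt)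
    show "g holomorphic_on H \<inter> {z. 0 < \<i> \<bullet> z}" unfolding eq by (rule hol) (auto intro: open_halfspace_Im_gt)
  qed (use contg in auto)
  moreover have "cmod (g l) \<le> K * norm y" if "l \<in> H" for l
  proof -
    have "cmod (g m) \<le> K * norm y" if "m \<in> W" for m
    proof -
      have "cmod (F m) \<le> norm (R m y) * norm y" unfolding F_def by (rule norm_cinner_le)
      also have "\<dots> \<le> K * norm y" using K[of m] that by (intro mult_right_mono) (auto simp: W_def H_def)
      finally show ?thesis using g(2)[OF that] by simp
    qed
    then have "\<forall>x\<in>closure W. cmod (g x) \<le> K * norm y"
      using continuous_le_on_closure[of W "\<lambda>x. cmod (g x)"]
        continuous_on_norm[OF uniformly_continuous_imp_continuous[OF g(1)]] by blast
    then show ?thesis using HW that by blast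
  qed
  ultimately show ?thesis using that[of g] g(2) by (auto simp: H_def W_def F_def)
qed

text \<open>The resolvent identity iterated \<open>N\<close> times, with its exact remainder.
  Convergence of the series is then only a matter of letting the remainder tend to zero.\<close>

lemma Neumann_partial_sum:
  assumes "l0 \<in> rho" "l0 - w \<in> rho"
  shows "cinner (R (l0 - w) y) z = (\<Sum>n<N. cinner ((R l0 ^^ Suc n) y) z * w ^ n)
    + w ^ N * cinner ((R l0 ^^ N) (R (l0 - w) y)) z"
proof (induction N)
  case (Suc N)
  have lin: "linear (R l0 ^^ N)" using assms by (intro linear_funpow R_linear)
  have sc: "(R l0 ^^ N) (c *\<^sub>C x) = c *\<^sub>C (R l0 ^^ N) x" for c x
    using funpow_commute[of "R l0" "\<lambda>x. c *\<^sub>C x" N x] R_scaleC[OF assms(1)] by simp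
  have "R (l0 - w) y = R l0 y + w *\<^sub>C R l0 (R (l0 - w) y)"
    using resolvent_identity[OF assms(2,1), of y] R_commute[OF assms(2,1)] by (simp add: algebra_simps)
  then have eq: "(R l0 ^^ N) (R (l0 - w) y) = (R l0 ^^ N) (R l0 y) + w *\<^sub>C (R l0 ^^ N) (R l0 (R (l0 - w) y))"
    by (metis linear_add[OF lin] sc)
  have sw: "(R l0 ^^ N) (R l0 x) = (R l0 ^^ Suc N) x" for x by (simp add: funpow_swap1)
  have "cinner ((R l0 ^^ N) (R (l0 - w) y)) z
      = cinner ((R l0 ^^ Suc N) y) z + w * cinner ((R l0 ^^ Suc N) (R (l0 - w) y)) z"
    by (simp only: eq sw cinner_add_left cinner_scaleC_left)
  then show ?case unfolding Suc by (simp add: algebra_simps)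
qed simp

lemma norm_R_funpow:
  assumes "a < r"
  shows "norm ((R (complex_of_real r) ^^ n) x) \<le> norm x / (r - a) ^ n"
proof (induction n)
  case (Suc n)
  have "norm ((R (complex_of_real r) ^^ Suc n) x) \<le> norm ((R (complex_of_real r) ^^ n) x) / (r - a)"
    using R_norm_real[OF assms] by simp
  also have "\<dots> \<le> (norm x / (r - a) ^ n) / (r - a)" using Suc assms by (intro divide_right_mono) auto
  finally show ?case by (simp add: mult.commute)
qed simp

lemma R_funpow_symmetric:
  assumes "a < r"
  shows "cinner ((R (complex_of_real r) ^^ n) x) z = cinner x ((R (complex_of_real r) ^^ n) z)"
proof (induction n arbitrary: x z)
  case (Suc n)
  have "cinner ((R (complex_of_real r) ^^ Suc n) x) z = cinner ((R (complex_of_real r) ^^ n) x) (R (complex_of_real r) z)"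
    using R_symmetric[OF gt_a_in_rho[OF assms]] by simp
  then show ?case using Suc by (simp add: funpow_swap1)
qed simp

text \<open>The Taylor coefficients of the extension at \<open>r\<^sub>0\<close> are \<open>\<langle>R(r\<^sub>0)\<^sup>n\<^sup>+\<^sup>1 y, y\<rangle>\<close> up to sign, so
  Cauchy's estimate bounds these moments.\<close>

lemma moment_bound:
  assumes K: "\<And>l. l \<in> rho \<Longrightarrow> c \<le> Re l \<Longrightarrow> norm (R l y) \<le> K" and r0: "a < r0" and r: "0 < r" "r < r0 - c"
  shows "cmod (cinner ((R (complex_of_real r0) ^^ Suc n) y) y) \<le> K * norm y / r ^ n"
proof -
  obtain g where g: "g holomorphic_on {l. c < Re l}"
    "\<And>l. l \<in> rho \<Longrightarrow> c < Re l \<Longrightarrow> g l = cinner (R l y) y"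
    "\<And>l. c < Re l \<Longrightarrow> cmod (g l) \<le> K * norm y"
    using scalar_resolvent_extension[OF K] by blast
  let ?l0 = "complex_of_real r0"
  have l0: "?l0 \<in> rho" by (rule gt_a_in_rho[OF r0])
  \<comment> \<open>The reflection at \<open>?l0\<close> makes the Taylor coefficients in
    \<open>w\<close> equal to the moments without alternating signs.\<close>
  define f where "f w = g (?l0 - w)" for w
  define F where "F = Abs_fps (\<lambda>n. cinner ((R ?l0 ^^ Suc n) y) y)"
  have inH: "c < Re (?l0 - w)" if "cmod w \<le> r" for w
    using complex_Re_le_cmod[of w] that r by simp
  have "f has_fps_expansion F"
  proof (rule has_fps_expansionI)
    \<comment> \<open>The Neumann series is available only within distance \<open>r0 - a\<close>,
      where it identifies the coefficients. Cauchy's estimate afterwards uses the disc of radius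
      \<open>r\<close>, which may reach beyond \<open>a\<close>.\<close>
    define d where "d = min r (r0 - a)"
    have d: "0 < d" using r r0 by (simp add: d_def)
    have "(\<lambda>n. fps_nth F n * w ^ n) sums f w" if w: "cmod w < d" for w
    proof -
      have w': "?l0 - w \<in> rho" using complex_Re_le_cmod[of w] w by (intro Re_gt_a_in_rho) (simp add: d_def)
      have fw: "f w = cinner (R (?l0 - w) y) y" unfolding f_def using inH[of w] w by (intro g(2) w') (simp add: d_def)
      let ?rem = "\<lambda>N. w ^ N * cinner ((R ?l0 ^^ N) (R (?l0 - w) y)) y"
      have "?rem \<longlonglongrightarrow> 0"
      proof (rule tendsto_zero_norm_le)
        fix N
        have "cmod (?rem N) \<le> cmod w ^ N * (norm ((R ?l0 ^^ N) (R (?l0 - w) y)) * norm y)"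
          unfolding norm_mult norm_power by (intro mult_left_mono norm_cinner_le) simp
        also have "\<dots> \<le> cmod w ^ N * ((norm (R (?l0 - w) y) / (r0 - a) ^ N) * norm y)"
          by (intro mult_left_mono mult_right_mono norm_R_funpow r0) auto
        also have "\<dots> = (cmod w / (r0 - a)) ^ N * (norm (R (?l0 - w) y) * norm y)" by (simp add: power_divide)
        finally show "cmod (?rem N) \<le> (cmod w / (r0 - a)) ^ N * (norm (R (?l0 - w) y) * norm y)" .
      next
        have "(\<lambda>N. (cmod w / (r0 - a)) ^ N) \<longlonglongrightarrow> 0"
          using w r0 by (intro LIMSEQ_realpow_zero) (auto simp: d_def)
        then show "(\<lambda>N. (cmod w / (r0 - a)) ^ N * (norm (R (?l0 - w) y) * norm y)) \<longlonglongrightarrow> 0"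
          by (rule tendsto_mult_left_zero)
      qed
      then have "(\<lambda>N. f w - ?rem N) \<longlonglongrightarrow> f w - 0" by (intro tendsto_diff tendsto_const)
      moreover have "f w - ?rem N = (\<Sum>n<N. fps_nth F n * w ^ n)" for N
        using Neumann_partial_sum[OF l0 w', of y y N] by (simp add: fw F_def)
      ultimately show ?thesis by (simp add: sums_def)
    qed
    then show "eventually (\<lambda>w. (\<lambda>n. fps_nth F n * w ^ n) sums f w) (nhds 0)"
      using eventually_nhds_in_open[of "ball 0 d" "0::complex"] d by (auto elim!: eventually_mono)
  qed
  then have coeff: "cinner ((R ?l0 ^^ Suc n) y) y = (deriv ^^ n) f 0 / fact n"
    using fps_nth_fps_expansion[of f F n] by (simp add: F_def)
  have hol: "f holomorphic_on cball 0 r"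
    unfolding f_def using inH
    by (intro holomorphic_on_compose_gen[OF _ g(1), unfolded o_def] holomorphic_intros) auto
  have "cmod ((deriv ^^ n) f 0) \<le> fact n * (K * norm y) / r ^ n"
  proof (rule Cauchy_inequality)
    show "f holomorphic_on ball 0 r" using hol by (rule holomorphic_on_subset) auto
    show "continuous_on (cball 0 r) f" using hol by (rule holomorphic_on_imp_continuous_on)
    show "cmod (f x) \<le> K * norm y" if "cmod (0 - x) = r" for x
      unfolding f_def using inH[of x] that by (intro g(3)) simp
  qed (use r in auto)
  then show ?thesis unfolding coeff by (simp add: norm_divide field_simps)
qed

text \<open>At such a vector the resolvent behaves as if the spectrum lay in the negative half-line:
  the bound has \<open>r0\<close> in place of \<open>r0 - a\<close>. The squared norm of
  \<open>R(r0)\<^sup>n y\<close> is the moment of order \<open>2 n\<close>, so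
  \<open>moment_bound\<close> controls all powers, and doubling the exponent reduces the constant to
  1 for every radius \<open>r < r0\<close>.\<close>

lemma resolvent_bounded_norm:
  assumes y: "resolvent_bounded y" and r0: "a < r0"
  shows "norm (R (complex_of_real r0) y) \<le> norm y / r0"
proof (cases "y = 0")
  case True
  then show ?thesis using linear_0[OF R_linear[OF gt_a_in_rho[OF r0]]] by simp
next
  case False
  then have N: "0 < norm y" by simp
  have r0p: "0 < r0" using r0 a_nonneg by simp
  let ?G = "R (complex_of_real r0)"
  have main: "r * norm (?G y) \<le> norm y" if r: "0 < r" "r < r0" for r
  proof -
    \<comment> \<open>Halfway, so that the disc of radius \<open>r\<close> around \<open>r0\<close>
      stays strictly to the right of the abscissa \<open>c\<close>.\<close>
    define c where "c = (r0 - r) / 2"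
    have c: "0 < c" "r < r0 - c" using r by (auto simp: c_def field_simps)
    obtain K where K: "\<And>l. l \<in> rho \<Longrightarrow> c \<le> Re l \<Longrightarrow> norm (R l y) \<le> K"
      using y c(1) unfolding resolvent_bounded_def by blast
    have sq: "(norm ((?G ^^ n) y))\<^sup>2 = cmod (cinner ((?G ^^ (2 * n)) y) y)" for n
    proof -
      have "cinner ((?G ^^ (2 * n)) y) y = cinner ((?G ^^ n) y) ((?G ^^ n) y)"
        using R_funpow_symmetric[OF r0, of n "(?G ^^ n) y" y] by (simp add: funpow_add mult_2)
      then show ?thesis by (simp add: cinner_self_norm norm_power)
    qed
    define q where "q m = norm ((?G ^^ (2 ^ m)) y) * r ^ (2 ^ m) / norm y" for m
    have "q 0 \<le> 1"
    proof (rule square_doubling_bounded[of q "1 + K * r / norm y"])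
      fix m
      let ?n = "2 ^ m :: nat"
      have "(norm ((?G ^^ ?n) y))\<^sup>2 \<le> norm ((?G ^^ (2 * ?n)) y) * norm y"
        unfolding sq by (rule norm_cinner_le)
      then have "(norm ((?G ^^ ?n) y))\<^sup>2 * r ^ (2 * ?n) / (norm y)\<^sup>2 \<le> norm ((?G ^^ (2 * ?n)) y) * norm y * r ^ (2 * ?n) / (norm y)\<^sup>2"
        using r by (intro divide_right_mono mult_right_mono) auto
      also have "\<dots> = q (Suc m)" using N by (simp add: q_def power2_eq_square)
      also have "(norm ((?G ^^ ?n) y))\<^sup>2 * r ^ (2 * ?n) / (norm y)\<^sup>2 = (q m)\<^sup>2"
        by (simp add: q_def power_divide power_mult_distrib power_mult[symmetric] mult.commute)
      finally show "(q m)\<^sup>2 \<le> q (Suc m)" .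
      obtain k where k: "2 * ?n = Suc k" by (metis gr0_implies_Suc nat_0_less_mult_iff pos2 zero_less_power)
      have "(norm ((?G ^^ ?n) y))\<^sup>2 \<le> K * norm y / r ^ k"
        unfolding sq k by (rule moment_bound[OF K r0 r(1) c(2)])
      then have "(norm ((?G ^^ ?n) y))\<^sup>2 * r ^ (2 * ?n) / (norm y)\<^sup>2 \<le> K * norm y / r ^ k * r ^ (2 * ?n) / (norm y)\<^sup>2"
        using r by (intro divide_right_mono mult_right_mono) auto
      also have "\<dots> = K * r / norm y" unfolding k using r N by (simp add: power2_eq_square)
      finally have "(q m)\<^sup>2 \<le> K * r / norm y"
        by (simp add: q_def power_divide power_mult_distrib power_mult[symmetric] mult.commute)
      \<comment> \<open>The moment bound controls \<open>(q m)\<^sup>2\<close>;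
        \<open>q m \<le> 1 + (q m)\<^sup>2\<close> converts it into a bound for \<open>q m\<close>
        itself.\<close>
      moreover have "0 \<le> (q m)\<^sup>2 + 1 - 2 * q m" using zero_le_power2[of "q m - 1"] by (simp add: power2_diff)
      then have "q m \<le> 1 + (q m)\<^sup>2" using zero_le_power2[of "q m"] by linarith
      ultimately show "q m \<le> 1 + K * r / norm y" by linarith
      show "0 \<le> q 0" using r by (simp add: q_def)
    qed
    then show ?thesis using N by (simp add: q_def field_simps)
  qed
  have "r0 * norm (?G y) \<le> norm y"
  proof (rule field_le_mult_one_interval)
    fix z :: real assume "0 < z" "z < 1"
    then show "z * (r0 * norm (?G y)) \<le> norm y" using main[of "z * r0"] r0p by (simp add: mult.assoc)
  qed
  then show ?thesis using r0p by (simp add: field_simps)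
qed

lemma resolvent_bounded_J:
  assumes "resolvent_bounded y" "0 \<le> h"
  shows "resolvent_bounded (J h y)" "norm (J h y) \<le> norm y / (1 + a * h)"
proof -
  show "resolvent_bounded (J h y)"
    using assms shift_in_rho[of h] by (cases "h = 0") (auto simp: J_def resolvent_bounded_scaleR resolvent_bounded_R simp del: of_real_add of_real_divide)
  show "norm (J h y) \<le> norm y / (1 + a * h)"
  proof (cases "h = 0")
    case False
    then have h: "0 < h" using assms by simp
    have "norm (J h y) = (1 / h) * norm (R (complex_of_real (a + 1 / h)) y)" using h by (simp add: J_pos)
    also have "\<dots> \<le> (1 / h) * (norm y / (a + 1 / h))"
      using h assms by (intro mult_left_mono resolvent_bounded_norm) auto
    also have "\<dots> = norm y / (1 + a * h)" using h by (simp add: field_simps)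
    finally show ?thesis .
  qed simp
qed

text \<open>On these vectors every Euler step shrinks by \<open>1 / (1 + a h)\<close>, so the limit
  shrinks by \<open>exp (- a t)\<close>. This cancels exactly the factor \<open>exp (a t)\<close> in
  \<open>T\<close>.\<close>

lemma resolvent_bounded_imp_growth:
  assumes y: "resolvent_bounded y"
  shows "growth 0 y"
  unfolding growth_def
proof (intro allI impI)
  fix t :: real assume t: "0 \<le> t"
  have pow: "resolvent_bounded ((J h ^^ n) y) \<and> norm ((J h ^^ n) y) \<le> norm y / (1 + a * h) ^ n" if h: "0 \<le> h" for h n
  proof (induction n)
    case (Suc n)
    have "norm ((J h ^^ Suc n) y) \<le> norm ((J h ^^ n) y) / (1 + a * h)" using resolvent_bounded_J(2)[OF _ h] Suc by simp
    also have "\<dots> \<le> (norm y / (1 + a * h) ^ n) / (1 + a * h)"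
      using Suc h a_nonneg by (intro divide_right_mono) auto
    finally show ?case using resolvent_bounded_J(1)[OF _ h] Suc by (simp add: mult.commute)
  qed (simp add: y)
  have "norm (T0 t y) \<le> norm y / exp (a * t)"
  proof (rule LIMSEQ_le[OF tendsto_norm[OF V_tendsto[OF t]]])
    have "strict_mono (\<lambda>k. 2 ^ k :: nat)" by (simp add: strict_mono_def)
    from LIMSEQ_subseq_LIMSEQ[OF tendsto_exp_limit_sequentially[of "a * t"] this]
    have "(\<lambda>k. (1 + a * t / real (2 ^ k)) ^ (2 ^ k)) \<longlonglongrightarrow> exp (a * t)" by (simp add: o_def)
    then show "(\<lambda>k. norm y / (1 + a * t / real (2 ^ k)) ^ (2 ^ k)) \<longlonglongrightarrow> norm y / exp (a * t)"
      by (intro tendsto_divide tendsto_const exp_not_eq_zero)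
    have "norm (V k t y) \<le> norm y / (1 + a * t / real (2 ^ k)) ^ (2 ^ k)" for k
      using pow[of "t / 2 ^ k" "2 ^ k"] t by (simp add: V_def)
    then show "\<exists>N. \<forall>k\<ge>N. norm (V k t y) \<le> norm y / (1 + a * t / real (2 ^ k)) ^ (2 ^ k)" by blast
  qed
  then show "norm (T t y) \<le> exp (0 * t) * norm y" by (simp add: T_def field_simps)
qed

end

subsection \<open>A Hilbert type inequality\<close>

lemma finite_measure_lebesgue_on_Icc: "finite_measure (lebesgue_on {0..t::real})"
  by (simp add: finite_measure_lebesgue_on)

text \<open>The row integral in Schur's test for the kernel \<open>1 / (x + y)\<close> with weight
  \<open>1 / sqrt x\<close>. The antiderivative is an arctangent of the square root, so the exact
  bound is \<open>pi\<close>, rounded up to 4.\<close>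

lemma Schur_weight:
  fixes e t c :: real
  assumes e: "0 < e" and t: "0 \<le> t" and c: "0 < c"
  shows "(\<integral>\<^sup>+s. ennreal (sqrt (c / (e + t - s)) / (c + (e + t - s))) \<partial>lebesgue_on {0..t}) \<le> 4"
proof -
  let ?f = "\<lambda>s. sqrt (c / (e + t - s)) / (c + (e + t - s))"
  let ?G = "\<lambda>s. - 2 * arctan (sqrt ((e + t - s) / c))"
  have I: "(?f has_integral (?G t - ?G 0)) {0..t}"
  proof (rule fundamental_theorem_of_calculus[OF t])
    fix s assume s: "s \<in> {0..t}"
    then have p: "0 < (e + t - s) / c" "0 < e + t - s" using e c by auto
    have "(?G has_real_derivative - 2 * (inverse (1 + (sqrt ((e + t - s) / c))\<^sup>2) * (inverse (sqrt ((e + t - s) / c)) / 2 * (- 1 / c)))) (at s within {0..t})"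
      using p by (auto intro!: derivative_eq_intros)
    moreover have "- 2 * (inverse (1 + (sqrt ((e + t - s) / c))\<^sup>2) * (inverse (sqrt ((e + t - s) / c)) / 2 * (- 1 / c))) = ?f s"
    proof -
      have "inverse (sqrt ((e + t - s) / c)) = sqrt (c / (e + t - s))"
        by (simp add: real_sqrt_divide)
      moreover have "(sqrt ((e + t - s) / c))\<^sup>2 = (e + t - s) / c" using p by simp
      moreover have "- 2 * (inverse (1 + p / c) * (S / 2 * (- 1 / c))) = S / (c + p)" if "0 < p" for p S :: real
      proof -
        have "inverse (1 + p / c) = c / (c + p)" using that c by (simp add: field_simps)
        then show ?thesis using c that add_pos_pos[OF c that] by (auto simp: divide_simps)
      qed
      ultimately show ?thesis using p by presburger
    qed
    ultimately show "(?G has_vector_derivative ?f s) (at s within {0..t})"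
      by (simp add: has_real_derivative_iff_has_vector_derivative)
  qed
  have le: "?G t - ?G 0 \<le> 4"
  proof -
    have "0 \<le> arctan (sqrt (e / c))" using e c by simp
    moreover have "arctan (sqrt ((e + t) / c)) < pi / 2" by (rule arctan_ubound)
    moreover have "?G t = - 2 * arctan (sqrt (e / c))" "?G 0 = - 2 * arctan (sqrt ((e + t) / c))" by simp_all
    ultimately show ?thesis using pi_less_4 by linarith
  qed
  have "(\<integral>\<^sup>+s. ennreal (?f s) \<partial>lebesgue_on {0..t}) = (\<integral>\<^sup>+s. ennreal (?f s) * indicator {0..t} s \<partial>lebesgue)"
    by (rule nn_integral_restrict_space) simp
  also have "\<dots> = (\<integral>\<^sup>+s. ennreal (?f s) * indicator {0..t} s \<partial>lborel)"
    by (intro nn_integral_completion) measurable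
  also have "\<dots> = ennreal (?G t - ?G 0)"
    by (rule nn_integral_has_integral_lebesgue'[OF _ I]) (use e c in auto)
  also have "\<dots> \<le> 4" using ennreal_leI[OF le] by simp
  finally show ?thesis .
qed

lemma id_measurable_lebesgue_on: "(\<lambda>x. x) \<in> borel_measurable (lebesgue_on (S :: real set))"
  by (intro measurable_restrict_space1 measurable_completion) simp

text \<open>Schur's test: weighting the two factors by \<open>sqrt (p / q)\<close> and
  \<open>sqrt (q / p)\<close> in the inequality of arithmetic and geometric means splits the
  integrand into two mirror-image terms, each with an explicit inner integral. \<open>F\<close>
  stands for the square of the usual function.\<close>

lemma Hilbert_inequality:
  fixes F :: "real \<Rightarrow> real"
  assumes F[measurable]: "F \<in> borel_measurable (lebesgue_on {0..t})" and F0: "\<And>x. 0 \<le> F x"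
    and e: "0 < e" and t: "0 \<le> t"
  shows "(\<integral>\<^sup>+r. (\<integral>\<^sup>+s. ennreal (sqrt (F r * F s) / ((e + t - r) + (e + t - s))) \<partial>lebesgue_on {0..t}) \<partial>lebesgue_on {0..t})
    \<le> 4 * (\<integral>\<^sup>+r. ennreal (F r) \<partial>lebesgue_on {0..t})"
proof -
  let ?M = "lebesgue_on {0..t}"
  note id_measurable_lebesgue_on[measurable]
  interpret finite_measure ?M by (rule finite_measure_lebesgue_on_Icc)
  interpret pair_sigma_finite ?M ?M ..
  define k where "k r s = sqrt ((e + t - r) / (e + t - s)) / ((e + t - r) + (e + t - s))" for r s
  let ?h = "\<lambda>r s. ennreal (F r) * ennreal (k r s) / 2"
  have k0: "0 \<le> k r s" if "r \<in> {0..t}" "s \<in> {0..t}" for r s using that e by (auto simp: k_def)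
  have pt: "ennreal (sqrt (F r * F s) / ((e + t - r) + (e + t - s))) \<le> ?h r s + ?h s r"
    if rs: "r \<in> {0..t}" "s \<in> {0..t}" for r s
  proof -
    let ?p = "e + t - r" and ?q = "e + t - s"
    have p: "0 < ?p" "0 < ?q" using rs e by auto
    let ?x = "sqrt (F r * sqrt (?p / ?q))" and ?y = "sqrt (F s * sqrt (?q / ?p))"
    have "sqrt (?p / ?q) * sqrt (?q / ?p) = 1" using p by (simp add: real_sqrt_mult[symmetric])
    then have "(F r * sqrt (?p / ?q)) * (F s * sqrt (?q / ?p)) = F r * F s" by (simp add: algebra_simps)
    then have xy: "?x * ?y = sqrt (F r * F s)" by (simp add: real_sqrt_mult[symmetric])
    have "2 * ?x * ?y \<le> ?x\<^sup>2 + ?y\<^sup>2" by (rule sum_squares_bound)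
    then have "sqrt (F r * F s) \<le> (F r * sqrt (?p / ?q) + F s * sqrt (?q / ?p)) / 2"
      using xy F0 p by simp
    then have "sqrt (F r * F s) / (?p + ?q) \<le> (F r * sqrt (?p / ?q) + F s * sqrt (?q / ?p)) / 2 / (?p + ?q)"
      using p by (intro divide_right_mono) auto
    also have "\<dots> = F r * k r s / 2 + F s * k s r / 2"
    proof -
      have "(x * u + y * v) / 2 / (p + q) = x * (u / (p + q)) / 2 + y * (v / (q + p)) / 2" for x u y v p q :: real
        by (simp add: add_divide_distrib add.commute mult.commute)
      then show ?thesis unfolding k_def .
    qed
    finally have "ennreal (sqrt (F r * F s) / (?p + ?q)) \<le> ennreal (F r * k r s / 2 + F s * k s r / 2)"
      by (rule ennreal_leI)
    also have "\<dots> = ennreal (F r * k r s / 2) + ennreal (F s * k s r / 2)"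
      using F0 k0 rs by (intro ennreal_plus) auto
    also have "ennreal (F r * k r s / 2) = ?h r s"
      using F0[of r] k0[OF rs] by (simp add: ennreal_mult[symmetric] divide_ennreal[symmetric] del: times_divide_eq_right)
    also have "ennreal (F s * k s r / 2) = ?h s r"
      using F0[of s] k0[OF rs(2,1)] by (simp add: ennreal_mult[symmetric] divide_ennreal[symmetric] del: times_divide_eq_right)
    finally show ?thesis .
  qed
  have inner: "(\<integral>\<^sup>+s. ?h r s \<partial>?M) \<le> 2 * ennreal (F r)" if "r \<in> {0..t}" for r
  proof -
    have "(\<integral>\<^sup>+s. ?h r s \<partial>?M) = ennreal (F r) / 2 * (\<integral>\<^sup>+s. ennreal (k r s) \<partial>?M)"
      unfolding k_def
      by (subst nn_integral_cmult[symmetric], measurable) (simp add: divide_ennreal_def mult_ac)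
    also have "\<dots> \<le> ennreal (F r) / 2 * 4"
      using Schur_weight[of e t "e + t - r"] that e t by (intro mult_left_mono) (auto simp: k_def)
    also have "\<dots> = 2 * ennreal (F r)"
      using F0[of r] by (simp add: divide_ennreal ennreal_mult'[symmetric] flip: ennreal_numeral)
    finally show ?thesis .
  qed
  have "(\<integral>\<^sup>+r. (\<integral>\<^sup>+s. ennreal (sqrt (F r * F s) / ((e + t - r) + (e + t - s))) \<partial>?M) \<partial>?M)
      \<le> (\<integral>\<^sup>+r. (\<integral>\<^sup>+s. ?h r s + ?h s r \<partial>?M) \<partial>?M)"
    by (intro nn_integral_mono pt) (auto simp: space_restrict_space)
  also have "\<dots> = (\<integral>\<^sup>+r. (\<integral>\<^sup>+s. ?h r s \<partial>?M) \<partial>?M) + (\<integral>\<^sup>+r. (\<integral>\<^sup>+s. ?h s r \<partial>?M) \<partial>?M)"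
    unfolding k_def
    by (subst nn_integral_add[symmetric], measurable) (intro nn_integral_cong nn_integral_add; measurable)
  also have "(\<integral>\<^sup>+r. (\<integral>\<^sup>+s. ?h s r \<partial>?M) \<partial>?M) = (\<integral>\<^sup>+s. (\<integral>\<^sup>+r. ?h s r \<partial>?M) \<partial>?M)"
    unfolding k_def by (rule Fubini') measurable
  also have "(\<integral>\<^sup>+r. (\<integral>\<^sup>+s. ?h r s \<partial>?M) \<partial>?M) + (\<integral>\<^sup>+r. (\<integral>\<^sup>+s. ?h r s \<partial>?M) \<partial>?M)
      \<le> (\<integral>\<^sup>+r. 2 * ennreal (F r) \<partial>?M) + (\<integral>\<^sup>+r. 2 * ennreal (F r) \<partial>?M)"
    by (intro add_mono nn_integral_mono inner) (auto simp: space_restrict_space)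
  also have "\<dots> = 4 * (\<integral>\<^sup>+r. ennreal (F r) \<partial>?M)"
    by (simp add: nn_integral_cmult distrib_right[symmetric])
  finally show ?thesis .
qed

lemma powr_interpolation_le_add:
  fixes x y k :: real
  assumes "0 < x" "0 < y" "0 \<le> k" "k \<le> 1"
  shows "x powr (1 - k) * y powr k \<le> x + y"
proof -
  have "x powr (1 - k) * y powr k \<le> (x + y) powr (1 - k) * (x + y) powr k"
    using assms by (intro mult_mono powr_mono2) auto
  also have "\<dots> = x + y" using assms by (simp add: powr_add[symmetric])
  finally show ?thesis .
qed

text \<open>With \<open>k = 2 (1 - 1/q)\<close> the left side equals \<open>N powr (2 / q)\<close>
  times the geometric mean \<open>x powr (1 - k) * y powr k\<close> of the two summands. The first
  is the kernel for \<open>q = 1\<close>, the second the Hilbert kernel for \<open>q = 2\<close>;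
  dividing by powers of \<open>N\<close> makes both of bounded double integral. The exponents are
  verified on logarithms.\<close>

lemma kernel_interpolation:
  fixes f g d N q :: real
  assumes f: "0 \<le> f" and g: "0 \<le> g" and d: "0 < d" and N: "0 < N" and q: "1 \<le> q" "q \<le> 2"
  shows "f * g * d powr (- 2 * (1 - 1 / q))
    \<le> N powr (2 / q) * (f powr q * g powr q / N\<^sup>2 + sqrt (f powr q * g powr q) / (N * d))"
proof (cases "f = 0 \<or> g = 0")
  case False
  then have fg: "0 < f" "0 < g" using f g by auto
  define k where "k = 2 * (1 - 1 / q)"
  have k: "0 \<le> k" "k \<le> 1" using q by (auto simp: k_def field_simps)
  let ?x = "f powr q * g powr q / N\<^sup>2" and ?y = "sqrt (f powr q * g powr q) / (N * d)"
  have xp: "0 < ?x" "0 < ?y" using fg d N by auto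
  have "q * (1 - k) + q / 2 * k = 1" "- 2 * (1 - k) - k = - 2 / q" using q by (auto simp: k_def field_simps)
  note ex = this
  have "ln (x powr (1 - k) * y powr k) = (1 - k) * ln x + k * ln y" if "0 < x" "0 < y" for x y :: real
    using that by (simp add: ln_mult ln_powr)
  from this[OF xp] have "ln (?x powr (1 - k) * ?y powr k) = (1 - k) * ln ?x + k * ln ?y" .
  also have "ln ?x = q * ln f + q * ln g - 2 * ln N" using fg N by (simp add: ln_mult ln_div ln_powr ln_realpow)
  also have "ln ?y = q / 2 * ln f + q / 2 * ln g - ln N - ln d"
    using fg N d by (simp add: ln_mult ln_div ln_powr ln_sqrt)
  also have "(1 - k) * (q * ln f + q * ln g - 2 * ln N) + k * (q / 2 * ln f + q / 2 * ln g - ln N - ln d)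
     = (q * (1 - k) + q / 2 * k) * (ln f + ln g) + (- 2 * (1 - k) - k) * ln N - k * ln d"
    by (simp add: algebra_simps)
  also have "\<dots> = ln f + ln g - 2 / q * ln N - k * ln d" unfolding ex by simp
  also have "\<dots> = ln (f * g * d powr (- k) * N powr (- 2 / q))"
    using fg d N by (simp add: ln_mult ln_powr)
  finally have "?x powr (1 - k) * ?y powr k = f * g * d powr (- k) * N powr (- 2 / q)"
    using fg d N xp by (subst (asm) ln_inj_iff) auto
  then have "f * g * d powr (- k) * N powr (- 2 / q) \<le> ?x + ?y"
    using powr_interpolation_le_add[OF xp k] by simp
  then have "N powr (2 / q) * (f * g * d powr (- k) * N powr (- 2 / q)) \<le> N powr (2 / q) * (?x + ?y)"
    by (intro mult_left_mono) auto
  also have "N powr (2 / q) * (f * g * d powr (- k) * N powr (- 2 / q)) = f * g * d powr (- k)"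
    using N by (simp add: powr_minus field_simps)
  finally show ?thesis by (simp add: k_def)
qed (use d N in auto)

lemma double_integral_bound:
  fixes f :: "real \<Rightarrow> real"
  assumes f[measurable]: "f \<in> borel_measurable (lebesgue_on {0..t})" and f0: "\<And>x. 0 \<le> f x"
    and int: "integrable (lebesgue_on {0..t}) (\<lambda>x. f x powr q)"
    and q: "1 \<le> q" "q \<le> 2" and e: "0 < e" and t: "0 \<le> t"
  shows "(\<integral>\<^sup>+r. (\<integral>\<^sup>+s. ennreal (f r * f s * ((e + t - r) + (e + t - s)) powr (- 2 * (1 - 1 / q)))
      \<partial>lebesgue_on {0..t}) \<partial>lebesgue_on {0..t})
    \<le> ennreal (5 * (\<integral>x. f x powr q \<partial>lebesgue_on {0..t}) powr (2 / q))" (is "?L \<le> _")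
proof -
  let ?M = "lebesgue_on {0..t}"
  note id_measurable_lebesgue_on[measurable]
  define N where "N = (\<integral>x. f x powr q \<partial>?M)"
  have N0: "0 \<le> N" unfolding N_def by (intro integral_nonneg_AE) auto
  have Nn: "(\<integral>\<^sup>+x. ennreal (f x powr q) \<partial>?M) = ennreal N"
    unfolding N_def by (rule nn_integral_eq_integral[OF int]) auto
  show ?thesis
  proof (cases "N = 0")
    case True
    then have "AE x in ?M. f x powr q = 0"
      using integral_nonneg_eq_0_iff_AE[OF int] by (auto simp: N_def)
    then have "AE x in ?M. f x = 0" by eventually_elim (use f0 in \<open>auto simp: powr_eq_0_iff\<close>)
    then have "?L = (\<integral>\<^sup>+r. 0 \<partial>?M)"
      by (intro nn_integral_cong_AE) (auto elim!: eventually_mono)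
    then show ?thesis by simp
  next
    case False
    then have N: "0 < N" using N0 by simp
    let ?F = "\<lambda>x. f x powr q"
    let ?d = "\<lambda>r s. (e + t - r) + (e + t - s)"
    let ?c = "N powr (2 / q)"
    interpret finite_measure ?M by (rule finite_measure_lebesgue_on_Icc)
    have "?L \<le> (\<integral>\<^sup>+r. (\<integral>\<^sup>+s. ennreal (?c / N\<^sup>2) * (ennreal (?F r) * ennreal (?F s))
        + ennreal (?c / N) * ennreal (sqrt (?F r * ?F s) / ?d r s) \<partial>?M) \<partial>?M)"
    proof (intro nn_integral_mono)
      fix r s assume "r \<in> space ?M" "s \<in> space ?M"
      then have d: "0 < ?d r s" using e by (auto simp: space_restrict_space)
      have "f r * f s * ?d r s powr (- 2 * (1 - 1 / q)) \<le> ?c * (?F r * ?F s / N\<^sup>2 + sqrt (?F r * ?F s) / (N * ?d r s))"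
        by (rule kernel_interpolation[OF f0 f0 d N q])
      also have "\<dots> = ?c / N\<^sup>2 * (?F r * ?F s) + ?c / N * (sqrt (?F r * ?F s) / ?d r s)"
        by (simp add: distrib_left)
      finally have "ennreal (f r * f s * ?d r s powr (- 2 * (1 - 1 / q)))
          \<le> ennreal (?c / N\<^sup>2 * (?F r * ?F s) + ?c / N * (sqrt (?F r * ?F s) / ?d r s))" by (rule ennreal_leI)
      also have "\<dots> = ennreal (?c / N\<^sup>2) * (ennreal (?F r) * ennreal (?F s)) + ennreal (?c / N) * ennreal (sqrt (?F r * ?F s) / ?d r s)"
      proof -
        have "0 \<le> ?c / N\<^sup>2" "0 \<le> ?c / N" "0 \<le> ?F r * ?F s" "0 \<le> sqrt (?F r * ?F s) / ?d r s" using N d by auto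
        then show ?thesis by (simp only: ennreal_plus ennreal_mult mult_nonneg_nonneg powr_ge_zero)
      qed
      finally show "ennreal (f r * f s * ?d r s powr (- 2 * (1 - 1 / q)))
        \<le> ennreal (?c / N\<^sup>2) * (ennreal (?F r) * ennreal (?F s)) + ennreal (?c / N) * ennreal (sqrt (?F r * ?F s) / ?d r s)" .
    qed
    also have "\<dots> = (\<integral>\<^sup>+r. ennreal (?c / N\<^sup>2) * (ennreal (?F r) * ennreal N)
        + ennreal (?c / N) * (\<integral>\<^sup>+s. ennreal (sqrt (?F r * ?F s) / ?d r s) \<partial>?M) \<partial>?M)"
      unfolding Nn[symmetric]
      by (intro nn_integral_cong) (simp add: nn_integral_add nn_integral_cmult)
    also have "\<dots> = ennreal (?c / N\<^sup>2) * (ennreal N * ennreal N)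
        + ennreal (?c / N) * (\<integral>\<^sup>+r. (\<integral>\<^sup>+s. ennreal (sqrt (?F r * ?F s) / ?d r s) \<partial>?M) \<partial>?M)"
      by (simp add: nn_integral_add nn_integral_cmult nn_integral_multc Nn)
    also have "\<dots> \<le> ennreal (?c / N\<^sup>2) * (ennreal N * ennreal N) + ennreal (?c / N) * (4 * ennreal N)"
      using Hilbert_inequality[of ?F t e] e t by (intro add_left_mono mult_left_mono) (auto simp: Nn)
    \<comment> \<open>The product term contributes 1 and Hilbert's inequality 4.\<close>
    also have "\<dots> = ennreal (5 * ?c)"
    proof -
      have 1: "ennreal (?c / N\<^sup>2) * (ennreal N * ennreal N) = ennreal ?c"
        using N by (simp add: ennreal_mult[symmetric] power2_eq_square)
      have 2: "ennreal (?c / N) * (4 * ennreal N) = ennreal (4 * ?c)"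
        using N by (simp add: ennreal_mult[symmetric] flip: ennreal_numeral)
      show ?thesis unfolding 1 2 by (simp flip: ennreal_plus)
    qed
    finally show ?thesis by (simp add: N_def)
  qed
qed

subsection \<open>The extrapolation space\<close>

lemma closed_dense_UNIV: "closed S \<Longrightarrow> range j \<subseteq> S \<Longrightarrow> closure (range j) = UNIV \<Longrightarrow> x \<in> S"
  using closure_minimal by blast

lemma eq_on_dense_range:
  assumes "bounded_linear F" "bounded_linear G" "closure (range j) = UNIV" "\<And>z. F (j z) = G (j z)"
  shows "F y = G y"
proof -
  have "closed {y. F y = G y}"
    using assms(1,2) by (intro closed_Collect_eq linear_continuous_on)
  from closed_dense_UNIV[OF this _ assms(3), of y] show ?thesis using assms(4) by blast
qed

text \<open>Supplies the existence and uniqueness behind the definite description in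
  \<open>ext_along\<close>. The bound by \<open>K\<close> is continuity of \<open>S\<close> for the
  norm induced by \<open>j\<close>; it also makes the value on the range of \<open>j\<close>
  independent of the chosen preimage.\<close>

lemma ext_along:
  fixes j :: "'x::cbanach \<Rightarrow> 'y::cbanach" and S :: "'x \<Rightarrow> 'z::cbanach"
  assumes j: "bounded_clinear j" and dense: "closure (range j) = UNIV"
    and S: "bounded_clinear S" and K: "\<And>z. norm (S z) \<le> K * norm (j z)"
  shows "bounded_clinear (ext_along j S)" "ext_along j S (j z) = S z"
proof -
  have jl: "linear j" and Sl: "linear S"
    using j S by (auto simp: bounded_clinear_def bounded_linear.linear)
  have jc: "j (c *\<^sub>C x) = c *\<^sub>C j x" and Sc: "S (c *\<^sub>C x) = c *\<^sub>C S x" for c x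
    using j S by (auto simp: bounded_clinear_def)
  have diff: "norm (S z - S w) \<le> K * norm (j z - j w)" for z w
    using K[of "z - w"] by (simp add: linear_diff[OF Sl] linear_diff[OF jl])
  define f where "f y = S (inv j y)" for y
  have fj: "f (j z) = S z" for z
    using diff[of "inv j (j z)" z] by (simp add: f_def f_inv_into_f)
  have "uniformly_continuous_on (range j) f"
    unfolding uniformly_continuous_on_def
  proof (intro allI impI)
    fix e :: real assume e: "0 < e"
    have pos: "0 < \<bar>K\<bar> + 1" by (simp add: add_nonneg_pos)
    show "\<exists>d>0. \<forall>x\<in>range j. \<forall>x'\<in>range j. dist x' x < d \<longrightarrow> dist (f x') (f x) < e"
    proof (intro exI[of _ "e / (\<bar>K\<bar> + 1)"] conjI ballI impI)
      fix x x' assume x: "x \<in> range j" "x' \<in> range j" "dist x' x < e / (\<bar>K\<bar> + 1)"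
      then have "dist (f x') (f x) \<le> K * dist x' x" using diff by (auto simp: fj dist_norm)
      also have "\<dots> \<le> (\<bar>K\<bar> + 1) * dist x' x" by (intro mult_right_mono) auto
      also have "\<dots> < e" using x(3) pos by (simp add: field_simps)
      finally show "dist (f x') (f x) < e" .
    qed (use e pos in simp)
  qed
  then obtain g where "uniformly_continuous_on (closure (range j)) g" and g: "\<And>x. x \<in> range j \<Longrightarrow> f x = g x"
    using uniformly_continuous_on_extension_on_closure by metis
  then have cont: "continuous_on UNIV g"
    using uniformly_continuous_imp_continuous dense by metis
  have gj: "g (j z) = S z" for z using g fj by (metis rangeI)
  have comp: "continuous_on UNIV (\<lambda>y. g (h y))" if "continuous_on UNIV h" for h :: "'y \<Rightarrow> 'y"
    using continuous_on_compose2[OF cont that] by simp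
  \<comment> \<open>Additivity extends in one argument at a time: first the left one with the right
    one still in the range of \<open>j\<close>, then the right one.\<close>
  have add1: "g (y + j z) = g y + g (j z)" for y z
  proof -
    have "closed {y. g (y + j z) = g y + g (j z)}"
      by (intro closed_Collect_eq comp continuous_intros cont)
    moreover have "range j \<subseteq> {y. g (y + j z) = g y + g (j z)}"
      by (auto simp: linear_add[OF jl, symmetric] linear_add[OF Sl, symmetric] gj)
    ultimately show ?thesis using closed_dense_UNIV[OF _ _ dense, of _ y] by blast
  qed
  have add: "g (y + y') = g y + g y'" for y y'
  proof -
    have "closed {y'. g (y + y') = g y + g y'}"
      by (intro closed_Collect_eq comp continuous_intros cont)
    moreover have "range j \<subseteq> {y'. g (y + y') = g y + g y'}" using add1 by auto
    ultimately show ?thesis using closed_dense_UNIV[OF _ _ dense, of _ y'] by blast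
  qed
  have sc: "g (c *\<^sub>C y) = c *\<^sub>C g y" for c y
  proof -
    have "closed {y. g (c *\<^sub>C y) = c *\<^sub>C g y}"
      by (intro closed_Collect_eq comp scaleC.continuous_on continuous_on_const continuous_on_id cont)
    moreover have "range j \<subseteq> {y. g (c *\<^sub>C y) = c *\<^sub>C g y}" by (auto simp: jc[symmetric] Sc gj)
    ultimately show ?thesis using closed_dense_UNIV[OF _ _ dense, of _ y] by blast
  qed
  have bound: "norm (g y) \<le> K * norm y" for y
  proof -
    have "closed {y. norm (g y) \<le> K * norm y}"
      by (intro closed_Collect_le continuous_intros cont)
    moreover have "range j \<subseteq> {y. norm (g y) \<le> K * norm y}" using K by (auto simp: gj)
    ultimately show ?thesis using closed_dense_UNIV[OF _ _ dense, of _ y] by blast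
  qed
  have "bounded_clinear g" by (rule bounded_clinearI[OF add sc bound])
  then have "\<exists>!S'. bounded_clinear S' \<and> (\<forall>z. S' (j z) = S z)"
  proof (intro ex1I[of _ g] ext)
    fix S' y assume "bounded_clinear g" "bounded_clinear S' \<and> (\<forall>z. S' (j z) = S z)"
    then show "S' y = g y"
      using gj dense eq_on_dense_range[of S' g j y] by (simp add: bounded_clinear_imp_bounded_linear)
  qed (use gj in auto)
  from theI'[OF this] show "bounded_clinear (ext_along j S)" "ext_along j S (j z) = S z"
    unfolding ext_along_def by auto
qed

locale extrapolated_self_adjoint = upper_bounded_self_adjoint A a
  for A :: "'x::chilbert_space unbounded_op" and a +
  fixes j :: "'x \<Rightarrow> 'y::cbanach" and s :: complex
  assumes j_bounded_clinear: "bounded_clinear j" and j_dense: "closure (range j) = UNIV"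
    and s_in_rho: "s \<in> rho" and norm_j: "\<And>z. norm (j z) = norm (R s z)"
begin

definition E :: "'y \<Rightarrow> 'x" where "E = ext_resolvent j s A"

text \<open>Every resolvent is continuous for the norm defined by \<open>R s\<close>, because
  \<open>R(l) = (1 + (s - l) R(l)) R(s)\<close>.\<close>

lemma ext_resolvent_props:
  assumes l: "l \<in> rho"
  shows "bounded_clinear (ext_resolvent j l A)" "ext_resolvent j l A (j z) = R l z"
proof -
  obtain B where B: "\<And>x. norm (R l x) \<le> norm x * B"
    using bounded_linear.bounded[OF R_bounded_linear[OF l]] by blast
  have "norm (R l z) \<le> (1 + cmod (s - l) * B) * norm (j z)" for z
  proof -
    have "R l z = R s z + (s - l) *\<^sub>C R l (R s z)"
      using resolvent_identity[OF l s_in_rho, of z] by (simp add: algebra_simps)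
    then have "norm (R l z) \<le> norm (R s z) + cmod (s - l) * norm (R l (R s z))"
      by (metis norm_scaleC norm_triangle_ineq)
    also have "\<dots> \<le> norm (R s z) + cmod (s - l) * (norm (R s z) * B)"
      by (intro add_left_mono mult_left_mono B) simp
    finally show ?thesis by (simp add: norm_j algebra_simps)
  qed
  from ext_along[OF j_bounded_clinear j_dense R_bounded_clinear[OF l] this]
  show "bounded_clinear (ext_resolvent j l A)" "ext_resolvent j l A (j z) = R l z"
    by (auto simp: ext_resolvent_def)
qed

lemma E_bounded_clinear: "bounded_clinear E" and E_j: "E (j z) = R s z"
  unfolding E_def by (rule ext_resolvent_props[OF s_in_rho])+

lemma E_bounded_linear: "bounded_linear E"
  by (rule bounded_clinear_imp_bounded_linear[OF E_bounded_clinear])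

lemma norm_E: "norm (E y) = norm y"
proof -
  have "closed {y. norm (E y) = norm y}"
    by (intro closed_Collect_eq continuous_intros linear_continuous_on E_bounded_linear)
  moreover have "range j \<subseteq> {y. norm (E y) = norm y}" by (auto simp: E_j norm_j)
  ultimately show ?thesis using closed_dense_UNIV[OF _ _ j_dense, of _ y] by blast
qed

text \<open>Being isometric on a complete space, \<open>E\<close> has closed range; the range
  contains \<open>D\<close>, the values of \<open>R s\<close>, which is dense.\<close>

lemma bij_E: "bij E"
proof -
  have lin: "linear E" by (rule bounded_linear.linear[OF E_bounded_linear])
  have "inj E"
  proof (rule injI)
    fix x y assume "E x = E y"
    then have "norm (E (x - y)) = 0" by (simp add: linear_diff[OF lin])
    then show "x = y" by (simp add: norm_E)
  qed
  have "complete (range E)"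
    using complete_isometric_image[of 1 UNIV E] E_bounded_linear norm_E complete_UNIV by simp
  then have "closed (range E)" by (rule complete_imp_closed)
  moreover have "D \<subseteq> range E"
  proof
    fix x assume "x \<in> D"
    then have "x = E (j (s *\<^sub>C x - Op x))" using R_left[OF s_in_rho] by (simp add: E_j)
    then show "x \<in> range E" by blast
  qed
  ultimately have "closure D \<subseteq> range E" using closure_minimal by blast
  then have "surj E" using dense_D by auto
  with \<open>inj E\<close> show ?thesis by (simp add: bij_def)
qed

lemma inv_E_bounded_linear: "bounded_linear (inv E)" and E_inv: "E (inv E x) = x" and inv_E: "inv E (E y) = y"
proof -
  have lin: "linear E" by (rule bounded_linear.linear[OF E_bounded_linear])
  show 1: "E (inv E x) = x" for x using bij_E by (simp add: bij_is_surj surj_f_inv_f)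
  show 2: "inv E (E y) = y" for y using bij_E by (simp add: bij_is_inj)
  show "bounded_linear (inv E)"
  proof (rule bounded_linear_intro[where K = 1])
    show "inv E (x + z) = inv E x + inv E z" for x z
      using 2[of "inv E x + inv E z"] by (simp add: linear_add[OF lin] 1)
    show "inv E (r *\<^sub>R x) = r *\<^sub>R inv E x" for r x
      using 2[of "r *\<^sub>R inv E x"] by (simp add: linear_cmul[OF lin] 1)
    show "norm (inv E x) \<le> norm x * 1" for x using norm_E[of "inv E x"] 1 by simp
  qed
qed

text \<open>This is \<open>(s - A) R(l)\<close> written as a bounded operator, so that
  \<open>Y l (E y)\<close> is the extended resolvent at \<open>y\<close>.\<close>

definition Y :: "complex \<Rightarrow> 'x \<Rightarrow> 'x" where "Y l x = x + (s - l) *\<^sub>C R l x"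

lemma Y_linear: "l \<in> rho \<Longrightarrow> bounded_linear (Y l)"
  unfolding Y_def[abs_def]
  using bounded_linear_add[OF bounded_linear_ident bounded_linear_compose[OF scaleC.bounded_linear_right R_bounded_linear]]
  by blast

lemma ext_resolvent_eq:
  assumes l: "l \<in> rho"
  shows "ext_resolvent j l A y = Y l (E y)"
proof (rule eq_on_dense_range[where j = j])
  show "bounded_linear (ext_resolvent j l A)"
    using ext_resolvent_props[OF l] bounded_clinear_imp_bounded_linear by blast
  show "bounded_linear (\<lambda>y. Y l (E y))" by (rule bounded_linear_compose[OF Y_linear[OF l] E_bounded_linear])
  show "ext_resolvent j l A (j z) = Y l (E (j z))" for z
    using ext_resolvent_props(2)[OF l, of z] resolvent_identity[OF l s_in_rho, of z]
    by (simp add: Y_def E_j algebra_simps)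
qed (rule j_dense)

lemma R_s_Y: "l \<in> rho \<Longrightarrow> R s (Y l x) = R l x"
  using resolvent_identity[of l s x] R_commute[of l s x] s_in_rho
  by (simp add: Y_def linear_add[OF R_linear] R_scaleC algebra_simps)

lemma R_s_inj:
  assumes "R s x = R s z"
  shows "x = z"
proof -
  have "w = s *\<^sub>C R s w - Op (R s w)" for w by (simp add: Op_R s_in_rho)
  from this[of x] this[of z] show ?thesis unfolding assms by (rule trans[OF _ sym])
qed

lemma E_ext_semigroup:
  assumes t: "0 \<le> t"
  shows "E (ext_semigroup j T t y) = T t (E y)"
proof -
  have bound: "norm ((j \<circ> T t) z) \<le> exp (a * t) * norm (j z)" for z
    using T_norm[OF t, of "R s z"] by (simp add: norm_j T_R_commute[OF t s_in_rho, symmetric])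
  have bcl: "bounded_clinear (j \<circ> T t)"
    using bounded_clinear_comp[OF j_bounded_clinear T_bounded_clinear[OF t]] by (simp add: o_def)
  note ext = ext_along[OF j_bounded_clinear j_dense bcl bound]
  show ?thesis
  proof (rule eq_on_dense_range[where j = j])
    show "bounded_linear (\<lambda>y. E (ext_semigroup j T t y))"
      unfolding ext_semigroup_def
      by (rule bounded_linear_compose[OF E_bounded_linear bounded_clinear_imp_bounded_linear[OF ext(1)]])
    show "bounded_linear (\<lambda>y. T t (E y))" by (rule bounded_linear_compose[OF T_bounded_linear[OF t] E_bounded_linear])
    show "E (ext_semigroup j T t (j z)) = T t (E (j z))" for z
      unfolding ext_semigroup_def ext(2) by (simp add: E_j T_R_commute[OF t s_in_rho])
  qed (rule j_dense)
qed

text \<open>Transfers the state equation to \<open>X\<close>. The statement that the state is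
  \<open>j x\<close> becomes the statement that the integral is \<open>R s x\<close>, hence lies in
  \<open>D\<close>. The two integrands are matched only on \<open>{0..t}\<close>, where the time
  \<open>t - r\<close> is nonnegative.\<close>

lemma strong_integral_iff:
  fixes B :: "'u \<Rightarrow> 'y"
  shows "has_strong_integral (lebesgue_on {0..t}) (\<lambda>r. ext_semigroup j T (t - r) (B (u r))) (j x)
    \<longleftrightarrow> has_strong_integral (lebesgue_on {0..t}) (\<lambda>r. T (t - r) (E (B (u r)))) (R s x)"
proof -
  let ?f = "\<lambda>r. ext_semigroup j T (t - r) (B (u r))" and ?g = "\<lambda>r. T (t - r) (E (B (u r)))"
  have eq: "E (?f r) = ?g r" if "r \<in> {0..t}" for r using that by (intro E_ext_semigroup) simp
  have cong: "has_strong_integral (lebesgue_on {0..t}) f I \<longleftrightarrow> has_strong_integral (lebesgue_on {0..t}) g I"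
    if "\<And>r. r \<in> {0..t} \<Longrightarrow> f r = g r" for f g :: "real \<Rightarrow> 'b::real_normed_vector" and I
  proof -
    have "strongly_measurable (lebesgue_on {0..t}) f \<longleftrightarrow> strongly_measurable (lebesgue_on {0..t}) g"
      unfolding strongly_measurable_def
      by (intro ex_cong1 conj_cong refl AE_cong) (simp add: that space_restrict_space)
    moreover have "(\<integral>\<^sup>+r. ennreal (norm (f r - h r)) \<partial>lebesgue_on {0..t}) = (\<integral>\<^sup>+r. ennreal (norm (g r - h r)) \<partial>lebesgue_on {0..t})" for h
      by (intro nn_integral_cong) (simp add: that space_restrict_space)
    ultimately show ?thesis unfolding has_strong_integral_def by simp
  qed
  show ?thesis
  proof
    assume "has_strong_integral (lebesgue_on {0..t}) ?f (j x)"
    from has_strong_integral_bounded_linear[OF E_bounded_linear this]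
    show "has_strong_integral (lebesgue_on {0..t}) ?g (R s x)" using cong[OF eq] by (simp add: E_j)
  next
    assume "has_strong_integral (lebesgue_on {0..t}) ?g (R s x)"
    from has_strong_integral_bounded_linear[OF inv_E_bounded_linear this]
    have "has_strong_integral (lebesgue_on {0..t}) (\<lambda>r. inv E (?g r)) (inv E (E (j x)))" by (simp add: E_j)
    moreover have "inv E (?g r) = ?f r" if "r \<in> {0..t}" for r using eq[OF that] inv_E by metis
    ultimately show "has_strong_integral (lebesgue_on {0..t}) ?f (j x)"
      using cong[of "\<lambda>r. inv E (?g r)" ?f] by (simp add: inv_E)
  qed
qed

end

subsection \<open>Admissibility implies the resolvent condition\<close>

lemma strongly_measurable_scaleC:
  fixes c :: "'a \<Rightarrow> complex"
  assumes "c \<in> borel_measurable M"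
  shows "strongly_measurable M (\<lambda>r. c r *\<^sub>C (v::'u::complex_normed_vector))"
proof -
  obtain F where F: "\<And>i. simple_function M (F i)" "\<And>x. x \<in> space M \<Longrightarrow> (\<lambda>i. F i x) \<longlonglongrightarrow> c x"
    using borel_measurable_implies_sequence_metric[OF assms, of 0] by blast
  have "simple_function M (\<lambda>x. F i x *\<^sub>C v)" for i
    using simple_function_compose1[OF F(1)[of i], of "\<lambda>c. c *\<^sub>C v"] by simp
  moreover have "AE x in M. (\<lambda>i. F i x *\<^sub>C v) \<longlonglongrightarrow> c x *\<^sub>C v"
    by (intro AE_I2 scaleC.tendsto F tendsto_const)
  ultimately show ?thesis unfolding strongly_measurable_def by (intro exI[of _ "\<lambda>i x. F i x *\<^sub>C v"]) auto
qed

lemma continuous_on_borel_measurable_lebesgue_on: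
  fixes f :: "real \<Rightarrow> 'b::{metric_space, second_countable_topology}"
  assumes "continuous_on UNIV f"
  shows "f \<in> borel_measurable (lebesgue_on S)"
  using measurable_compose[OF id_measurable_lebesgue_on borel_measurable_continuous_onI[OF assms]] by simp

lemma exponential_input:
  fixes v :: "'u::cbanach"
  assumes q: "p \<noteq> \<infinity>" "1 \<le> enn2real p" and l: "0 < Re l" and t: "0 \<le> t"
  shows "(\<lambda>r. exp (- l * complex_of_real (t - r)) *\<^sub>C v) \<in> Lp_space p (lebesgue_on {0..t})"
    and "Lp_norm p (lebesgue_on {0..t}) (\<lambda>r. exp (- l * complex_of_real (t - r)) *\<^sub>C v) \<le> norm v / Re l powr (1 / enn2real p)"
proof -
  define q where "q = enn2real p"
  have q1: "1 \<le> q" using q by (simp add: q_def)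
  let ?u = "\<lambda>r. exp (- l * complex_of_real (t - r)) *\<^sub>C v"
  have nu: "norm (?u r) powr q = norm v powr q * exp (- (q * Re l) * (t - r))" for r
  proof -
    have "norm (?u r) = exp (- Re l * (t - r)) * norm v" by (simp add: norm_scaleC)
    then have "norm (?u r) powr q = exp (- Re l * (t - r)) powr q * norm v powr q" by (simp add: powr_mult)
    also have "exp (- Re l * (t - r)) powr q = exp (- (q * Re l) * (t - r))" by (simp add: powr_def)
    finally show ?thesis by simp
  qed
  have sm: "strongly_measurable (lebesgue_on {0..t}) ?u"
    by (intro strongly_measurable_scaleC continuous_on_borel_measurable_lebesgue_on continuous_intros)
  have int: "integrable (lebesgue_on {0..t}) (\<lambda>r. norm (?u r) powr q)"
    unfolding nu by (intro continuous_imp_integrable_real continuous_intros)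
  show "?u \<in> Lp_space p (lebesgue_on {0..t})"
    using sm int q by (simp add: Lp_space_def q_def)
  let ?k = "q * Re l"
  have k: "0 < ?k" using l q1 by simp
  have "((\<lambda>r. exp (- ?k * (t - r))) has_integral (exp (- ?k * (t - t)) / ?k - exp (- ?k * (t - 0)) / ?k)) {0..t}"
    using k t by (intro fundamental_theorem_of_calculus)
      (auto simp: has_real_derivative_iff_has_vector_derivative[symmetric] intro!: derivative_eq_intros)
  then have hi: "((\<lambda>r. norm v powr q * exp (- ?k * (t - r))) has_integral
      norm v powr q * (exp (- ?k * (t - t)) / ?k - exp (- ?k * (t - 0)) / ?k)) {0..t}"
    by (rule has_integral_mult_right)
  have "(\<integral>r. norm (?u r) powr q \<partial>lebesgue_on {0..t}) = integral {0..t} (\<lambda>r. norm (?u r) powr q)"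
    by (rule lebesgue_integral_eq_integral[OF int]) simp
  also have "\<dots> = norm v powr q * (exp (- ?k * (t - t)) / ?k - exp (- ?k * (t - 0)) / ?k)"
    unfolding nu by (rule integral_unique[OF hi])
  also have "\<dots> \<le> norm v powr q * (1 / Re l)"
  proof (rule mult_left_mono)
    have "exp (- ?k * (t - t)) / ?k - exp (- ?k * (t - 0)) / ?k \<le> 1 / ?k" using k by simp
    \<comment> \<open>The factor \<open>1 / q\<close> is given up, as \<open>q\<close> is at least
      1.\<close>
    also have "\<dots> \<le> 1 / Re l" using l q1 by (intro divide_left_mono) auto
    finally show "exp (- ?k * (t - t)) / ?k - exp (- ?k * (t - 0)) / ?k \<le> 1 / Re l" .
  qed simp
  finally have le: "(\<integral>r. norm (?u r) powr q \<partial>lebesgue_on {0..t}) \<le> norm v powr q * (1 / Re l)" .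
  have "Lp_norm p (lebesgue_on {0..t}) ?u = (\<integral>r. norm (?u r) powr q \<partial>lebesgue_on {0..t}) powr (1 / q)"
    using q by (simp add: Lp_norm_def q_def)
  also have "\<dots> \<le> (norm v powr q * (1 / Re l)) powr (1 / q)"
    using le q1 by (intro powr_mono2 integral_nonneg_AE) auto
  also have "\<dots> = norm v / Re l powr (1 / q)"
    using l q1 by (simp add: powr_mult powr_powr powr_divide)
  finally show "Lp_norm p (lebesgue_on {0..t}) ?u \<le> norm v / Re l powr (1 / enn2real p)" by (simp add: q_def)
qed

context extrapolated_self_adjoint
begin

text \<open>Because \<open>(l - A) R(l) x = x\<close>, the integrand is the derivative of
  \<open>exp(- l (t - r)) T(t - r) R(l) x\<close>. The fundamental theorem is applied after pairing
  with an arbitrary \<open>z\<close>, where the strong integral becomes a scalar one.\<close>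

lemma exponential_response:
  fixes b :: "'u::cbanach \<Rightarrow> 'x"
  assumes b: "bounded_clinear b" and l: "l \<in> rho" and t: "0 \<le> t"
    and int: "has_strong_integral (lebesgue_on {0..t}) (\<lambda>r. T (t - r) (b (exp (- l * complex_of_real (t - r)) *\<^sub>C v))) I"
  shows "I = R l (b v) - exp (- l * complex_of_real t) *\<^sub>C T t (R l (b v))"
proof (rule cinner_ext)
  fix z
  define x where "x = b v"
  let ?p = "R l x"
  let ?f = "\<lambda>r. T (t - r) (b (exp (- l * complex_of_real (t - r)) *\<^sub>C v))"
  have f: "?f r = exp (- l * complex_of_real (t - r)) *\<^sub>C T (t - r) x" if "r \<le> t" for r
    using b that by (simp add: bounded_clinear_def T_scaleC x_def)
  let ?P = "\<lambda>r. exp (- l * complex_of_real (t - r)) *\<^sub>C T (t - r) ?p"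
  have dP: "(?P has_vector_derivative ?f r) (at r within {0..t})" if r: "r \<in> {0..t}" for r
  proof -
    have "((\<lambda>t. T t ?p) has_vector_derivative T (t - r) (Op ?p)) (at (t - r) within {0..})"
      using r by (intro T_has_vector_derivative R_in_D l) simp
    then have dT: "((\<lambda>t. T t ?p) has_vector_derivative T (t - r) (Op ?p)) (at (t - r) within (\<lambda>r. t - r) ` {0..t})"
      by (rule has_vector_derivative_within_subset) auto
    have "((\<lambda>r. t - r) has_vector_derivative (- 1)) (at r within {0..t})"
      by (auto intro!: derivative_eq_intros)
    from vector_diff_chain_within[OF this dT]
    have d1: "((\<lambda>r. T (t - r) ?p) has_vector_derivative - T (t - r) (Op ?p)) (at r within {0..t})"
      by (simp add: o_def)
    have d2: "((\<lambda>r. exp (- l * complex_of_real (t - r))) has_vector_derivative l * exp (- l * complex_of_real (t - r))) (at r within {0..t})"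
    proof -
      have "((\<lambda>z. exp (- l * (complex_of_real t - z))) has_field_derivative
          l * exp (- l * (complex_of_real t - complex_of_real r))) (at (complex_of_real r))"
        by (auto intro!: derivative_eq_intros)
      from has_vector_derivative_real_field[OF this] show ?thesis by simp
    qed
    have "(?P has_vector_derivative (exp (- l * complex_of_real (t - r)) *\<^sub>C (- T (t - r) (Op ?p))
        + (l * exp (- l * complex_of_real (t - r))) *\<^sub>C T (t - r) ?p)) (at r within {0..t})"
      by (rule scaleC.has_vector_derivative[OF d2 d1])
    moreover have "exp (- l * complex_of_real (t - r)) *\<^sub>C (- T (t - r) (Op ?p))
        + (l * exp (- l * complex_of_real (t - r))) *\<^sub>C T (t - r) ?p = ?f r"
    proof -
      have "T (t - r) (Op ?p) = l *\<^sub>C T (t - r) ?p - T (t - r) x"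
        using r by (simp add: Op_R l linear_diff[OF T_linear] T_scaleC)
      then show ?thesis using f[of r] r
        by (simp add: scaleC.diff_right scaleC_scaleC scaleC.minus_right mult.commute)
    qed
    ultimately show ?thesis by simp
  qed
  have "((\<lambda>r. cinner (?f r) z) has_integral cinner (?P t) z - cinner (?P 0) z) {0..t}"
  proof (rule fundamental_theorem_of_calculus[OF t])
    fix r assume "r \<in> {0..t}"
    from bounded_linear.has_vector_derivative[OF cinner.bounded_linear_left dP[OF this]]
    show "((\<lambda>r. cinner (?P r) z) has_vector_derivative cinner (?f r) z) (at r within {0..t})" .
  qed
  then have "integral {0..t} (\<lambda>r. cinner (?f r) z) = cinner (?P t) z - cinner (?P 0) z" by (rule integral_unique)
  moreover have hb: "has_bochner_integral (lebesgue_on {0..t}) (\<lambda>r. cinner (?f r) z) (cinner I z)"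
    by (rule has_bochner_integral_strong_integral[OF complete_measure_lebesgue_on cinner.bounded_linear_left int]) simp
  then have "cinner I z = integral {0..t} (\<lambda>r. cinner (?f r) z)"
    using lebesgue_integral_eq_integral[of "{0..t}" "\<lambda>r. cinner (?f r) z"]
    by (auto simp: has_bochner_integral_iff)
  ultimately show "cinner I z = cinner (R l (b v) - exp (- l * complex_of_real t) *\<^sub>C T t (R l (b v))) z"
    by (simp add: cinner_diff_left T_zero x_def)
qed

lemma resolvent_condition_nonreal:
  fixes b :: "'u::cbanach \<Rightarrow> 'x"
  assumes b: "bounded_clinear b" and q: "p \<noteq> \<infinity>" "1 \<le> enn2real p"
    and adm: "\<And>t u. 0 \<le> t \<Longrightarrow> u \<in> Lp_space p (lebesgue_on {0..t}) \<Longrightarrow>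
      \<exists>x. has_strong_integral (lebesgue_on {0..t}) (\<lambda>r. T (t - r) (b (u r))) (R s x)
        \<and> norm x \<le> C0 * Lp_norm p (lebesgue_on {0..t}) u"
    and C0: "0 < C0" and l: "0 < Re l" "Im l \<noteq> 0"
  shows "norm (Y l (b v)) \<le> C0 * norm v / Re l powr (1 / enn2real p)"
proof -
  have lr: "l \<in> rho" using l by (intro nonreal_in_rho)
  define t where "t = pi / \<bar>Im l\<bar>"
  have t: "0 \<le> t" by (simp add: t_def)
  let ?u = "\<lambda>r. exp (- l * complex_of_real (t - r)) *\<^sub>C v"
  let ?y = "Y l (b v)"
  obtain x where x: "has_strong_integral (lebesgue_on {0..t}) (\<lambda>r. T (t - r) (b (?u r))) (R s x)"
      "norm x \<le> C0 * Lp_norm p (lebesgue_on {0..t}) ?u"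
    using adm[OF t exponential_input(1)[OF q l(1) t]] by blast
  have "R s x = R l (b v) - exp (- l * complex_of_real t) *\<^sub>C T t (R l (b v))"
    by (rule exponential_response[OF b lr t x(1)])
  also have "\<dots> = R s (?y - exp (- l * complex_of_real t) *\<^sub>C T t ?y)"
    using t s_in_rho by (simp add: linear_diff[OF R_linear] R_scaleC R_s_Y[OF lr] T_R_commute[symmetric])
  finally have xy: "x = ?y - exp (- l * complex_of_real t) *\<^sub>C T t ?y" by (rule R_s_inj)
  have "exp (- l * complex_of_real t) = complex_of_real (- exp (- Re l * t))"
  proof -
    have "Im l * t = pi \<or> Im l * t = - pi" using l(2) by (auto simp: t_def abs_if)
    then show ?thesis by (auto simp: complex_eq_iff Re_exp Im_exp)
  qed
  then have x2: "x = ?y + exp (- Re l * t) *\<^sub>R T t ?y" unfolding xy by (simp add: scaleC_of_real del: of_real_minus)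
  have "0 \<le> Re (cinner ?y (exp (- Re l * t) *\<^sub>R T t ?y))"
  proof -
    have "Re (cinner ?y (T t ?y)) = (norm (T (t / 2) ?y))\<^sup>2"
      using T_half[OF t, of ?y] T_symmetric[OF t, of ?y ?y] by simp
    then show ?thesis by (simp add: cinner_scaleR_right)
  qed
  then have "(norm ?y)\<^sup>2 \<le> (norm x)\<^sup>2" unfolding x2 norm_add_square by simp
  then have "norm ?y \<le> norm x" by (rule power2_le_imp_le) simp
  also have "\<dots> \<le> C0 * (norm v / Re l powr (1 / enn2real p))"
    using x(2) exponential_input(2)[OF q l(1) t, of v] C0 by (meson mult_left_mono less_imp_le order_trans)
  finally show ?thesis by simp
qed

lemma resolvent_condition_all:
  assumes l: "0 < Re l" "l \<in> rho"
    and nonreal: "\<And>m. 0 < Re m \<Longrightarrow> Im m \<noteq> 0 \<Longrightarrow> norm (Y m x) \<le> K / Re m powr k"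
  shows "norm (Y l x) \<le> K / Re l powr k"
proof (cases "Im l = 0")
  case True
  define e where "e n = 1 / real (Suc n)" for n
  define m where "m n = l + \<i> * complex_of_real (e n)" for n
  have en: "0 < e n" for n by (simp add: e_def)
  have m: "Re (m n) = Re l" "Im (m n) = e n" for n using True by (auto simp: m_def)
  have mr: "m n \<in> rho" for n using m en[of n] by (intro nonreal_in_rho) simp
  obtain B where B: "0 < B" "\<And>x. norm (R l x) \<le> norm x * B"
    using bounded_linear.pos_bounded[OF R_bounded_linear[OF l(2)]] by blast
  let ?K = "K / Re l powr k"
  have bnd: "norm (Y l x) \<le> ?K + e n * (?K * B)" for n
  proof -
    \<comment> \<open>The resolvent identity for \<open>Y\<close>, verified after applying the
      injective \<open>R s\<close>. Its correction term carries the norm of \<open>R l\<close> at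
      the fixed point \<open>l\<close>, so it vanishes as \<open>m n\<close> tends to
      \<open>l\<close>.\<close>
    have "R s (Y l x) = R s (Y (m n) x + (m n - l) *\<^sub>C R l (Y (m n) x))"
      using resolvent_identity[OF l(2) mr[of n], of x] R_commute[OF s_in_rho l(2), of "Y (m n) x"]
      by (simp add: R_s_Y l(2) mr linear_add[OF R_linear[OF s_in_rho]] R_scaleC[OF s_in_rho] algebra_simps)
    then have "Y l x = Y (m n) x + (m n - l) *\<^sub>C R l (Y (m n) x)" by (rule R_s_inj)
    then have "norm (Y l x) \<le> norm (Y (m n) x) + cmod (m n - l) * norm (R l (Y (m n) x))"
      by (metis norm_triangle_ineq norm_scaleC)
    also have "cmod (m n - l) = e n" using en[of n] by (simp add: m_def norm_mult)
    also have "norm (R l (Y (m n) x)) \<le> norm (Y (m n) x) * B" by (rule B)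
    finally have 1: "norm (Y l x) \<le> norm (Y (m n) x) + e n * (norm (Y (m n) x) * B)"
      using en[of n] by (simp add: mult_left_mono)
    have "norm (Y (m n) x) \<le> ?K" using nonreal[of "m n"] m[of n] en[of n] l by simp
    then have "norm (Y (m n) x) + e n * (norm (Y (m n) x) * B) \<le> ?K + e n * (?K * B)"
      using en[of n] B by (intro add_mono mult_left_mono mult_right_mono) auto
    with 1 show ?thesis by linarith
  qed
  have "e \<longlonglongrightarrow> 0" unfolding e_def using LIMSEQ_inverse_real_of_nat by (simp add: inverse_eq_divide)
  then have "(\<lambda>n. ?K + e n * (?K * B)) \<longlonglongrightarrow> ?K + 0 * (?K * B)" by (intro tendsto_intros)
  then show ?thesis using LIMSEQ_le_const[of _ "?K"] bnd by fastforce
qed (use nonreal l in simp)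

end

subsection \<open>The resolvent condition implies admissibility\<close>

context extrapolated_self_adjoint
begin

text \<open>The bounded operator \<open>(s - A) T(e)\<close>. At \<open>x = E y\<close> its value is
  the vector of \<open>X\<close> representing the extended \<open>T(e) y\<close>, since
  \<open>R s (Sm e x) = T e x\<close>.\<close>

definition Sm :: "real \<Rightarrow> 'x \<Rightarrow> 'x" where "Sm e x = s *\<^sub>C T e x - Op (T e x)"

lemma T_in_D_pos: "0 < e \<Longrightarrow> T e x \<in> D"
  by (rule smoothing(1)[OF growth_a])

lemma Sm_bounded_linear:
  assumes e: "0 < e"
  shows "bounded_linear (Sm e)"
proof (rule bounded_linear_intro[where K = "(cmod s + a) * exp (a * e) + 2 * exp (a * e) / e"])
  have e': "0 \<le> e" using e by simp
  show "Sm e (x + y) = Sm e x + Sm e y" for x y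
    using T_in_D_pos[OF e] e'
    by (simp add: Sm_def linear_add[OF T_linear] Op_add scaleC_add_right del: domIff)
  show "Sm e (r *\<^sub>R x) = r *\<^sub>R Sm e x" for r x
    using T_in_D_pos[OF e] e'
    by (simp add: Sm_def linear_cmul[OF T_linear] Op_scaleR scaleC.scaleR_right scaleR_diff_right del: domIff)
  show "norm (Sm e x) \<le> norm x * ((cmod s + a) * exp (a * e) + 2 * exp (a * e) / e)" for x
  proof -
    have "Sm e x = (s *\<^sub>C T e x - a *\<^sub>R T e x) - (Op (T e x) - a *\<^sub>R T e x)" by (simp add: Sm_def)
    then have "norm (Sm e x) \<le> norm (s *\<^sub>C T e x - a *\<^sub>R T e x) + norm (Op (T e x) - a *\<^sub>R T e x)"
      by (metis norm_triangle_ineq4)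
    also have "norm (s *\<^sub>C T e x - a *\<^sub>R T e x) \<le> cmod s * norm (T e x) + a * norm (T e x)"
      using norm_triangle_ineq4[of "s *\<^sub>C T e x" "a *\<^sub>R T e x"] a_nonneg by (simp add: norm_scaleC)
    also have "\<dots> = (cmod s + a) * norm (T e x)" by (simp add: algebra_simps)
    also have "\<dots> \<le> (cmod s + a) * (exp (a * e) * norm x)"
      using a_nonneg by (intro mult_left_mono T_norm e') auto
    also have "norm (Op (T e x) - a *\<^sub>R T e x) \<le> 2 * exp (a * e) * norm x / e"
      by (rule smoothing(2)[OF growth_a e])
    finally show ?thesis by (simp add: algebra_simps)
  qed
qed

lemma T_Sm: "0 < e \<Longrightarrow> 0 \<le> h \<Longrightarrow> T h (Sm e x) = Sm (e + h) x"
  using T_in_D_pos[of e x] T_add[of h e x]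
  by (simp add: Sm_def linear_diff[OF T_linear] T_scaleC Op_T add.commute del: domIff)

lemma Sm_T: "0 < e \<Longrightarrow> 0 \<le> h \<Longrightarrow> Sm e (T h x) = Sm (e + h) x"
  by (simp add: Sm_def T_add)

lemma cinner_Sm_midpoint:
  assumes "0 < d" "0 < e"
  shows "cinner (Sm d x) (Sm e z) = cinner (Sm ((d + e) / 2) x) (Sm ((d + e) / 2) z)"
proof -
  have *: "cinner (Sm d x) (Sm e z) = cinner (Sm ((d + e) / 2) x) (Sm ((d + e) / 2) z)"
    if "0 < e" "e \<le> d" for d e x z
  proof -
    let ?m = "(d + e) / 2" and ?h = "(d - e) / 2"
    have m: "?m + ?h = d" "e + ?h = ?m" by (simp_all add: field_simps)
    have "Sm d x = T ?h (Sm ?m x)" "Sm ?m z = T ?h (Sm e z)"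
      using T_Sm[of ?m ?h x] T_Sm[of e ?h z] that unfolding m by simp_all
    then show ?thesis using T_symmetric[of ?h "Sm ?m x" "Sm e z"] that by simp
  qed
  show ?thesis
  proof (cases "e \<le> d")
    case True
    then show ?thesis using * assms by blast
  next
    case False
    then have "cinner (Sm e z) (Sm d x) = cinner (Sm ((d + e) / 2) z) (Sm ((d + e) / 2) x)"
      using *[of d e z x] assms by (simp add: add.commute)
    then show ?thesis by (metis cinner_commute)
  qed
qed

text \<open>Here the resolvent condition is used at a single point whose real part is
  \<open>1 / t\<close>. Since \<open>(s - A) T(t) x = (l - A) T(t) Y(l) x\<close>, the contractive
  orbit of \<open>Y l x\<close> and the smoothing estimate give a bound of order
  \<open>1 / t\<close> times \<open>norm (Y l x)\<close>.\<close>

lemma Sm_bound: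
  assumes K: "\<And>l. l \<in> rho \<Longrightarrow> 0 < Re l \<Longrightarrow> norm (Y l x) \<le> K / Re l powr k" and k: "0 \<le> k" and t: "0 < t"
  shows "norm (Sm t x) \<le> 4 * K * t powr (k - 1)"
proof -
  have K0: "0 \<le> K" using order_trans[OF norm_ge_zero K[of "Complex 1 1"]] nonreal_in_rho[of "Complex 1 1"] by simp
  have "resolvent_bounded x"
    unfolding resolvent_bounded_def
  proof (intro allI impI)
    fix c :: real assume c: "0 < c"
    obtain B where B: "0 < B" "\<And>x. norm (R s x) \<le> norm x * B"
      using bounded_linear.pos_bounded[OF R_bounded_linear[OF s_in_rho]] by blast
    have "norm (R l x) \<le> K / c powr k * B" if "l \<in> rho" "c \<le> Re l" for l
    proof -
      have "norm (R l x) \<le> norm (Y l x) * B" using B(2)[of "Y l x"] R_s_Y[OF that(1), of x] by simp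
      also have "\<dots> \<le> (K / Re l powr k) * B" using K[OF that(1)] that c B by (intro mult_right_mono) auto
      also have "\<dots> \<le> (K / c powr k) * B"
        using that c k K0 B by (intro mult_right_mono divide_left_mono powr_mono2) auto
      finally show ?thesis .
    qed
    then show "\<exists>K. \<forall>l\<in>rho. c \<le> Re l \<longrightarrow> norm (R l x) \<le> K" by blast
  qed
  then have gx: "growth 0 x" by (rule resolvent_bounded_imp_growth)
  \<comment> \<open>The imaginary part guarantees a resolvent point even if \<open>1 / t\<close> is
    in the spectrum. It makes \<open>cmod l \<le> 2 / t\<close>, which matches the constant 2 of the
    smoothing estimate; hence the 4.\<close>
  define l where "l = Complex (1 / t) (1 / t)"
  have l: "l \<in> rho" "Re l = 1 / t" using t by (auto simp: l_def intro: nonreal_in_rho)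
  have cl: "cmod l \<le> 2 / t" using cmod_le[of l] t by (simp add: l_def)
  let ?y = "Y l x"
  have gy: "growth 0 ?y" unfolding Y_def by (intro growth_add growth_scaleC growth_R gx l)
  have t': "0 \<le> t" using t by simp
  have eq: "Sm t x = l *\<^sub>C T t ?y - Op (T t ?y)"
  proof -
    have p: "T t (R l x) \<in> D" "Op (T t (R l x)) = l *\<^sub>C T t (R l x) - T t x"
      using R_in_D[OF l(1)] Op_R[OF l(1)] T_R_commute[OF t' l(1)] by simp_all
    have Ty: "T t ?y = T t x + (s - l) *\<^sub>C T t (R l x)"
      using t' by (simp add: Y_def linear_add[OF T_linear] T_scaleC)
    have "Op (T t ?y) = Op (T t x) + (s - l) *\<^sub>C (l *\<^sub>C T t (R l x) - T t x)"
      unfolding Ty using p T_in_D_pos[OF t] by (simp add: Op_add Op_scaleC D_scaleC del: domIff)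
    then show ?thesis unfolding Ty Sm_def
      by (simp add: scaleC.diff_left scaleC.diff_right scaleC_add_right scaleC_scaleC mult.commute
          left_diff_distrib right_diff_distrib)
  qed
  have "norm (Sm t x) \<le> cmod l * norm (T t ?y) + norm (Op (T t ?y))"
    unfolding eq using norm_triangle_ineq4[of "l *\<^sub>C T t ?y" "Op (T t ?y)"] by (simp add: norm_scaleC)
  also have "\<dots> \<le> (2 / t) * norm ?y + (2 / t) * norm ?y"
  proof (intro add_mono mult_mono cl)
    show "norm (T t ?y) \<le> norm ?y" using gy t by (simp add: growth_def)
    show "norm (Op (T t ?y)) \<le> (2 / t) * norm ?y" using smoothing(2)[OF gy t] by simp
  qed (use t in auto)
  also have "\<dots> = (4 / t) * norm ?y" by simp
  also have "\<dots> \<le> (4 / t) * (K / (1 / t) powr k)"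
    using K[OF l(1)] l t by (intro mult_left_mono) auto
  also have "\<dots> = 4 * K * t powr (k - 1)" using t by (simp add: powr_divide powr_diff)
  finally show ?thesis .
qed

section \<open>Existence of the state integral\<close>

lemma orbit_strongly_measurable:
  fixes b :: "'u::cbanach \<Rightarrow> 'x"
  assumes b: "bounded_linear b" and u: "strongly_measurable (lebesgue_on {0..t}) u"
  shows "strongly_measurable (lebesgue_on {0..t}) (\<lambda>r. T (t - r) (b (u r)))"
proof -
  let ?M = "lebesgue_on {0..t}"
  obtain g where g: "\<And>n::nat. simple_function ?M (g n)" "AE r in ?M. (\<lambda>n. g n r) \<longlonglongrightarrow> u r"
    using u unfolding strongly_measurable_def by blast
  \<comment> \<open>Times are rounded down, so \<open>t - d n r\<close> never becomes negative and
    the semigroup stays defined; on \<open>{0..t}\<close> only finitely many values occur.\<close>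
  define d where "d n r = real_of_int \<lfloor>r * real (Suc n)\<rfloor> / real (Suc n)" for n r
  have d_le: "d n r \<le> r" and d_ge: "r - 1 / real (Suc n) \<le> d n r" and d_0: "0 \<le> r \<Longrightarrow> 0 \<le> d n r" for n r
  proof -
    have "real_of_int \<lfloor>r * real (Suc n)\<rfloor> \<le> r * real (Suc n)" "r * real (Suc n) - 1 \<le> real_of_int \<lfloor>r * real (Suc n)\<rfloor>"
      by linarith+
    from divide_right_mono[OF this(1), of "real (Suc n)"] divide_right_mono[OF this(2), of "real (Suc n)"]
    show "d n r \<le> r" "r - 1 / real (Suc n) \<le> d n r" unfolding d_def
      by (simp_all add: diff_divide_distrib del: of_nat_Suc)
    show "0 \<le> r \<Longrightarrow> 0 \<le> d n r" by (simp add: d_def)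
  qed
  have ds: "simple_function ?M (d n)" for n
  proof (rule simple_function_borel_measurable)
    have "d n \<in> borel_measurable borel" unfolding d_def by measurable
    from measurable_compose[OF id_measurable_lebesgue_on this] show "d n \<in> borel_measurable ?M" by simp
    have "d n ` space ?M \<subseteq> (\<lambda>k. real_of_int k / real (Suc n)) ` {0..\<lfloor>t * real (Suc n)\<rfloor>}"
      by (auto simp: d_def space_restrict_space intro!: imageI floor_mono mult_right_mono)
    then show "finite (d n ` space ?M)" by (rule finite_subset) simp
  qed
  have "AE r in ?M. (\<lambda>n. T (t - d n r) (b (g n r))) \<longlonglongrightarrow> T (t - r) (b (u r))"
    using g(2) AE_space
  proof eventually_elim
    case (elim r)
    then have r: "0 \<le> r" "r \<le> t" by (auto simp: space_restrict_space)
    have nn: "0 \<le> t - d n r" "t - d n r \<le> t" for n using d_le[of n r] d_0[OF r(1), of n] r by auto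
    have bg: "(\<lambda>n. b (g n r)) \<longlonglongrightarrow> b (u r)" by (rule bounded_linear.tendsto[OF b elim(1)])
    \<comment> \<open>The semigroup is only strongly continuous, so the approximation of the vector
      is separated from that of the time; the former uses the uniform bound of \<open>T\<close> on
      \<open>{0..t}\<close>.\<close>
    have "(\<lambda>n. T (t - d n r) (b (g n r) - b (u r))) \<longlonglongrightarrow> 0"
    proof (rule tendsto_zero_norm_le)
      fix n
      have "norm (T (t - d n r) (b (g n r) - b (u r))) \<le> exp (a * (t - d n r)) * norm (b (g n r) - b (u r))"
        by (rule T_norm[OF nn(1)])
      also have "\<dots> \<le> exp (a * t) * norm (b (g n r) - b (u r))"
        using nn(2)[of n] a_nonneg by (intro mult_right_mono) (auto intro: mult_left_mono)
      finally show "norm (T (t - d n r) (b (g n r) - b (u r))) \<le> exp (a * t) * norm (b (g n r) - b (u r))" .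
    next
      show "(\<lambda>n. exp (a * t) * norm (b (g n r) - b (u r))) \<longlonglongrightarrow> 0"
        using bg by (intro tendsto_mult_right_zero tendsto_norm_zero) (simp add: LIM_zero_iff)
    qed
    moreover have "(\<lambda>n. T (t - d n r) (b (u r))) \<longlonglongrightarrow> T (t - r) (b (u r))"
    proof -
      have "(\<lambda>n. d n r) \<longlonglongrightarrow> r"
      proof (rule tendsto_sandwich[of "\<lambda>n. r - 1 / real (Suc n)" _ _ "\<lambda>_. r"])
        have "(\<lambda>n. r - 1 / real (Suc n)) \<longlonglongrightarrow> r - 0"
          using LIMSEQ_inverse_real_of_nat by (intro tendsto_intros) (simp add: inverse_eq_divide)
        then show "(\<lambda>n. r - 1 / real (Suc n)) \<longlonglongrightarrow> r" by simp
      qed (use d_le d_ge in auto)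
      then have "(\<lambda>n. t - d n r) \<longlonglongrightarrow> t - r" by (intro tendsto_intros)
      then show ?thesis
        using nn r by (intro continuous_on_tendsto_compose[OF T_continuous_on]) auto
    qed
    ultimately have "(\<lambda>n. T (t - d n r) (b (g n r) - b (u r)) + T (t - d n r) (b (u r))) \<longlonglongrightarrow> 0 + T (t - r) (b (u r))"
      by (rule tendsto_add)
    then show ?case using nn by (simp add: linear_diff[OF T_linear])
  qed
  moreover have "simple_function ?M (\<lambda>r. T (t - d n r) (b (g n r)))" for n
    by (rule simple_function_compose2[OF ds g(1), of "\<lambda>x y. T (t - x) (b y)"])
  ultimately show ?thesis
    unfolding strongly_measurable_def by (intro exI[of _ "\<lambda>n r. T (t - d n r) (b (g n r))"]) auto
qed

lemma orbit_strong_integral: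
  fixes b :: "'u::cbanach \<Rightarrow> 'x"
  assumes b: "bounded_linear b" and q: "1 \<le> q" and t: "0 \<le> t"
    and u: "strongly_measurable (lebesgue_on {0..t}) u" "integrable (lebesgue_on {0..t}) (\<lambda>r. norm (u r) powr q)"
  shows "\<exists>I. has_strong_integral (lebesgue_on {0..t}) (\<lambda>r. T (t - r) (b (u r))) I"
proof -
  let ?M = "lebesgue_on {0..t}"
  interpret finite_measure ?M by (rule finite_measure_lebesgue_on_Icc)
  obtain K where K: "0 < K" "\<And>v. norm (b v) \<le> norm v * K" using bounded_linear.pos_bounded[OF b] by blast
  show ?thesis
  proof (rule has_strong_integral_dominated[OF orbit_strongly_measurable[OF b u(1)]])
    show "integrable ?M (\<lambda>r. exp (a * t) * ((1 + norm (u r) powr q) * K))"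
      using u(2) by (intro integrable_mult_right integrable_mult_left integrable_add) auto
    show "AE r in ?M. norm (T (t - r) (b (u r))) \<le> exp (a * t) * ((1 + norm (u r) powr q) * K)"
    proof (rule AE_I2)
      fix r assume "r \<in> space ?M"
      then have r: "0 \<le> r" "r \<le> t" by (auto simp: space_restrict_space)
      \<comment> \<open>On a bounded interval the power \<open>q\<close> of the norm, together with
        the constant 1, dominates the norm itself, so one integrable majorant serves all
        exponents.\<close>
      have n1: "norm (u r) \<le> 1 + norm (u r) powr q"
      proof (cases "norm (u r) \<le> 1")
        case False
        then have "norm (u r) powr 1 \<le> norm (u r) powr q" using q by (intro powr_mono) auto
        then show ?thesis using False by simp
      qed (simp add: add_increasing2)
      have "norm (T (t - r) (b (u r))) \<le> exp (a * (t - r)) * norm (b (u r))" using r by (intro T_norm) simp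
      also have "\<dots> \<le> exp (a * t) * ((1 + norm (u r) powr q) * K)"
      proof (intro mult_mono)
        show "exp (a * (t - r)) \<le> exp (a * t)" using r a_nonneg by (auto intro: mult_left_mono)
        have "norm (b (u r)) \<le> norm (u r) * K" by (rule K)
        also have "\<dots> \<le> (1 + norm (u r) powr q) * K" using n1 K by (intro mult_right_mono) auto
        finally show "norm (b (u r)) \<le> (1 + norm (u r) powr q) * K" .
      qed auto
      finally show "norm (T (t - r) (b (u r))) \<le> exp (a * t) * ((1 + norm (u r) powr q) * K)" .
    qed
  qed
qed

text \<open>The squared norm is expanded into a double integral of pairings, as in a TT* argument,
  and estimated by \<open>double_integral_bound\<close>. The bound does not depend on
  \<open>e\<close>. Working with upper bounds of nonnegative integrals avoids any question of joint
  measurability of the pairings.\<close>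

lemma Sm_integral_bound:
  fixes b :: "'u::cbanach \<Rightarrow> 'x"
  assumes q: "1 \<le> q" "q \<le> 2" and M: "0 < M"
    and K: "\<And>l v. l \<in> rho \<Longrightarrow> 0 < Re l \<Longrightarrow> norm (Y l (b v)) \<le> M * norm v / Re l powr (1 / q)"
    and t: "0 \<le> t" and u: "integrable (lebesgue_on {0..t}) (\<lambda>r. norm (u r) powr q)"
    and I: "has_strong_integral (lebesgue_on {0..t}) (\<lambda>r. T (t - r) (b (u r))) I" and e: "0 < e"
  shows "norm (Sm e I) \<le> 13 * M * (\<integral>r. norm (u r) powr q \<partial>lebesgue_on {0..t}) powr (1 / q)"
proof -
  let ?M = "lebesgue_on {0..t}"
  define N where "N = (\<integral>r. norm (u r) powr q \<partial>?M)"
  define w where "w r = Sm (e + t - r) (b (u r))" for r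
  define k where "k = 1 - 1 / q"
  have k: "0 \<le> k" "2 * k \<le> 1" using q by (auto simp: k_def field_simps)
  define f where "f r = norm (u r)" for r
  have fm: "f \<in> borel_measurable ?M"
  proof -
    have "(\<lambda>r. (norm (u r) powr q) powr (1 / q)) \<in> borel_measurable ?M"
      using borel_measurable_integrable[OF u] by measurable
    moreover have "(norm (u r) powr q) powr (1 / q) = f r" for r using q by (simp add: powr_powr f_def)
    ultimately show ?thesis by simp
  qed
  have cin: "ennreal (cmod (cinner (Sm e I) z)) \<le> (\<integral>\<^sup>+r. ennreal (cmod (cinner (w r) z)) \<partial>?M)" for z
  proof -
    have "bounded_linear (\<lambda>x. cinner (Sm e x) z)"
      by (rule bounded_linear_compose[OF cinner.bounded_linear_left Sm_bounded_linear[OF e]])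
    from has_bochner_integral_strong_integral[OF complete_measure_lebesgue_on this I]
    have hb: "has_bochner_integral ?M (\<lambda>r. cinner (Sm e (T (t - r) (b (u r)))) z) (cinner (Sm e I) z)" by simp
    then have "ennreal (cmod (cinner (Sm e I) z)) \<le> (\<integral>\<^sup>+r. ennreal (cmod (cinner (Sm e (T (t - r) (b (u r)))) z)) \<partial>?M)"
      using integral_norm_bound_ennreal[of ?M "\<lambda>r. cinner (Sm e (T (t - r) (b (u r)))) z"]
      by (auto simp: has_bochner_integral_iff)
    also have "\<dots> = (\<integral>\<^sup>+r. ennreal (cmod (cinner (w r) z)) \<partial>?M)"
      using e by (intro nn_integral_cong) (simp add: Sm_T w_def space_restrict_space add_diff_eq)
    finally show ?thesis .
  qed
  have kernel: "cmod (cinner (w r') (w r)) \<le> 32 * M\<^sup>2 * (f r * f r' * ((e + t - r) + (e + t - r')) powr (- 2 * k))"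
    if r: "r \<in> {0..t}" "r' \<in> {0..t}" for r r'
  proof -
    let ?d = "(e + t - r) + (e + t - r')"
    let ?m = "((e + t - r') + (e + t - r)) / 2"
    have pos: "0 < e + t - r" "0 < e + t - r'" "0 < ?m" "0 < ?d" using r e by auto
    have Sb: "norm (Sm ?m (b v)) \<le> 4 * (M * norm v) * ?m powr (- k)" for v
      using Sm_bound[of "b v" "M * norm v" "1 / q" ?m] K pos(3) q by (simp add: k_def)
    have "cinner (w r') (w r) = cinner (Sm ?m (b (u r'))) (Sm ?m (b (u r)))"
      unfolding w_def by (rule cinner_Sm_midpoint[OF pos(2,1)])
    then have "cmod (cinner (w r') (w r)) \<le> norm (Sm ?m (b (u r'))) * norm (Sm ?m (b (u r)))"
      by (simp add: norm_cinner_le)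
    also have "\<dots> \<le> (4 * (M * f r') * ?m powr (- k)) * (4 * (M * f r) * ?m powr (- k))"
      unfolding f_def using M by (intro mult_mono Sb) auto
    also have "\<dots> = 16 * M\<^sup>2 * (f r * f r') * (?m powr (- k) * ?m powr (- k))"
      by (simp add: power2_eq_square)
    \<comment> \<open>The midpoint \<open>?m\<close> is half of \<open>?d\<close>, and
      \<open>2 * k \<le> 1\<close>, which is \<open>q \<le> 2\<close>, bounds the resulting factor
      by 2.\<close>
    also have "\<dots> \<le> 16 * M\<^sup>2 * (f r * f r') * (2 * ?d powr (- 2 * k))"
    proof (rule mult_left_mono)
      have "?m powr (- k) * ?m powr (- k) = ?m powr (- 2 * k)" by (simp add: powr_add[symmetric])
      also have "?m powr (- 2 * k) = ?d powr (- 2 * k) * 2 powr (2 * k)"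
        using pos by (simp add: powr_divide powr_minus_divide add.commute)
      also have "\<dots> \<le> ?d powr (- 2 * k) * 2 powr (1::real)" using k by (intro mult_left_mono powr_mono) auto
      finally show "?m powr (- k) * ?m powr (- k) \<le> 2 * ?d powr (- 2 * k)" by simp
    qed (simp add: f_def)
    finally show ?thesis by (simp only: mult_ac)
  qed
  have "ennreal ((norm (Sm e I))\<^sup>2) = ennreal (cmod (cinner (Sm e I) (Sm e I)))"
    by (simp add: cinner_self_norm norm_power)
  also have "\<dots> \<le> (\<integral>\<^sup>+r. ennreal (cmod (cinner (w r) (Sm e I))) \<partial>?M)" by (rule cin)
  \<comment> \<open>The integral representation is used a second time, now paired with
    \<open>w r\<close> in place of \<open>Sm e I\<close>.\<close>
  also have "\<dots> \<le> (\<integral>\<^sup>+r. (\<integral>\<^sup>+r'. ennreal (cmod (cinner (w r') (w r))) \<partial>?M) \<partial>?M)"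
  proof (rule nn_integral_mono)
    fix r
    have "cmod (cinner (w r) (Sm e I)) = cmod (cinner (Sm e I) (w r))" by (metis cinner_commute complex_mod_cnj)
    then show "ennreal (cmod (cinner (w r) (Sm e I))) \<le> (\<integral>\<^sup>+r'. ennreal (cmod (cinner (w r') (w r))) \<partial>?M)"
      using cin[of "w r"] by simp
  qed
  also have "\<dots> \<le> (\<integral>\<^sup>+r. ennreal (32 * M\<^sup>2) * (\<integral>\<^sup>+r'. ennreal (f r * f r' * ((e + t - r) + (e + t - r')) powr (- 2 * k)) \<partial>?M) \<partial>?M)"
  proof (rule nn_integral_mono)
    fix r assume r: "r \<in> space ?M"
    have "(\<integral>\<^sup>+r'. ennreal (cmod (cinner (w r') (w r))) \<partial>?M)
        \<le> (\<integral>\<^sup>+r'. ennreal (32 * M\<^sup>2) * ennreal (f r * f r' * ((e + t - r) + (e + t - r')) powr (- 2 * k)) \<partial>?M)"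
    proof (rule nn_integral_mono)
      fix r' assume "r' \<in> space ?M"
      then show "ennreal (cmod (cinner (w r') (w r))) \<le> ennreal (32 * M\<^sup>2) * ennreal (f r * f r' * ((e + t - r) + (e + t - r')) powr (- 2 * k))"
        using ennreal_leI[OF kernel[of r r']] r M by (simp add: ennreal_mult f_def space_restrict_space)
    qed
    also have "\<dots> \<le> ennreal (32 * M\<^sup>2) * (\<integral>\<^sup>+r'. ennreal (f r * f r' * ((e + t - r) + (e + t - r')) powr (- 2 * k)) \<partial>?M)"
      using M by (intro nn_integral_cmult_le) simp
    finally show "(\<integral>\<^sup>+r'. ennreal (cmod (cinner (w r') (w r))) \<partial>?M)
      \<le> ennreal (32 * M\<^sup>2) * (\<integral>\<^sup>+r'. ennreal (f r * f r' * ((e + t - r) + (e + t - r')) powr (- 2 * k)) \<partial>?M)" .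
  qed
  also have "\<dots> \<le> ennreal (32 * M\<^sup>2) * (\<integral>\<^sup>+r. (\<integral>\<^sup>+r'. ennreal (f r * f r' * ((e + t - r) + (e + t - r')) powr (- 2 * k)) \<partial>?M) \<partial>?M)"
    using M by (intro nn_integral_cmult_le) simp
  also have "\<dots> \<le> ennreal (32 * M\<^sup>2) * ennreal (5 * N powr (2 / q))"
    using double_integral_bound[OF fm _ _ q e t] u unfolding k_def N_def f_def by (intro mult_left_mono) auto
  also have "\<dots> = ennreal (32 * M\<^sup>2 * (5 * N powr (2 / q)))" by (rule ennreal_mult[symmetric]) auto
  finally have "(norm (Sm e I))\<^sup>2 \<le> 32 * M\<^sup>2 * (5 * N powr (2 / q))" by (subst (asm) ennreal_le_iff) auto
  \<comment> \<open>The constant 32 * 5 = 160 is rounded up to the square of 13.\<close>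
  also have "\<dots> \<le> 169 * M\<^sup>2 * N powr (2 / q)" by (simp add: mult_right_mono)
  also have "\<dots> = (13 * M * N powr (1 / q))\<^sup>2"
    by (simp add: power_mult_distrib power2_eq_square powr_add[symmetric])
  finally show ?thesis unfolding N_def using M by (intro power2_le_imp_le[of "norm (Sm e I)"]) (auto simp: N_def)
qed

text \<open>The midpoint identity replaces weak compactness: by it, the squared distance of
  \<open>Sm d x\<close> and \<open>Sm e x\<close> is the sum of their squared norms minus twice the
  squared norm at the midpoint. Up to exponential factors the norms increase to a limit as the time
  decreases to 0, so the distances vanish.\<close>

lemma bounded_Sm_in_D:
  assumes bound: "\<And>e. 0 < e \<Longrightarrow> norm (Sm e x) \<le> K"
  obtains y where "x = R s y" "norm y \<le> K"
proof -
  define e where "e n = 1 / real (Suc n)" for n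
  have e: "0 < e n" "e n \<le> 1" for n by (auto simp: e_def)
  have e_mono: "e m \<le> e n" if "n \<le> m" for n m using that by (auto simp: e_def field_simps)
  have e_lim: "e \<longlonglongrightarrow> 0" unfolding e_def using LIMSEQ_inverse_real_of_nat by (simp add: inverse_eq_divide)
  \<comment> \<open>The factor turns \<open>T\<close> into a contraction semigroup, so
    \<open>psi\<close> is decreasing and its values at \<open>e n\<close> converge upwards.\<close>
  define psi where "psi d = exp (- a * d) * norm (Sm d x)" for d
  have psi_mono: "psi d' \<le> psi d" if "0 < d" "d \<le> d'" for d d'
  proof -
    have "norm (Sm d' x) \<le> exp (a * (d' - d)) * norm (Sm d x)"
      using T_Sm[of d "d' - d" x] T_norm[of "d' - d" "Sm d x"] that by simp
    then have "exp (- a * d') * norm (Sm d' x) \<le> exp (- a * d') * (exp (a * (d' - d)) * norm (Sm d x))"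
      by (rule mult_left_mono) simp
    also have "\<dots> = exp (- a * d) * norm (Sm d x)" by (simp add: mult.assoc[symmetric] exp_add[symmetric] algebra_simps)
    finally show ?thesis by (simp add: psi_def)
  qed
  have psi_0: "0 \<le> psi d" for d by (simp add: psi_def)
  have psi_K: "psi d \<le> K" if "0 < d" for d
  proof -
    have "psi d \<le> 1 * norm (Sm d x)" unfolding psi_def using that a_nonneg by (intro mult_right_mono) auto
    then show ?thesis using bound[OF that] by simp
  qed
  have "incseq (\<lambda>n. psi (e n))" using psi_mono e_mono e by (auto simp: incseq_def)
  then obtain L where L: "(\<lambda>n. psi (e n)) \<longlonglongrightarrow> L" "\<And>n. psi (e n) \<le> L"
    using incseq_convergent[of "\<lambda>n. psi (e n)" K] psi_K e by blast
  have psi_L: "psi d \<le> L" if d: "0 < d" for d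
  proof -
    obtain n where "e n < d" using reals_Archimedean[OF d] by (auto simp: e_def inverse_eq_divide)
    then show ?thesis using psi_mono[OF e(1), of n d] L(2)[of n] by linarith
  qed
  have L0: "0 \<le> L" using psi_0[of "e 0"] L(2)[of 0] by linarith
  have upper: "(norm (Sm d x))\<^sup>2 \<le> (exp (a * e n) * L)\<^sup>2" if "0 < d" "d \<le> e n" for d n
  proof -
    have "norm (Sm d x) = exp (a * d) * psi d" by (simp add: psi_def exp_minus)
    also have "\<dots> \<le> exp (a * e n) * L"
      using that a_nonneg psi_L[OF that(1)] psi_0 by (intro mult_mono) (auto intro: mult_left_mono)
    finally show ?thesis by (intro power_mono) auto
  qed
  have lower: "(psi (e n))\<^sup>2 \<le> (norm (Sm d x))\<^sup>2" if "0 < d" "d \<le> e n" for d n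
  proof -
    have "psi (e n) \<le> psi d" using psi_mono that by blast
    also have "\<dots> \<le> 1 * norm (Sm d x)" unfolding psi_def using that a_nonneg by (intro mult_right_mono) auto
    finally show ?thesis using psi_0 by (intro power_mono) auto
  qed
  \<comment> \<open>Upper bounds at the two times minus the lower bound at their midpoint; both
    parts tend to \<open>2 * L\<^sup>2\<close>.\<close>
  define h where "h n = 2 * (exp (a * e n) * L)\<^sup>2 - 2 * (psi (e n))\<^sup>2" for n
  have diff: "(norm (Sm (e k) x - Sm (e m) x))\<^sup>2 \<le> h n" if "n \<le> k" "n \<le> m" for n k m
  proof -
    let ?c = "(e k + e m) / 2"
    have c: "0 < ?c" "?c \<le> e n" using e[of k] e[of m] e_mono[OF that(1)] e_mono[OF that(2)] by (auto simp: field_simps)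
    have "(norm (Sm (e k) x - Sm (e m) x))\<^sup>2 = (norm (Sm (e k) x))\<^sup>2 + (norm (Sm (e m) x))\<^sup>2 - 2 * (norm (Sm ?c x))\<^sup>2"
      unfolding norm_diff_square cinner_Sm_midpoint[OF e(1) e(1)] by (simp add: Re_cinner_self)
    then show ?thesis
      using upper[OF e(1) e_mono[OF that(1)]] upper[OF e(1) e_mono[OF that(2)]] lower[OF c] by (simp add: h_def)
  qed
  have "h \<longlonglongrightarrow> 2 * (exp (a * 0) * L)\<^sup>2 - 2 * L\<^sup>2"
    unfolding h_def by (intro tendsto_intros e_lim L(1))
  then have h0: "h \<longlonglongrightarrow> 0" by simp
  have "Cauchy (\<lambda>n. Sm (e n) x)"
  proof (rule metric_CauchyI)
    fix eta :: real assume eta: "0 < eta"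
    then obtain n where n: "h n < eta\<^sup>2"
      using order_tendstoD(2)[OF h0, of "eta\<^sup>2"] by (auto simp: eventually_sequentially)
    show "\<exists>n. \<forall>k\<ge>n. \<forall>m\<ge>n. dist (Sm (e k) x) (Sm (e m) x) < eta"
    proof (intro exI[of _ n] allI impI)
      fix k m assume "n \<le> k" "n \<le> m"
      then have "(norm (Sm (e k) x - Sm (e m) x))\<^sup>2 < eta\<^sup>2" using diff[of n k m] n by linarith
      then show "dist (Sm (e k) x) (Sm (e m) x) < eta" using eta by (simp add: dist_norm power2_less_imp_less)
    qed
  qed
  then obtain y where y: "(\<lambda>n. Sm (e n) x) \<longlonglongrightarrow> y" using Cauchy_convergent convergent_def by blast
  have Tlim: "(\<lambda>n. T (e n) x) \<longlonglongrightarrow> x"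
    using continuous_on_tendsto_compose[OF T_continuous_on[of x] e_lim] e by (simp add: T_zero less_imp_le)
  have "(\<lambda>n. s *\<^sub>C T (e n) x - Sm (e n) x) \<longlonglongrightarrow> s *\<^sub>C x - y"
    by (intro tendsto_diff scaleC.tendsto tendsto_const Tlim y)
  then have "(\<lambda>n. Op (T (e n) x)) \<longlonglongrightarrow> s *\<^sub>C x - y" by (simp add: Sm_def)
  from closed_op[OF T_in_D_pos[OF e(1)] Tlim this] have "x \<in> D" "Op x = s *\<^sub>C x - y" by auto
  then have "x = R s y" using R_left[OF s_in_rho, of x] by simp
  moreover have "norm y \<le> K"
    by (rule LIMSEQ_le_const2[OF tendsto_norm[OF y]]) (use bound e in blast)
  ultimately show ?thesis using that by blast
qed

end

theorem proposition5p4: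
  fixes A :: "'x::chilbert_space unbounded_op"
    and j :: "'x \<Rightarrow> 'y::cbanach"
    and a :: real and p :: ennreal
  assumes "self_adjoint A"
    and "spectrum A \<subseteq> complex_of_real ` {..a}"
    and "extrapolation_space A j"
    and "1 \<le> p" and "p \<le> 2"
  shows "weiss_property TYPE('u::cbanach) p A j"
proof -
  obtain s where s: "s \<in> resolvent_set A" "\<And>z. norm (j z) = norm (resolvent s A z)"
    using assms(3) unfolding extrapolation_space_def by blast
  \<comment> \<open>The bound on the spectrum is enlarged to a nonnegative one, which makes
    \<open>exp (a * t)\<close> increasing in \<open>t\<close> and every real number beyond the bound
    positive.\<close>
  interpret extrapolated_self_adjoint A "max a 0" j s
  proof
    have "complex_of_real ` {..a} \<subseteq> complex_of_real ` {..max a 0}" by (intro image_mono) auto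
    then show "spectrum A \<subseteq> complex_of_real ` {..max a 0}" using assms(2) by blast
  qed (use assms s in \<open>auto simp: extrapolation_space_def\<close>)
  define q where "q = enn2real p"
  have "p < \<infinity>" using assms(5) by (rule le_less_trans) simp
  then have pfin: "p \<noteq> \<infinity>" by simp
  have pq: "p = ennreal q" using pfin by (simp add: q_def less_top)
  have q: "1 \<le> q" "q \<le> 2"
    using assms(4,5) enn2real_nonneg[of p] unfolding pq by (auto simp: q_def[symmetric] ennreal_le_iff2 simp flip: ennreal_1 ennreal_numeral)
  have invp: "enn2real (inverse p) = 1 / q"
    using q unfolding pq by (simp add: inverse_ennreal inverse_eq_divide)
  show ?thesis
    unfolding weiss_property_def
  proof (intro exI[of _ T] conjI allI impI generates_T)
    fix B :: "'u \<Rightarrow> 'y" assume B: "bounded_clinear B"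
    define b where "b v = E (B v)" for v
    have b: "bounded_clinear b" unfolding b_def[abs_def] by (rule bounded_clinear_comp[OF E_bounded_clinear B])
    have bl: "bounded_linear b" by (rule bounded_clinear_imp_bounded_linear[OF b])
    have adm: "infinite_time_admissible p T j B \<longleftrightarrow> (\<exists>C>0. \<forall>t\<ge>0. \<forall>u\<in>Lp_space p (lebesgue_on {0..t}).
        \<exists>x. has_strong_integral (lebesgue_on {0..t}) (\<lambda>r. T (t - r) (b (u r))) (R s x)
          \<and> norm x \<le> C * Lp_norm p (lebesgue_on {0..t}) u)"
      unfolding infinite_time_admissible_def strong_integral_iff b_def ..
    have ext: "(ext_resolvent j l A \<circ> B) v = Y l (b v)" if "l \<in> rho" for l v
      by (simp add: ext_resolvent_eq[OF that] b_def)
    have extl: "bounded_linear (ext_resolvent j l A \<circ> B)" if "l \<in> rho" for l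
      unfolding o_def by (rule bounded_linear_compose[OF bounded_clinear_imp_bounded_linear[OF ext_resolvent_props(1)[OF that]]
            bounded_clinear_imp_bounded_linear[OF B]])
    show "infinite_time_admissible p T j B \<longleftrightarrow> weiss_resolvent_condition p A j B"
    proof
      assume "infinite_time_admissible p T j B"
      then obtain C0 where C0: "0 < C0" "\<And>t u. 0 \<le> t \<Longrightarrow> u \<in> Lp_space p (lebesgue_on {0..t}) \<Longrightarrow>
          \<exists>x. has_strong_integral (lebesgue_on {0..t}) (\<lambda>r. T (t - r) (b (u r))) (R s x)
            \<and> norm x \<le> C0 * Lp_norm p (lebesgue_on {0..t}) u"
        unfolding adm by blast
      have "norm (Y m (b v)) \<le> C0 * norm v / Re m powr (1 / q)" if "0 < Re m" "Im m \<noteq> 0" for m v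
        using resolvent_condition_nonreal[OF b pfin _ C0(2,1) that, of v] q(1) unfolding q_def by blast
      then have Y: "norm (Y l (b v)) \<le> C0 * norm v / Re l powr (1 / q)" if "0 < Re l" "l \<in> rho" for l v
        by (rule resolvent_condition_all[OF that])
      have "Re l powr (1 / q) * onorm (ext_resolvent j l A \<circ> B) \<le> C0" if "0 < Re l" "l \<in> rho" for l
      proof -
        have "onorm (ext_resolvent j l A \<circ> B) \<le> C0 / Re l powr (1 / q)"
          using Y[OF that] C0(1) by (intro onorm_bound) (auto simp: ext[OF that(2)] simp del: o_apply)
        then show ?thesis using that by (simp add: field_simps)
      qed
      then show "weiss_resolvent_condition p A j B"
        unfolding weiss_resolvent_condition_def invp by (intro bdd_aboveI[of _ C0]) auto
    next
      assume "weiss_resolvent_condition p A j B"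
      then obtain M0 where M0: "\<And>l. l \<in> rho \<Longrightarrow> 0 < Re l \<Longrightarrow> Re l powr (1 / q) * onorm (ext_resolvent j l A \<circ> B) \<le> M0"
        unfolding weiss_resolvent_condition_def invp bdd_above_def by auto
      \<comment> \<open>Admissibility asks for a strictly positive constant, while \<open>M0\<close>
        may be zero or negative.\<close>
      define M where "M = \<bar>M0\<bar> + 1"
      have M: "0 < M" by (simp add: M_def add_nonneg_pos)
      have K: "norm (Y l (b v)) \<le> M * norm v / Re l powr (1 / q)" if "l \<in> rho" "0 < Re l" for l v
      proof -
        have "Re l powr (1 / q) * onorm (ext_resolvent j l A \<circ> B) \<le> M" using M0[OF that] by (simp add: M_def)
        then have "onorm (ext_resolvent j l A \<circ> B) \<le> M / Re l powr (1 / q)" using that by (simp add: field_simps)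
        then have "onorm (ext_resolvent j l A \<circ> B) * norm v \<le> M / Re l powr (1 / q) * norm v"
          by (rule mult_right_mono) simp
        then show ?thesis using onorm[OF extl[OF that(1)], of v] by (simp add: ext[OF that(1)] del: o_apply)
      qed
      show "infinite_time_admissible p T j B"
        unfolding adm
      proof (intro exI[of _ "13 * M"] conjI allI impI ballI)
        fix t :: real and u :: "real \<Rightarrow> 'u" assume t: "0 \<le> t" and u: "u \<in> Lp_space p (lebesgue_on {0..t})"
        then have um: "strongly_measurable (lebesgue_on {0..t}) u"
          and ui: "integrable (lebesgue_on {0..t}) (\<lambda>r. norm (u r) powr q)"
          using pfin by (auto simp: Lp_space_def q_def)
        obtain I where I: "has_strong_integral (lebesgue_on {0..t}) (\<lambda>r. T (t - r) (b (u r))) I"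
          using orbit_strong_integral[OF bl q(1) t um ui] by blast
        have "norm (Sm e I) \<le> 13 * M * Lp_norm p (lebesgue_on {0..t}) u" if "0 < e" for e
          using Sm_integral_bound[OF q M K t ui I that] pfin by (simp add: Lp_norm_def q_def)
        from bounded_Sm_in_D[OF this] obtain x where "I = R s x" "norm x \<le> 13 * M * Lp_norm p (lebesgue_on {0..t}) u"
          by blast
        with I show "\<exists>x. has_strong_integral (lebesgue_on {0..t}) (\<lambda>r. T (t - r) (b (u r))) (R s x)
            \<and> norm x \<le> 13 * M * Lp_norm p (lebesgue_on {0..t}) u" by blast
      qed (use M in simp)
    qed
  qed
qed

end
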